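(* Fix $\alpha\in(0,1)\cup(1,2)$ and set $\gamma=\alpha^{-1}$. Let $T$ be the Thaler map with parameter $\gamma$, let $Y=(x^\star,1]$, let $\mu_Y$ be the probability measure on $Y$, let $\tau_0,\tau_1,\dots$ be the successive return times to $Y$, and let $d_\alpha,\ell_\alpha$ be the constants, all as defined in the context. Then, on the probability space $(Y,\mu_Y)$, $$n^{-\gamma}\, d_\alpha^{-\gamma}\Big(\sum_{j=0}^{n-1}\tau_j-n\ell_\alpha\Big)\to_d X_{\alpha,1,1}\quad\text{as } n\to\infty .$$ That is, $$\mu_Y\Big\{y_0\in Y:\ n^{-\gamma} d_\alpha^{-\gamma}\Big(\sum_{j=0}^{n-1}\tau_j(y_0)-n\ell_\alpha\Big)\le c\Big\}\to \mathbb{P}(X_{\alpha,1,1}\le c)\quad\text{as } n\to\infty$$ for all $c\in\mathbb{R}$.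
   Context: Stable laws: for $\alpha\in(0,1)\cup(1,2)$, $\eta>0$, $\beta\in[-1,1]$, $X_{\alpha,\eta,\beta}$ denotes a real random variable with characteristic function $$\mathbb{E}(e^{itX_{\alpha,\eta,\beta}})=\exp\Big\{-\eta^\alpha|t|^\alpha\Big(1-i\beta\,\mathrm{sgn}(t)\tan\frac{\alpha\pi}{2}\Big)\Big\},\quad t\in\mathbb{R}.$$ Thaler map: for $\gamma\in(0,1)\cup(1,\infty)$, $T:[0,1]\to[0,1]$ is $$Tx=x\Big(1+\Big(\frac{x}{1+x}\Big)^{\gamma-1}-x^{\gamma-1}\Big)^{1/(1-\gamma)}\bmod 1,$$ equivalently $Tx=(x^{1-\gamma}+(1+x)^{1-\gamma}-1)^{1/(1-\gamma)}\bmod 1$ (with $T0=0$). Let $x^\star\in(0,1)$ be the unique solution of ${x^\star}^{1-\gamma}+(1+x^\star)^{1-\gamma}=2$, and $Y=(x^\star,1]$. Measure: let $h(x)=x^{-\gamma}+(x+1)^{-\gamma}$, and let $\mu_Y$ be the probability measure on $Y$ with density $\frac{1-\gamma}{2^{1-\gamma}-1}\,h|_Y$ with respect to Lebesgue measure. Return times: for $y_0\in Y$ (defined $\mu_Y$-almost everywhere), $\tau_0\ge1$ is the least integer such that $T^{\tau_0}y_0\in Y$; inductively, given $\tau_0,\dots,\tau_{j-1}$, $\tau_j\ge1$ is the least integer such that $T^{\tau_0+\dots+\tau_j}y_0\in Y$. These are random variables on $(Y,\mu_Y)$, the randomness being the choice of $y_0$. Constants: with $\gamma=\alpha^{-1}$,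 $g_\alpha=\Gamma(1-\alpha)\cos\frac{\alpha\pi}{2}$, $d_\alpha=\alpha^\alpha\,\frac{1-\gamma}{2^{1-\gamma}-1}\,g_\alpha$, and $\ell_\alpha=0$ if $\alpha\in(0,1)$, $\ell_\alpha=(1-2^{\gamma-1})^{-1}$ if $\alpha\in(1,2)$. $\to_d$ denotes convergence in distribution. *)

theory Defs
  imports "HOL-Probability.Probability"
begin

definition is_stable_rv :: "'a measure \<Rightarrow> ('a \<Rightarrow> real) \<Rightarrow> real \<Rightarrow> real \<Rightarrow> real \<Rightarrow> bool" where
  "is_stable_rv N X \<alpha> \<eta> \<beta> \<longleftrightarrow>
     X \<in> borel_measurable N \<and>
     (\<forall>t::real. char (distr N borel X) t =
        exp (- complex_of_real (\<eta> powr \<alpha> * \<bar>t\<bar> powr \<alpha>) *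
              (1 - \<i> * complex_of_real (\<beta> * sgn t * tan (\<alpha> * pi / 2)))))"

text \<open>No case distinction is needed at the endpoint: the leading factor \<open>x\<close> forces the value \<open>0\<close>
  at \<open>x = 0\<close>, whatever the convention for powers of \<open>0\<close>. For \<open>x \<in> (0, 1]\<close> all bases
  of \<open>powr\<close> are positive.\<close>

definition thaler_map :: "real \<Rightarrow> real \<Rightarrow> real" where
  "thaler_map \<gamma> x =
     frac (x * (1 + (x / (1 + x)) powr (\<gamma> - 1) - x powr (\<gamma> - 1)) powr (1 / (1 - \<gamma>)))"

definition thaler_star :: "real \<Rightarrow> real" where
  "thaler_star \<gamma> = (THE x. 0 < x \<and> x < 1 \<and> x powr (1 - \<gamma>) + (1 + x) powr (1 - \<gamma>) = 2)"

definition thaler_Y :: "real \<Rightarrow> real set" where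
  "thaler_Y \<gamma> = {thaler_star \<gamma> <.. 1}"

definition thaler_h :: "real \<Rightarrow> real \<Rightarrow> real" where
  "thaler_h \<gamma> x = x powr (- \<gamma>) + (x + 1) powr (- \<gamma>)"

definition thaler_mu :: "real \<Rightarrow> real measure" where
  "thaler_mu \<gamma> = density (restrict_space lborel (thaler_Y \<gamma>))
     (\<lambda>x. ennreal ((1 - \<gamma>) / (2 powr (1 - \<gamma>) - 1) * thaler_h \<gamma> x))"

text \<open>On the null set of points that return to \<open>Y\<close> only finitely often, \<open>LEAST\<close> yields an
  arbitrary value.\<close>

function return_time :: "real \<Rightarrow> real \<Rightarrow> nat \<Rightarrow> nat" where
  "return_time \<gamma> y j =
     (LEAST k. k \<ge> 1 \<and>
        (thaler_map \<gamma> ^^ ((\<Sum>i<j. return_time \<gamma> y i) + k)) y \<in> thaler_Y \<gamma>)"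
  by pat_completeness auto
termination
  by (relation "Wellfounded.measure (\<lambda>(\<gamma>, y, j). j)") auto

declare return_time.simps [simp del]

definition g_const :: "real \<Rightarrow> real" where
  "g_const \<alpha> = Gamma (1 - \<alpha>) * cos (\<alpha> * pi / 2)"

definition d_const :: "real \<Rightarrow> real" where
  "d_const \<alpha> = (let \<gamma> = inverse \<alpha> in
     \<alpha> powr \<alpha> * ((1 - \<gamma>) / (2 powr (1 - \<gamma>) - 1)) * g_const \<alpha>)"

definition ell_const :: "real \<Rightarrow> real" where
  "ell_const \<alpha> = (let \<gamma> = inverse \<alpha> in
     if \<alpha> < 1 then 0 else inverse (1 - 2 powr (\<gamma> - 1)))"

end

theory Submission
  imports Defs "HOL-Real_Asymp.Real_Asymp"
begin

text \<open>In terms of \<open>b x = c * x powr (1 - \<gamma>)\<close> and \<open>U x = b x + b (1 + x) - 2 * c\<close>, the distribution function of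
  \<open>\<mu>\<close> on \<open>Y\<close>, the unreduced map sends \<open>x\<close> to the point where \<open>b\<close> equals \<open>U x + b 1\<close>. With \<open>V\<close> its inverse,
  the inverse branches of the return map are \<open>\<psi> n y = V (1 + (V ^^ n) y)\<close>, and
  \<open>U (\<psi> n y) = U ((V ^^ n) y) - U ((V ^^ Suc n) y)\<close>. Hence the transfer operator \<open>K\<close> has the branch
  weights \<open>w n = Q n - Q (Suc n)\<close> with decreasing products \<open>Q n\<close>, so \<open>K\<close> preserves monotone functions, and
  the coupling \<open>V 1 = x\<^sup>\<star>\<close> of its extreme values halves their oscillation. Return times are
  monotone in the starting point, so this is exponential mixing and the characteristic function of their sum is close
  to the power of the characteristic function of one return time. The latter is expanded at \<open>0\<close>
  by comparing the explicit tails with the binomial coefficients of \<open>(1 - z) powr \<beta>\<close>.\<close>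

section \<open>Mixing for monotone transfer operators\<close>

text \<open>The obstacle is the heavy tail: for \<open>\<alpha>\<close> < 2 the return time has
  infinite variance, and for \<open>\<alpha>\<close> < 1 infinite mean. Mixing is therefore applied
  only to the indicators of {n < \<open>\<tau>\<close>}, which are antimonotone with values in
  [0,1]. This brings in a truncation level \<open>N\<close>, a gap of \<open>m\<close> discarded
  return times, and a total error of order n * (m * (tmean t)^2 + N / 2^m + prob
  (\<open>\<tau>\<close> > N)). The quadratic term comes from short lags, where decay is worthless;
  there it suffices that one transfer bounds a function by twice its mean. Exponential decay then
  allows \<open>m\<close> to be a small power of n and \<open>N\<close> a large one. For
  \<open>\<alpha>\<close> in (1,2) the tails decay too fast for the Abelian theorem, which covers
  exponents in (0,1). They are, however, the decrements of \<open>b\<close> along the preimages of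
  1, a sequence of exponent \<open>\<alpha>\<close> - 1; a second summation by parts handles this
  case and shows that the centring 1 + c is the sum of all tails, that is, the mean return time.
  Weak convergence gives the statement at every real threshold only after atoms of the limit law are
  excluded, which is read off from the integrability of its characteristic function.\<close>

lemma norm_cis_diff_le: "norm (cis x - cis y) \<le> \<bar>x - y\<bar>"
proof -
  have "norm (cis x - cis y) = norm (cis y * (cis (x - y) - 1))"
    by (simp add: algebra_simps cis_mult)
  also have "\<dots> = norm (cis (x - y) - 1)"
    by (simp add: norm_mult)
  also have "\<dots> \<le> \<bar>x - y\<bar>"
    using iexp_approx1[of "x - y" 0] by (simp add: cis_conv_exp)
  finally show ?thesis .
qed

lemma norm_cis_diff_le_2: "norm (cis x - cis y) \<le> 2"
  using norm_triangle_ineq4[of "cis x" "cis y"] by simp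

lemma antimono_on_borel_measurable:
  fixes f :: "real \<Rightarrow> real"
  assumes "antimono_on A f"
  shows "f \<in> borel_measurable (restrict_space borel A)"
proof -
  have "mono_on A (\<lambda>x. - f x)"
    using assms by (auto simp: monotone_on_def)
  then have "(\<lambda>x. - (- f x)) \<in> borel_measurable (restrict_space borel A)"
    by (intro borel_measurable_uminus borel_measurable_mono_on_fnc)
  then show ?thesis by simp
qed

text \<open>\<open>g\<close> is the image of \<open>f\<close> under the Perron-Frobenius operator of
  \<open>F\<close>, encoded by duality with bounded test functions. These are complex so that
  exponentials of Birkhoff sums can be inserted directly.\<close>

definition is_transfer :: "real measure \<Rightarrow> (real \<Rightarrow> real) \<Rightarrow> (real \<Rightarrow> real) \<Rightarrow> (real \<Rightarrow> real) \<Rightarrow> bool" where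
  "is_transfer M F f g \<longleftrightarrow> (\<forall>H::real \<Rightarrow> complex. H \<in> borel_measurable M \<longrightarrow> bounded (range H) \<longrightarrow>
     (\<integral>x. of_real (f x) * H (F x) \<partial>M) = (\<integral>x. of_real (g x) * H x \<partial>M))"

lemma is_transferD:
  "\<lbrakk>is_transfer M F f g; H \<in> borel_measurable M; bounded (range H)\<rbrakk> \<Longrightarrow>
     (\<integral>x. complex_of_real (f x) * H (F x) \<partial>M) = (\<integral>x. of_real (g x) * H x \<partial>M)"
  by (simp add: is_transfer_def)

text \<open>\<open>transfer_step\<close> bundles three effects of one transfer: range bounds that
  never widen (invariance of \<open>M\<close>, iteration), an oscillation that halves (exponential
  mixing), and an upper bound by twice the mean (correlations at short lags).
  \<open>tau_antimono\<close> puts the indicators of {n < \<open>\<tau>\<close>} into the class on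
  which it acts.\<close>

locale monotone_mixing = prob_space M for M :: "real measure" +
  fixes F :: "real \<Rightarrow> real" and \<tau> :: "real \<Rightarrow> nat"
  assumes F_measurable [measurable]: "F \<in> measurable M M"
    and tau_measurable [measurable]: "\<tau> \<in> measurable M (count_space UNIV)"
    and sets_M: "sets M = sets (restrict_space borel (space M))"
    and tau_antimono: "\<And>x y. \<lbrakk>x \<in> space M; y \<in> space M; x \<le> y\<rbrakk> \<Longrightarrow> \<tau> y \<le> \<tau> x"
    and transfer_step: "\<And>f lo hi. \<lbrakk>antimono_on (space M) f; \<And>y. y \<in> space M \<Longrightarrow> f y \<in> {lo..hi}; 0 \<le> lo\<rbrakk> \<Longrightarrow>
        \<exists>g lo' hi'. is_transfer M F f g \<and> antimono_on (space M) g \<and> (\<forall>y\<in>space M. g y \<in> {lo'..hi'}) \<and>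
          lo \<le> lo' \<and> hi' \<le> hi \<and> hi' - lo' \<le> (hi - lo) / 2 \<and>
          (\<forall>y\<in>space M. g y \<le> 2 * (\<integral>x. f x \<partial>M))"
begin

lemma antimono_measurable:
  fixes f :: "real \<Rightarrow> real"
  assumes "antimono_on (space M) f"
  shows "f \<in> borel_measurable M"
  using antimono_on_borel_measurable[OF assms] by (simp add: measurable_cong_sets[OF sets_M refl])

lemma integrable_bounded:
  fixes f :: "real \<Rightarrow> 'b::{banach, second_countable_topology}"
  assumes "f \<in> borel_measurable M" "\<And>y. y \<in> space M \<Longrightarrow> norm (f y) \<le> B"
  shows "integrable M f"
  using assms by (intro integrable_const_bound[where B = B]) auto

lemma norm_integral_le_integral:
  fixes f :: "real \<Rightarrow> 'b::{banach, second_countable_topology}"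
  assumes "f \<in> borel_measurable M" "integrable M g" "\<And>y. y \<in> space M \<Longrightarrow> norm (f y) \<le> g y"
  shows "norm (\<integral>x. f x \<partial>M) \<le> (\<integral>x. g x \<partial>M)"
proof -
  have "integrable M f"
    by (rule Bochner_Integration.integrable_bound[OF assms(2)]) (use assms in \<open>fastforce intro!: AE_I2\<close>)+
  then show ?thesis
    using assms by (intro order.trans[OF integral_norm_bound] integral_mono) auto
qed

lemma norm_integral_le:
  fixes f :: "real \<Rightarrow> 'b::{banach, second_countable_topology}"
  assumes "f \<in> borel_measurable M" "\<And>y. y \<in> space M \<Longrightarrow> norm (f y) \<le> B"
  shows "norm (\<integral>x. f x \<partial>M) \<le> B"
  using norm_integral_le_integral[of f "\<lambda>_. B"] assms by (simp add: prob_space)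

lemma integral_F:
  fixes H :: "real \<Rightarrow> complex"
  assumes "H \<in> borel_measurable M" "bounded (range H)"
  shows "(\<integral>x. H (F x) \<partial>M) = (\<integral>x. H x \<partial>M)"
proof -
  \<comment> \<open>For the constant 1 both range bounds are 1, which pins \<open>g\<close> to 1:
    invariance is a special case of \<open>transfer_step\<close>.\<close>
  obtain g lo' hi' where tr: "is_transfer M F (\<lambda>_. 1) g"
    and g: "\<forall>y\<in>space M. g y \<in> {lo'..hi'}" "1 \<le> lo'" "hi' \<le> (1::real)"
    using transfer_step[of "\<lambda>_. 1" 1 1] by (auto simp: monotone_on_def)
  have g1: "g y = 1" if "y \<in> space M" for y
    using g that by fastforce
  have "(\<integral>x. H (F x) \<partial>M) = (\<integral>x. of_real (g x) * H x \<partial>M)"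
    using is_transferD[OF tr assms] by simp
  also have "\<dots> = (\<integral>x. H x \<partial>M)"
    by (intro Bochner_Integration.integral_cong) (simp_all add: g1)
  finally show ?thesis .
qed

lemma F_pow_measurable [measurable]: "(F ^^ m) \<in> measurable M M"
  by (rule measurable_compose_n) measurable

lemma integral_F_pow:
  fixes H :: "real \<Rightarrow> complex"
  assumes [measurable]: "H \<in> borel_measurable M" and "bounded (range H)"
  shows "(\<integral>x. H ((F ^^ m) x) \<partial>M) = (\<integral>x. H x \<partial>M)"
proof (induction m)
  case (Suc m)
  have "bounded (range (\<lambda>x. H ((F ^^ m) x)))"
    using assms(2) by (rule bounded_subset) auto
  then have "(\<integral>x. H ((F ^^ m) (F x)) \<partial>M) = (\<integral>x. H ((F ^^ m) x) \<partial>M)"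
    by (intro integral_F[of "\<lambda>x. H ((F ^^ m) x)"]) measurable
  then show ?case
    using Suc by (simp add: funpow_swap1)
qed simp

lemma transfer_iterate:
  assumes "antimono_on (space M) f" "\<And>y. y \<in> space M \<Longrightarrow> f y \<in> {lo..hi}" "0 \<le> lo"
  shows "\<exists>g lo' hi'. is_transfer M (F ^^ m) f g \<and> antimono_on (space M) g \<and> 0 \<le> lo' \<and>
          (\<forall>y\<in>space M. g y \<in> {lo'..hi'}) \<and> hi' - lo' \<le> (hi - lo) / 2 ^ m"
proof (induction m)
  case 0
  show ?case
    by (rule exI[of _ f], rule exI[of _ lo], rule exI[of _ hi]) (use assms in \<open>auto simp: is_transfer_def\<close>)
next
  case (Suc m)
  then obtain g lo1 hi1 where tr: "is_transfer M (F ^^ m) f g" and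
      g: "antimono_on (space M) g" "\<And>y. y\<in>space M \<Longrightarrow> g y \<in> {lo1..hi1}" "hi1 - lo1 \<le> (hi - lo) / 2 ^ m" "0 \<le> lo1"
    by blast
  obtain k lo2 hi2 where tr': "is_transfer M F g k" and
      k: "antimono_on (space M) k" "\<forall>y\<in>space M. k y \<in> {lo2..hi2}" "hi2 - lo2 \<le> (hi1 - lo1) / 2" "lo1 \<le> lo2"
    using transfer_step[OF g(1,2,4)] by blast
  have "is_transfer M (F ^^ Suc m) f k"
    unfolding is_transfer_def
  proof (intro allI impI)
    fix H :: "real \<Rightarrow> complex" assume [measurable]: "H \<in> borel_measurable M" and b: "bounded (range H)"
    have "bounded (range (\<lambda>x. H (F x)))"
      using b by (rule bounded_subset) auto
    then have "(\<integral>x. of_real (f x) * H (F ((F ^^ m) x)) \<partial>M) = (\<integral>x. of_real (g x) * H (F x) \<partial>M)"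
      by (intro is_transferD[OF tr]) measurable
    also have "\<dots> = (\<integral>x. of_real (k x) * H x \<partial>M)"
      using b by (intro is_transferD[OF tr']) auto
    finally show "(\<integral>x. of_real (f x) * H ((F ^^ Suc m) x) \<partial>M) = (\<integral>x. of_real (k x) * H x \<partial>M)"
      by simp
  qed
  moreover have "hi2 - lo2 \<le> (hi - lo) / 2 ^ Suc m"
    using order.trans[OF k(3) divide_right_mono[OF g(3), of 2]] by (simp add: mult.commute)
  moreover have "0 \<le> lo2"
    using k(4) g(4) by simp
  ultimately show ?case
    using k(1,2) by blast
qed

text \<open>After \<open>m\<close> transfers \<open>f\<close> has become a function of oscillation
  at most 2^-m with the same mean, hence uniformly within 2^-m of that mean. All regularity sits in
  \<open>f\<close>; \<open>H\<close> is merely measurable and bounded, so it may depend on the whole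
  future.\<close>

lemma mixing:
  fixes f :: "real \<Rightarrow> real" and H :: "real \<Rightarrow> complex"
  assumes f: "antimono_on (space M) f" "\<And>y. y \<in> space M \<Longrightarrow> f y \<in> {0..1}"
    and H [measurable]: "H \<in> borel_measurable M" and B: "\<And>y. norm (H y) \<le> 1"
  shows "norm ((\<integral>x. of_real (f x) * H ((F ^^ m) x) \<partial>M) - of_real (\<integral>x. f x \<partial>M) * (\<integral>x. H x \<partial>M)) \<le> 1 / 2 ^ m"
proof -
  obtain g lo hi where tr: "is_transfer M (F ^^ m) f g"
    and g: "antimono_on (space M) g" "\<And>y. y\<in>space M \<Longrightarrow> g y \<in> {lo..hi}" "hi - lo \<le> 1 / 2 ^ m"
    using transfer_iterate[OF f, of m] by auto
  have bH: "bounded (range H)"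
    using B by (auto simp: bounded_iff)
  have gm [measurable]: "g \<in> borel_measurable M"
    by (rule antimono_measurable) (rule g)
  have gB: "\<bar>g y\<bar> \<le> max \<bar>lo\<bar> \<bar>hi\<bar>" if "y \<in> space M" for y
    using g(2)[OF that] by auto
  have gi: "integrable M g"
    by (rule integrable_bounded[where B = "max \<bar>lo\<bar> \<bar>hi\<bar>"]) (use gB in simp_all)
  have mean: "complex_of_real (\<integral>x. f x \<partial>M) = of_real (\<integral>x. g x \<partial>M)"
    using is_transferD[OF tr, of "\<lambda>_. 1"] by simp
  define c where "c = (\<integral>x. g x \<partial>M)"
  have "lo \<le> c" "c \<le> hi"
    unfolding c_def using g(2) gi by (auto intro!: integral_ge_const integral_le_const AE_I2)
  then have gc: "\<bar>g y - c\<bar> \<le> 1 / 2 ^ m" if "y \<in> space M" for y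
    using g(2)[OF that] g(3) by auto
  have Hi: "integrable M H"
    by (rule integrable_bounded[where B = 1]) (use B in auto)
  have "norm (of_real (g y) * H y) \<le> max \<bar>lo\<bar> \<bar>hi\<bar>" if "y \<in> space M" for y
    using mult_mono[OF gB[OF that] B[of y]] by (simp add: norm_mult)
  then have "integrable M (\<lambda>x. of_real (g x) * H x)"
    by (rule integrable_bounded[rotated]) measurable
  then have "(\<integral>x. of_real (g x) * H x \<partial>M) - of_real c * (\<integral>x. H x \<partial>M) = (\<integral>x. of_real (g x - c) * H x \<partial>M)"
    using Hi by (simp add: left_diff_distrib)
  moreover have "norm (\<integral>x. of_real (g x - c) * H x \<partial>M) \<le> 1 / 2 ^ m"
  proof (rule norm_integral_le)
    show "norm (of_real (g x - c) * H x) \<le> 1 / 2 ^ m" if "x \<in> space M" for x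
      using mult_mono[OF gc[OF that] B[of x]] by (simp add: norm_mult del: of_real_diff)
  qed simp_all
  ultimately show ?thesis
    using is_transferD[OF tr H bH] mean by (simp add: c_def prob_space)
qed

text \<open>A single transfer turns \<open>f\<close> into a function bounded by twice its mean;
  invariance does the rest. The bound is uniform over all positive lags, hence the lag
  \<open>Suc m\<close>, and multiplicative, so it stays useful when both means are small.\<close>

lemma antimono_correlation_le:
  fixes f H :: "real \<Rightarrow> real"
  assumes f: "antimono_on (space M) f" "\<And>y. y \<in> space M \<Longrightarrow> f y \<in> {0..B}"
    and H [measurable]: "H \<in> borel_measurable M" and B: "\<And>y. H y \<in> {0..B}"
  shows "(\<integral>x. f x * H ((F ^^ Suc m) x) \<partial>M) \<le> 2 * (\<integral>x. f x \<partial>M) * (\<integral>x. H x \<partial>M)"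
proof -
  obtain g lo hi where tr: "is_transfer M F f g"
    and g': "antimono_on (space M) g" "\<forall>y\<in>space M. lo \<le> g y \<and> g y \<le> hi"
      "0 \<le> lo" "\<forall>y\<in>space M. g y \<le> 2 * (\<integral>x. f x \<partial>M)"
    using transfer_step[of f 0 B, OF f, simplified] by blast
  have g: "antimono_on (space M) g" "\<And>y. y\<in>space M \<Longrightarrow> g y \<in> {lo..hi}"
      "0 \<le> lo" "\<And>y. y \<in> space M \<Longrightarrow> g y \<le> 2 * (\<integral>x. f x \<partial>M)"
    using g' by auto
  have [measurable]: "g \<in> borel_measurable M"
    by (rule antimono_measurable) (rule g)
  have bd: "bounded (range (\<lambda>x. complex_of_real (H ((F ^^ k) x))))" for k
    using B by (auto simp: bounded_iff intro!: exI[of _ B])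
  have "complex_of_real (\<integral>x. f x * H ((F ^^ m) (F x)) \<partial>M) = (\<integral>x. of_real (g x) * of_real (H ((F ^^ m) x)) \<partial>M)"
    using is_transferD[OF tr _ bd[of m]] by (simp flip: of_real_mult integral_complex_of_real)
  then have "(\<integral>x. f x * H ((F ^^ Suc m) x) \<partial>M) = (\<integral>x. g x * H ((F ^^ m) x) \<partial>M)"
    by (simp flip: of_real_mult add: funpow_swap1)
  also have "\<dots> \<le> (\<integral>x. 2 * (\<integral>x. f x \<partial>M) * H ((F ^^ m) x) \<partial>M)"
  proof (rule integral_mono)
    have "norm (g y * H ((F ^^ m) y)) \<le> hi * B" if "y \<in> space M" for y
      using mult_mono[of "g y" hi "H ((F ^^ m) y)" B] g(2)[OF that] g(3) B[of "(F ^^ m) y"]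
      by (simp add: abs_mult)
    then show "integrable M (\<lambda>x. g x * H ((F ^^ m) x))"
      by (rule integrable_bounded[rotated]) measurable
    show "integrable M (\<lambda>x. 2 * (\<integral>x. f x \<partial>M) * H ((F ^^ m) x))"
      using B by (intro integrable_mult_right integrable_bounded[where B = B]) auto
  qed (use g(4) B in \<open>auto intro!: mult_right_mono\<close>)
  also have "\<dots> = 2 * (\<integral>x. f x \<partial>M) * (\<integral>x. H ((F ^^ m) x) \<partial>M)"
    by simp
  also have "complex_of_real (\<integral>x. H ((F ^^ m) x) \<partial>M) = of_real (\<integral>x. H x \<partial>M)"
    using integral_F_pow[of "\<lambda>x. of_real (H x)" m] bd[of 0] by simp
  then have "(\<integral>x. H ((F ^^ m) x) \<partial>M) = (\<integral>x. H x \<partial>M)"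
    by (simp only: of_real_eq_iff)
  finally show ?thesis .
qed

section \<open>Characteristic functions of Birkhoff sums\<close>

definition birkhoff :: "nat \<Rightarrow> real \<Rightarrow> nat" where
  "birkhoff k y = (\<Sum>j<k. \<tau> ((F ^^ j) y))"

definition phi :: "real \<Rightarrow> complex" where
  "phi t = (\<integral>x. cis (t * real (\<tau> x)) \<partial>M)"

text \<open>The cut at 2 keeps this finite when \<open>\<tau>\<close> is not integrable, while the
  integrand still dominates \<open>norm (cis (t * real (\<tau> x)) - 1)\<close>.\<close>

definition tmean :: "real \<Rightarrow> real" where
  "tmean t = (\<integral>x. min 2 (\<bar>t\<bar> * real (\<tau> x)) \<partial>M)"

lemma birkhoff_add: "birkhoff (k + l) y = birkhoff k y + birkhoff l ((F ^^ k) y)"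
proof -
  have "birkhoff (k + l) y = (\<Sum>j<k. \<tau> ((F ^^ j) y)) + (\<Sum>j\<in>{k..<k+l}. \<tau> ((F ^^ j) y))"
    unfolding birkhoff_def lessThan_atLeast0 by (rule sum.atLeastLessThan_concat[symmetric]) auto
  also have "(\<Sum>j\<in>{k..<k+l}. \<tau> ((F ^^ j) y)) = (\<Sum>j<l. \<tau> ((F ^^ (j + k)) y))"
    using sum.shift_bounds_nat_ivl[of "\<lambda>j. \<tau> ((F ^^ j) y)" 0 k l] by (simp add: add.commute lessThan_atLeast0)
  finally show ?thesis
    by (simp add: birkhoff_def funpow_add)
qed

lemma birkhoff_measurable [measurable]: "birkhoff k \<in> measurable M (count_space UNIV)"
  unfolding birkhoff_def by measurable

lemma cis_measurable [measurable]: "cis \<in> borel_measurable borel"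
  by (intro borel_measurable_continuous_onI continuous_intros)

lemma bounded_cis [simp]: "bounded (range (\<lambda>x. cis (f x)))"
  by (auto simp: bounded_iff intro!: exI[of _ 1])

lemma tmean_nonneg: "0 \<le> tmean t"
  unfolding tmean_def by (rule Bochner_Integration.integral_nonneg) simp

lemma norm_phi_le: "norm (phi t) \<le> 1"
  unfolding phi_def by (rule norm_integral_le) auto

lemma norm_cis_tau_le: "norm (cis (t * real n) - 1) \<le> min 2 (\<bar>t\<bar> * real n)"
  using norm_cis_diff_le[of "t * real n" 0] norm_cis_diff_le_2[of "t * real n" 0] by (simp add: abs_mult)

lemma norm_cis_birkhoff_le:
  fixes t :: real
  shows   "norm (cis (t * birkhoff k y) - 1) \<le> (\<Sum>j<k. min 2 (\<bar>t\<bar> * real (\<tau> ((F ^^ j) y))))"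
proof (induction k)
  case (Suc k)
  have "cis (t * birkhoff (Suc k) y) - 1 =
      cis (t * birkhoff k y) * (cis (t * real (\<tau> ((F ^^ k) y))) - 1) + (cis (t * birkhoff k y) - 1)"
    by (simp add: birkhoff_def algebra_simps cis_mult)
  also have "norm \<dots> \<le> norm (cis (t * real (\<tau> ((F ^^ k) y))) - 1) + norm (cis (t * birkhoff k y) - 1)"
    by (rule order.trans[OF norm_triangle_ineq]) (simp add: norm_mult)
  also have "\<dots> \<le> min 2 (\<bar>t\<bar> * real (\<tau> ((F ^^ k) y))) + (\<Sum>j<k. min 2 (\<bar>t\<bar> * real (\<tau> ((F ^^ j) y))))"
    by (intro add_mono Suc norm_cis_tau_le)
  finally show ?case by (simp add: add.commute)
qed (simp add: birkhoff_def)

lemma integrable_tmin [simp]: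
  "integrable M (\<lambda>x. min 2 (\<bar>t\<bar> * real (\<tau> x)))"
  "integrable M (\<lambda>x. min 2 (\<bar>t\<bar> * real (\<tau> ((F ^^ j) x))))"
  "integrable M (\<lambda>x. min 2 (\<bar>t\<bar> * real (\<tau> x)) * min 2 (\<bar>t\<bar> * real (\<tau> ((F ^^ j) x))))"
    apply (rule integrable_bounded[where B = 2]; simp)
   apply (rule integrable_bounded[where B = 2]; simp)
  apply (rule integrable_bounded[where B = 4]; simp add: abs_mult)
  using mult_mono[of _ "2::real" _ 2] apply force
  done

lemma norm_cis_birkhoff_mean_le:
  fixes t :: real
  shows   "(\<integral>x. norm (cis (t * birkhoff k x) - 1) \<partial>M) \<le> k * tmean t"
proof -
  have "(\<integral>x. norm (cis (t * birkhoff k x) - 1) \<partial>M) \<le> (\<integral>x. (\<Sum>j<k. min 2 (\<bar>t\<bar> * real (\<tau> ((F ^^ j) x)))) \<partial>M)"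
  proof (rule integral_mono)
    show "integrable M (\<lambda>x. norm (cis (t * birkhoff k x) - 1))"
      by (rule integrable_bounded[where B = 2]) (use norm_cis_diff_le_2[of _ 0] in auto)
  qed (auto intro!: norm_cis_birkhoff_le)
  also have "\<dots> = (\<Sum>j<k. (\<integral>x. min 2 (\<bar>t\<bar> * real (\<tau> ((F ^^ j) x))) \<partial>M))"
    by (rule Bochner_Integration.integral_sum) simp
  also have "\<dots> = (\<Sum>j<k. tmean t)"
  proof (intro sum.cong refl)
    fix j
    have bd: "bounded (range (\<lambda>x. complex_of_real (min 2 (\<bar>t\<bar> * real (\<tau> x)))))"
      by (auto simp: bounded_iff intro!: exI[of _ 2])
    have "complex_of_real (\<integral>x. min 2 (\<bar>t\<bar> * real (\<tau> ((F ^^ j) x))) \<partial>M) = of_real (tmean t)"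
      using integral_F_pow[OF _ bd, of j] by (simp add: tmean_def)
    then show "(\<integral>x. min 2 (\<bar>t\<bar> * real (\<tau> ((F ^^ j) x))) \<partial>M) = tmean t"
      by (simp only: of_real_eq_iff)
  qed
  finally show ?thesis by simp
qed

text \<open>The gain is the square of \<open>tmean t\<close>: the truncated return time is
  antimonotone, so its correlation with each later one is at most twice the product of the
  means.\<close>

lemma norm_cis_birkhoff_corr_le:
  fixes t :: real
  shows   "(\<integral>x. min 2 (\<bar>t\<bar> * real (\<tau> x)) * norm (cis (t * birkhoff k (F x)) - 1) \<partial>M) \<le> 2 * k * (tmean t)\<^sup>2"
proof -
  let ?d = "\<lambda>x. min 2 (\<bar>t\<bar> * real (\<tau> x))"
  have "(\<integral>x. ?d x * norm (cis (t * birkhoff k (F x)) - 1) \<partial>M) \<le> (\<integral>x. (\<Sum>j<k. ?d x * ?d ((F ^^ Suc j) x)) \<partial>M)"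
  proof (rule integral_mono)
    show "integrable M (\<lambda>x. ?d x * norm (cis (t * birkhoff k (F x)) - 1))"
    proof (rule integrable_bounded[where B = "2 * 2"])
      show "norm (?d x * norm (cis (t * birkhoff k (F x)) - 1)) \<le> 2 * 2" for x
        unfolding real_norm_def abs_mult
        by (rule mult_mono) (use norm_cis_diff_le_2[of _ 0] in auto)
    qed measurable
    show "?d x * norm (cis (t * birkhoff k (F x)) - 1) \<le> (\<Sum>j<k. ?d x * ?d ((F ^^ Suc j) x))" for x
      using mult_left_mono[OF norm_cis_birkhoff_le[of t k "F x"], of "?d x"]
      by (simp add: sum_distrib_left funpow_swap1)
    show "integrable M (\<lambda>x. \<Sum>j<k. ?d x * ?d ((F ^^ Suc j) x))"
      by (intro Bochner_Integration.integrable_sum integrable_tmin)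
  qed
  also have "\<dots> = (\<Sum>j<k. (\<integral>x. ?d x * ?d ((F ^^ Suc j) x) \<partial>M))"
    by (intro Bochner_Integration.integral_sum integrable_tmin)
  also have "\<dots> \<le> (\<Sum>j<k. 2 * (\<integral>x. ?d x \<partial>M) * (\<integral>x. ?d x \<partial>M))"
  proof (intro sum_mono antimono_correlation_le[where B = 2])
    show "antimono_on (space M) ?d"
      unfolding monotone_on_def
      by (intro ballI impI min.mono order_refl mult_left_mono) (auto intro: tau_antimono)
  qed (auto)
  finally show ?thesis
    by (simp add: tmean_def power2_eq_square mult_ac)
qed

lemma step_tail:
  "(\<integral>x. (if n < \<tau> x then 1 else 0) \<partial>M) = prob {x\<in>space M. n < \<tau> x}"
proof -
  have "(\<integral>x. (if n < \<tau> x then 1 else (0::real)) \<partial>M) = (\<integral>x. indicator {x\<in>space M. n < \<tau> x} x \<partial>M)"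
    by (intro Bochner_Integration.integral_cong) (auto simp: indicator_def)
  then show ?thesis by simp
qed

text \<open>A layer-cake formula: it writes an oscillating function of \<open>\<tau>\<close> as a
  combination of the indicators n < \<open>\<tau>\<close>, to which \<open>mixing\<close> applies
  one at a time. The minimum with \<open>N\<close> keeps the number of terms finite.\<close>

lemma cis_min_eq:
  "cis (t * real (min k N)) - 1 =
    (\<Sum>n<N. (cis (t * real (Suc n)) - cis (t * real n)) * of_real (if n < k then 1 else 0))"
proof (induction N)
  case (Suc N)
  show ?case
  proof (cases "N < k")
    case True
    then have min: "min k (Suc N) = Suc N" "min k N = N" by auto
    show ?thesis
      unfolding sum.lessThan_Suc Suc[symmetric] min using True by simp
  next
    case False
    then have "min k (Suc N) = k" "min k N = k" by auto
    with False Suc show ?thesis by simp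
  qed
qed simp

lemma phi_minus_1: "phi t - 1 = (\<integral>x. cis (t * real (\<tau> x)) - 1 \<partial>M)"
  unfolding phi_def
  by (subst Bochner_Integration.integral_diff) (auto simp: prob_space intro!: integrable_bounded[where B = 1])

text \<open>Split \<open>cis (t * real (\<tau> x)) - 1\<close> into the part \<open>D\<close>
  truncated at \<open>N\<close> and the rest \<open>E\<close>. \<open>D\<close> has \<open>N\<close>
  layers with coefficients of norm at most 2, each decorrelated up to 2^-m. \<open>E\<close> lives
  on {N < \<open>\<tau>\<close>} with norm at most 2 and enters twice, in the correlation and in the
  product, whence 4 * p.\<close>

lemma mixing_tau:
  fixes t :: real and N :: nat and W :: "real \<Rightarrow> complex"
  assumes W [measurable]: "W \<in> borel_measurable M" and B: "\<And>y. norm (W y) \<le> 1"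
  defines "p \<equiv> prob {x\<in>space M. N < \<tau> x}"
  shows "norm ((\<integral>x. (cis (t * real (\<tau> x)) - 1) * W ((F ^^ m) x) \<partial>M) - (phi t - 1) * (\<integral>x. W x \<partial>M))
    \<le> 2 * N / 2 ^ m + 4 * p"
proof -
  let ?I = "\<lambda>n x. if n < \<tau> x then 1 else (0::real)"
  let ?c = "\<lambda>n. cis (t * real (Suc n)) - cis (t * real n)"
  have cov: "norm ((\<integral>x. of_real (?I n x) * W ((F ^^ m) x) \<partial>M) - of_real (\<integral>x. ?I n x \<partial>M) * (\<integral>x. W x \<partial>M))
      \<le> 1 / 2 ^ m" for n
  proof (rule mixing)
    show "antimono_on (space M) (?I n)"
      using tau_antimono by (fastforce simp: monotone_on_def)
  qed (use B in auto)
  define D where "D x = cis (t * real (min (\<tau> x) N)) - 1" for x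
  define E where "E x = cis (t * real (\<tau> x)) - cis (t * real (min (\<tau> x) N))" for x
  have DE_meas [measurable]: "D \<in> borel_measurable M" "E \<in> borel_measurable M"
    unfolding D_def E_def by measurable
  have D2: "norm (D x) \<le> 2" for x
    using norm_cis_diff_le_2[of _ 0] by (simp add: D_def)
  have E2: "norm (E x) \<le> 2 * ?I N x" for x
    using norm_cis_diff_le_2 by (auto simp: E_def min_def)
  have E2': "norm (E x) \<le> 2" for x
    using E2[of x] by (auto split: if_splits)
  have int_mult: "integrable M (\<lambda>x. g x * h x)"
    if "g \<in> borel_measurable M" "h \<in> borel_measurable M" "\<And>x. norm (g x) \<le> 2" "\<And>x. norm (h x) \<le> 1"
    for g h :: "real \<Rightarrow> complex"
  proof (rule integrable_bounded[where B = "2 * 1"])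
    show "norm (g x * h x) \<le> 2 * 1" for x
      unfolding norm_mult by (rule mult_mono) (use that in auto)
  qed (use that in auto)
  have Wm: "(\<lambda>x. W ((F ^^ m) x)) \<in> borel_measurable M"
    by measurable
  have D_int: "(\<integral>x. D x * W' x \<partial>M) = (\<Sum>n<N. ?c n * (\<integral>x. of_real (?I n x) * W' x \<partial>M))"
    if [measurable]: "W' \<in> borel_measurable M" and "\<And>x. norm (W' x) \<le> 1" for W' :: "real \<Rightarrow> complex"
  proof -
    have "(\<integral>x. D x * W' x \<partial>M) = (\<integral>x. (\<Sum>n<N. ?c n * (of_real (?I n x) * W' x)) \<partial>M)"
      by (simp add: D_def cis_min_eq sum_distrib_right mult.assoc)
    also have "\<dots> = (\<Sum>n<N. (\<integral>x. ?c n * (of_real (?I n x) * W' x) \<partial>M))"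
      by (intro Bochner_Integration.integral_sum integrable_mult_right int_mult) (use that in auto)
    finally show ?thesis
      by simp
  qed
  have D_cov: "norm ((\<integral>x. D x * W ((F ^^ m) x) \<partial>M) - (\<integral>x. D x \<partial>M) * (\<integral>x. W x \<partial>M)) \<le> 2 * N / 2 ^ m"
  proof -
    have 1: "(\<integral>x. D x \<partial>M) = (\<Sum>n<N. ?c n * of_real (\<integral>x. ?I n x \<partial>M))"
      using D_int[of "\<lambda>_. 1"] by (simp flip: integral_complex_of_real)
    have "norm ((\<integral>x. D x * W ((F ^^ m) x) \<partial>M) - (\<integral>x. D x \<partial>M) * (\<integral>x. W x \<partial>M)) =
       norm (\<Sum>n<N. ?c n * ((\<integral>x. of_real (?I n x) * W ((F ^^ m) x) \<partial>M) - of_real (\<integral>x. ?I n x \<partial>M) * (\<integral>x. W x \<partial>M)))"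
      unfolding 1 D_int[OF Wm B] sum_distrib_right sum_subtractf[symmetric] by (simp add: algebra_simps)
    also have "\<dots> \<le> (\<Sum>n<N. 2 * (1 / 2 ^ m))"
      unfolding norm_mult using cov norm_cis_diff_le_2
      by (intro order.trans[OF norm_sum] sum_mono) (auto simp only: norm_mult norm_ge_zero intro!: mult_mono)
    finally show ?thesis
      by (simp add: mult.commute)
  qed
  have "norm (\<integral>x. E x * W' x \<partial>M) \<le> 2 * p"
    if [measurable]: "W' \<in> borel_measurable M" and "\<And>x. norm (W' x) \<le> 1" for W' :: "real \<Rightarrow> complex"
  proof -
    have "norm (\<integral>x. E x * W' x \<partial>M) \<le> (\<integral>x. 2 * ?I N x \<partial>M)"
    proof (rule norm_integral_le_integral)
      show "norm (E x * W' x) \<le> 2 * ?I N x" for x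
        using mult_mono[OF E2[of x] that(2)[of x]] by (simp add: norm_mult)
      show "integrable M (\<lambda>x. 2 * ?I N x)"
        by (rule integrable_bounded[where B = 2]) auto
    qed measurable
    then show ?thesis
      by (simp add: step_tail p_def)
  qed
  from this[OF Wm B] this[of "\<lambda>_. 1"]
  have E: "norm (\<integral>x. E x * W ((F ^^ m) x) \<partial>M) \<le> 2 * p" "norm (\<integral>x. E x \<partial>M) \<le> 2 * p"
    by simp_all
  have D_i: "integrable M D" and E_i: "integrable M E"
    using D2 E2' integrable_bounded[of D 2] integrable_bounded[of E 2] DE_meas by blast+
  have "(\<integral>x. (cis (t * real (\<tau> x)) - 1) * W ((F ^^ m) x) \<partial>M) =
      (\<integral>x. D x * W ((F ^^ m) x) + E x * W ((F ^^ m) x) \<partial>M)"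
    by (simp add: D_def E_def algebra_simps)
  also have "\<dots> = (\<integral>x. D x * W ((F ^^ m) x) \<partial>M) + (\<integral>x. E x * W ((F ^^ m) x) \<partial>M)"
    by (intro Bochner_Integration.integral_add int_mult) (use D2 E2' B in auto)
  finally have a: "(\<integral>x. (cis (t * real (\<tau> x)) - 1) * W ((F ^^ m) x) \<partial>M) = \<dots>" .
  have "phi t - 1 = (\<integral>x. D x + E x \<partial>M)"
    by (simp add: phi_minus_1 D_def E_def)
  also have "\<dots> = (\<integral>x. D x \<partial>M) + (\<integral>x. E x \<partial>M)"
    by (intro Bochner_Integration.integral_add D_i E_i)
  finally have b: "phi t - 1 = \<dots>" .
  have W1: "norm (\<integral>x. W x \<partial>M) \<le> 1"
    by (rule norm_integral_le) (use B in auto)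
  have e: "norm ((\<integral>x. E x \<partial>M) * (\<integral>x. W x \<partial>M)) \<le> 2 * p"
    using mult_mono[OF E(2) W1] by (simp add: norm_mult p_def)
  have "(\<integral>x. (cis (t * real (\<tau> x)) - 1) * W ((F ^^ m) x) \<partial>M) - (phi t - 1) * (\<integral>x. W x \<partial>M) =
     ((\<integral>x. D x * W ((F ^^ m) x) \<partial>M) - (\<integral>x. D x \<partial>M) * (\<integral>x. W x \<partial>M))
      + (\<integral>x. E x * W ((F ^^ m) x) \<partial>M) - (\<integral>x. E x \<partial>M) * (\<integral>x. W x \<partial>M)"
    unfolding a b by (simp add: algebra_simps)
  also have "norm \<dots> \<le> 2 * N / 2 ^ m + 2 * p + 2 * p"
    by (intro order.trans[OF norm_triangle_ineq4] add_mono e order.trans[OF norm_triangle_ineq] D_cov E)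
  finally show ?thesis by simp
qed

lemma norm_phi_minus_1_le: "norm (phi t - 1) \<le> tmean t"
  unfolding phi_minus_1 tmean_def
  by (rule norm_integral_le_integral) (simp_all only: norm_cis_tau_le integrable_tmin, measurable)

text \<open>To detach the first return time from the other \<open>k\<close>, a gap of
  \<open>l\<close> of them is first dropped, leaving \<open>W\<close>. Dropping costs 2 * l * (tmean
  t)^2 in the correlation with the first one and l * (tmean t)^2 in the product with
  \<open>phi t - 1\<close>; across the gap \<open>mixing_tau\<close> applies.\<close>

lemma birkhoff_char_step:
  fixes t :: real and N :: nat and k m :: nat
  defines "p \<equiv> prob {x\<in>space M. N < \<tau> x}"
  defines "a \<equiv> \<lambda>k. (\<integral>x. cis (t * real (birkhoff k x)) \<partial>M)"
  shows "norm (a (Suc k) - phi t * a k) \<le> 3 * m * (tmean t)\<^sup>2 + 2 * N / 2 ^ m + 4 * p"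
proof -
  \<comment> \<open>For \<open>k \<le> m\<close> everything but the first return time is dropped, so
    that \<open>W\<close> is 1 and no mixing is involved.\<close>
  define l where "l = min m k"
  define W where "W x = cis (t * real (birkhoff (k - l) x))" for x
  let ?D = "\<lambda>x. cis (t * real (\<tau> x)) - 1"
  let ?V = "\<lambda>x. cis (t * real (birkhoff l x)) - 1"
  have [measurable]: "W \<in> borel_measurable M"
    unfolding W_def by measurable
  have W1: "norm (W x) \<le> 1" for x
    by (simp add: W_def)
  have cis_i: "integrable M (\<lambda>x. cis (t * real (f x)))" if "f \<in> measurable M (count_space UNIV)" for f :: "real \<Rightarrow> nat"
    by (rule integrable_bounded[where B = 1]) (use that in auto)
  have split: "cis (t * real (birkhoff k x)) = (?V x + 1) * W ((F ^^ l) x)" for x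
    using birkhoff_add[of l "k - l" x] by (simp add: W_def l_def cis_mult algebra_simps)
  have bnd2: "norm (?V x) \<le> 2" "norm (?D x) \<le> 2" for x
    using norm_cis_diff_le_2[of _ 0] by auto
  have bnd4: "norm (?D x * ?V (F x) * W ((F ^^ l) (F x))) \<le> 2 * 2 * 1" for x
    unfolding norm_mult by (intro mult_mono bnd2 W1) auto
  have bnd1: "norm (?D x * W ((F ^^ l) (F x))) \<le> 2 * 1" for x
    unfolding norm_mult by (intro mult_mono bnd2 W1) auto
  have bnd1': "norm (?V x * W ((F ^^ l) x)) \<le> 2 * 1" for x
    unfolding norm_mult by (intro mult_mono bnd2 W1) auto

  \<comment> \<open>By invariance \<open>a k\<close> may be evaluated along \<open>F x\<close>; its
    difference with \<open>a (Suc k)\<close> then carries the factor \<open>?D x\<close> of the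
    first return time alone.\<close>
  have inv: "a k = (\<integral>x. cis (t * real (birkhoff k (F x))) \<partial>M)"
    unfolding a_def by (rule integral_F[symmetric]) auto
  have "a (Suc k) - a k = (\<integral>x. cis (t * real (birkhoff (Suc k) x)) - cis (t * real (birkhoff k (F x))) \<partial>M)"
    unfolding inv unfolding a_def
    by (rule Bochner_Integration.integral_diff[symmetric]) (auto intro!: cis_i)
  also have "\<dots> = (\<integral>x. ?D x * ?V (F x) * W ((F ^^ l) (F x)) + ?D x * W ((F ^^ l) (F x)) \<partial>M)"
  proof (intro Bochner_Integration.integral_cong refl)
    fix x
    have "cis (t * real (birkhoff (Suc k) x)) = (?D x + 1) * cis (t * real (birkhoff k (F x)))"
      using birkhoff_add[of 1 k x] by (simp add: birkhoff_def cis_mult algebra_simps)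
    then show "cis (t * real (birkhoff (Suc k) x)) - cis (t * real (birkhoff k (F x))) =
        ?D x * ?V (F x) * W ((F ^^ l) (F x)) + ?D x * W ((F ^^ l) (F x))"
      unfolding split[of "F x"] by (simp add: algebra_simps)
  qed
  also have "\<dots> = (\<integral>x. ?D x * ?V (F x) * W ((F ^^ l) (F x)) \<partial>M) + (\<integral>x. ?D x * W ((F ^^ l) (F x)) \<partial>M)"
    using bnd4 bnd1 by (intro Bochner_Integration.integral_add; intro integrable_bounded; measurable)
  finally have 1: "a (Suc k) - a k = \<dots>" .
  have "a k = (\<integral>x. ?V x * W ((F ^^ l) x) + W ((F ^^ l) x) \<partial>M)"
    unfolding a_def split by (simp add: algebra_simps)
  also have "\<dots> = (\<integral>x. ?V x * W ((F ^^ l) x) \<partial>M) + (\<integral>x. W ((F ^^ l) x) \<partial>M)"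
    using bnd1' W1 by (intro Bochner_Integration.integral_add; intro integrable_bounded; measurable)
  also have "(\<integral>x. W ((F ^^ l) x) \<partial>M) = (\<integral>x. W x \<partial>M)"
    by (rule integral_F_pow) (auto simp: W_def)
  finally have 2: "a k = (\<integral>x. ?V x * W ((F ^^ l) x) \<partial>M) + (\<integral>x. W x \<partial>M)" .

  have b1: "norm (\<integral>x. ?D x * ?V (F x) * W ((F ^^ l) (F x)) \<partial>M) \<le> 2 * l * (tmean t)\<^sup>2"
  proof (rule order.trans[OF norm_integral_le_integral])
    show "(\<integral>x. min 2 (\<bar>t\<bar> * real (\<tau> x)) * norm (?V (F x)) \<partial>M) \<le> 2 * l * (tmean t)\<^sup>2"
      using norm_cis_birkhoff_corr_le[of t l] by simp
    show "integrable M (\<lambda>x. min 2 (\<bar>t\<bar> * real (\<tau> x)) * norm (?V (F x)))"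
    proof (rule integrable_bounded[where B = "2 * 2"])
      show "norm (min 2 (\<bar>t\<bar> * real (\<tau> x)) * norm (?V (F x))) \<le> 2 * 2" for x
        unfolding real_norm_def abs_mult by (rule mult_mono) (use bnd2 in auto)
    qed measurable
    show "norm (?D x * ?V (F x) * W ((F ^^ l) (F x))) \<le> min 2 (\<bar>t\<bar> * real (\<tau> x)) * norm (?V (F x))" for x
      using norm_cis_tau_le[of t "\<tau> x"] by (simp add: norm_mult W_def mult_right_mono)
  qed measurable
  have b2: "norm ((phi t - 1) * (\<integral>x. ?V x * W ((F ^^ l) x) \<partial>M)) \<le> l * (tmean t)\<^sup>2"
  proof -
    have "norm (\<integral>x. ?V x * W ((F ^^ l) x) \<partial>M) \<le> l * tmean t"
    proof (rule order.trans[OF norm_integral_le_integral])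
      show "(\<integral>x. norm (?V x) \<partial>M) \<le> l * tmean t"
        by (rule norm_cis_birkhoff_mean_le)
      show "integrable M (\<lambda>x. norm (?V x))"
        using bnd2 by (intro integrable_norm integrable_bounded[where B = 2]) auto
      show "norm (?V x * W ((F ^^ l) x)) \<le> norm (?V x)" for x
        by (simp add: norm_mult W_def)
    qed measurable
    from mult_mono[OF norm_phi_minus_1_le[of t] this tmean_nonneg norm_ge_zero] show ?thesis
      unfolding norm_mult power2_eq_square by (simp only: mult_ac)
  qed
  have p0: "0 \<le> p"
    by (simp add: p_def)
  have b3: "norm ((\<integral>x. ?D x * W ((F ^^ l) (F x)) \<partial>M) - (phi t - 1) * (\<integral>x. W x \<partial>M)) \<le> 2 * N / 2 ^ m + 4 * p"
  proof (cases "k \<le> m")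
    case True
    then have "W = (\<lambda>_. 1)"
      by (auto simp: W_def l_def birkhoff_def)
    then show ?thesis
      using p0 by (simp add: phi_minus_1 prob_space)
  next
    case False
    then have l: "l = m" by (simp add: l_def)
    \<comment> \<open>\<open>W\<close> is evaluated after \<open>F\<close> and then the gap, so the
      lag is \<open>Suc m\<close>; the extra factor 1/2 is given away below.\<close>
    have "norm ((\<integral>x. ?D x * W ((F ^^ Suc m) x) \<partial>M) - (phi t - 1) * (\<integral>x. W x \<partial>M)) \<le> 2 * N / 2 ^ Suc m + 4 * p"
      unfolding p_def by (rule mixing_tau) (auto simp: W1)
    also have "\<dots> \<le> 2 * N / 2 ^ m + 4 * p"
      by (simp add: field_simps)
    finally show ?thesis
      by (simp add: l funpow_swap1)
  qed
  have "a (Suc k) - phi t * a k = (\<integral>x. ?D x * ?V (F x) * W ((F ^^ l) (F x)) \<partial>M)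
     - (phi t - 1) * (\<integral>x. ?V x * W ((F ^^ l) x) \<partial>M)
     + ((\<integral>x. ?D x * W ((F ^^ l) (F x)) \<partial>M) - (phi t - 1) * (\<integral>x. W x \<partial>M))"
  proof -
    have "a (Suc k) - phi t * a k = (a (Suc k) - a k) - (phi t - 1) * a k"
      by (simp add: algebra_simps)
    also have "\<dots> = ((\<integral>x. ?D x * ?V (F x) * W ((F ^^ l) (F x)) \<partial>M) + (\<integral>x. ?D x * W ((F ^^ l) (F x)) \<partial>M))
        - (phi t - 1) * ((\<integral>x. ?V x * W ((F ^^ l) x) \<partial>M) + (\<integral>x. W x \<partial>M))"
      by (subst 1, subst 2) (rule refl)
    finally show ?thesis
      by (simp only: distrib_left diff_diff_eq add_diff_eq diff_add_eq)
  qed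
  also have "norm \<dots> \<le> (2 * l * (tmean t)\<^sup>2 + l * (tmean t)\<^sup>2) + (2 * N / 2 ^ m + 4 * p)"
    by (intro order.trans[OF norm_triangle_ineq] add_mono order.trans[OF norm_triangle_ineq4] b1 b2 b3)
  also have "\<dots> \<le> 3 * m * (tmean t)\<^sup>2 + (2 * N / 2 ^ m + 4 * p)"
    by (simp add: l_def mult_right_mono)
  finally show ?thesis
    by simp
qed

text \<open>Since \<open>norm (phi t) \<le> 1\<close>, the one-step errors are not amplified by the
  recursion and simply add up.\<close>

theorem birkhoff_char_approx:
  fixes t :: real and N :: nat and n m :: nat
  shows "norm ((\<integral>x. cis (t * real (birkhoff n x)) \<partial>M) - phi t ^ n)
    \<le> n * (3 * m * (tmean t)\<^sup>2 + 2 * N / 2 ^ m + 4 * prob {x\<in>space M. N < \<tau> x})"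
    (is "norm (?a n - _) \<le> _ * ?e")
proof (induction n)
  case 0
  show ?case by (simp add: birkhoff_def prob_space)
next
  case (Suc n)
  have "?a (Suc n) - phi t ^ Suc n = (?a (Suc n) - phi t * ?a n) + phi t * (?a n - phi t ^ n)"
    by (simp add: algebra_simps)
  also have "norm \<dots> \<le> ?e + 1 * (n * ?e)"
    by (intro order.trans[OF norm_triangle_ineq] add_mono birkhoff_char_step)
       (unfold norm_mult, intro mult_mono norm_phi_le Suc, simp_all)
  also have "\<dots> = real (Suc n) * ?e"
    by (simp only: of_nat_Suc distrib_right mult_1)
  finally show ?case .
qed

text \<open>The Abel-summed form is chosen because it makes sense without a finite mean: the partial
  sums are integrals of truncated functions bounded by 2, so dominated convergence applies even when
  the tails themselves have a divergent sum.\<close>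

lemma phi_sums:
  "(\<lambda>n. of_real (prob {x\<in>space M. n < \<tau> x}) * (cis t ^ n - cis t ^ Suc n)) sums (1 - phi t)"
proof -
  let ?I = "\<lambda>n x. if n < \<tau> x then 1 else (0::real)"
  let ?c = "\<lambda>n. cis (t * real (Suc n)) - cis (t * real n)"
  have "(\<lambda>N. \<integral>x. cis (t * real (min (\<tau> x) N)) - 1 \<partial>M) \<longlonglongrightarrow> (\<integral>x. cis (t * real (\<tau> x)) - 1 \<partial>M)"
  proof (rule integral_dominated_convergence[where w = "\<lambda>_. 2"])
    show "AE x in M. (\<lambda>N. cis (t * real (min (\<tau> x) N)) - 1) \<longlonglongrightarrow> cis (t * real (\<tau> x)) - 1"
    proof (rule AE_I2, rule tendsto_eventually)
      show "\<forall>\<^sub>F N in sequentially. cis (t * real (min (\<tau> x) N)) - 1 = cis (t * real (\<tau> x)) - 1" for x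
        using eventually_ge_at_top[of "\<tau> x"] by eventually_elim (simp add: min_absorb1)
    qed
    show "AE x in M. norm (cis (t * real (min (\<tau> x) N)) - 1) \<le> 2" for N
      using norm_cis_diff_le_2[of _ 0] by (intro AE_I2) simp
  qed simp_all
  moreover have "(\<integral>x. cis (t * real (min (\<tau> x) N)) - 1 \<partial>M) = (\<Sum>n<N. ?c n * of_real (prob {x\<in>space M. n < \<tau> x}))" for N
  proof -
    have "(\<integral>x. cis (t * real (min (\<tau> x) N)) - 1 \<partial>M) = (\<integral>x. (\<Sum>n<N. ?c n * of_real (?I n x)) \<partial>M)"
      by (simp only: cis_min_eq)
    also have "\<dots> = (\<Sum>n<N. (\<integral>x. ?c n * of_real (?I n x) \<partial>M))"
      by (intro Bochner_Integration.integral_sum integrable_mult_right integrable_bounded[where B = 1]) auto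
    also have "\<dots> = (\<Sum>n<N. ?c n * of_real (\<integral>x. ?I n x \<partial>M))"
      by (simp only: integral_mult_right_zero integral_complex_of_real)
    finally show ?thesis
      by (simp only: step_tail)
  qed
  ultimately have "(\<lambda>n. ?c n * of_real (prob {x\<in>space M. n < \<tau> x})) sums (phi t - 1)"
    by (simp only: sums_def phi_minus_1)
  from sums_minus[OF this]
  have "(\<lambda>n. - (?c n * of_real (prob {x\<in>space M. n < \<tau> x}))) sums (1 - phi t)"
    by simp
  moreover have "cis (t * real n) = cis t ^ n" for n
    by (simp add: Complex.DeMoivre mult.commute)
  ultimately show ?thesis
    by (simp only: minus_mult_left minus_diff_eq mult.commute)
qed

text \<open>The level \<open>N\<close> is free; it will be taken of order 1 / t, where the two terms
  balance.\<close>

lemma tmean_le: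
  assumes "0 \<le> t"
  shows "tmean t \<le> 2 * prob {x\<in>space M. N < \<tau> x} + t * (\<Sum>n<N. prob {x\<in>space M. n < \<tau> x})"
proof -
  let ?I = "\<lambda>n x. if n < \<tau> x then 1 else (0::real)"
  have int: "integrable M (?I n)" for n
    by (rule integrable_bounded[where B = 1]) auto
  have min_eq: "real (min k N) = (\<Sum>n<N. if n < k then 1 else 0)" for k
  proof -
    have "(\<Sum>n<N. if n < k then 1 else (0::real)) = real (card ({..<N} \<inter> {n. n < k}))"
      by (simp add: sum.If_cases)
    also have "{..<N} \<inter> {n. n < k} = {..<min k N}"
      by auto
    finally show ?thesis by simp
  qed
  have "tmean t \<le> (\<integral>x. 2 * ?I N x + t * (\<Sum>n<N. ?I n x) \<partial>M)"
    unfolding tmean_def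
  proof (rule integral_mono)
    show "min 2 (\<bar>t\<bar> * real (\<tau> x)) \<le> 2 * ?I N x + t * (\<Sum>n<N. ?I n x)" for x
    proof (cases "N < \<tau> x")
      case True
      moreover have "0 \<le> t * real (min (\<tau> x) N)"
        using assms by simp
      ultimately show ?thesis
        unfolding min_eq[symmetric] by simp
    next
      case False
      then show ?thesis
        unfolding min_eq[symmetric] using assms by (simp add: min_absorb1)
    qed
    show "integrable M (\<lambda>x. 2 * ?I N x + t * (\<Sum>n<N. ?I n x))"
      by (intro Bochner_Integration.integrable_add integrable_mult_right Bochner_Integration.integrable_sum int)
  qed simp
  also have "\<dots> = 2 * (\<integral>x. ?I N x \<partial>M) + t * (\<Sum>n<N. (\<integral>x. ?I n x \<partial>M))"
    using int by (simp del: of_bool_def)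
  finally show ?thesis
    by (simp only: step_tail)
qed

end

section \<open>An Abelian theorem\<close>

text \<open>Serves two purposes: partial sums of regularly decaying sequences, and the growth of the
  preimages of 1 in the coordinate x powr -\<open>\<gamma>\<close>.\<close>

lemma stolz_cesaro:
  fixes a b :: "nat \<Rightarrow> real"
  assumes mono: "\<And>n. b n < b (Suc n)" and top: "filterlim b at_top sequentially"
    and lim: "(\<lambda>n. (a (Suc n) - a n) / (b (Suc n) - b n)) \<longlonglongrightarrow> L"
  shows "(\<lambda>n. a n / b n) \<longlonglongrightarrow> L"
proof (rule LIMSEQ_I)
  fix e :: real assume e: "0 < e"
  obtain N1 where N1: "\<And>n. N1 \<le> n \<Longrightarrow> norm ((a (Suc n) - a n) / (b (Suc n) - b n) - L) < e / 2"
    using LIMSEQ_D[OF lim, of "e / 2"] e by auto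
  obtain N2 where N2: "\<And>n. N2 \<le> n \<Longrightarrow> 1 \<le> b n"
    using filterlim_at_top[THEN iffD1, OF top] by (auto simp: eventually_sequentially)
  define N where "N = max N1 N2"
  have step: "\<bar>a n - a N - L * (b n - b N)\<bar> \<le> e / 2 * (b n - b N)" if "N \<le> n" for n
    using that
  proof (induction n rule: dec_induct)
    case (step n)
    have "norm ((a (Suc n) - a n) / (b (Suc n) - b n) - L) * (b (Suc n) - b n) \<le> e / 2 * (b (Suc n) - b n)"
      using N1[of n] step.hyps mono[of n] by (intro mult_right_mono) (auto simp: N_def)
    also have "norm ((a (Suc n) - a n) / (b (Suc n) - b n) - L) * (b (Suc n) - b n) =
        \<bar>((a (Suc n) - a n) / (b (Suc n) - b n) - L) * (b (Suc n) - b n)\<bar>"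
      using mono[of n] by (simp add: abs_mult)
    also have "((a (Suc n) - a n) / (b (Suc n) - b n) - L) * (b (Suc n) - b n) = a (Suc n) - a n - L * (b (Suc n) - b n)"
      using mono[of n] by (simp add: left_diff_distrib[of _ L])
    finally have "\<bar>a (Suc n) - a n - L * (b (Suc n) - b n)\<bar> \<le> e / 2 * (b (Suc n) - b n)" .
    moreover have "a (Suc n) - a N - L * (b (Suc n) - b N) =
        (a n - a N - L * (b n - b N)) + (a (Suc n) - a n - L * (b (Suc n) - b n))"
      by (simp add: algebra_simps)
    moreover have "e / 2 * (b (Suc n) - b N) = e / 2 * (b n - b N) + e / 2 * (b (Suc n) - b n)"
      by (simp add: field_simps)
    ultimately show ?case
      using step.IH by linarith
  qed simp
  have "\<forall>\<^sub>F n in sequentially. 2 * \<bar>a N - L * b N\<bar> / e < b n"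
    using filterlim_at_top_dense[THEN iffD1, OF top] by blast
  then obtain N3 where N3: "\<And>n. N3 \<le> n \<Longrightarrow> 2 * \<bar>a N - L * b N\<bar> / e < b n"
    by (auto simp: eventually_sequentially)
  show "\<exists>no. \<forall>n\<ge>no. norm (a n / b n - L) < e"
  proof (intro exI allI impI)
    fix n assume n: "max N N3 \<le> n"
    have bn: "1 \<le> b n" and bN: "1 \<le> b N"
      using n by (auto intro!: N2 simp: N_def)
    have "\<bar>a n - L * b n\<bar> \<le> \<bar>a N - L * b N\<bar> + e / 2 * b n"
    proof -
      have "e / 2 * (b n - b N) \<le> e / 2 * b n"
        using e bN by simp
      moreover have "a n - L * b n = (a N - L * b N) + (a n - a N - L * (b n - b N))"
        by (simp add: algebra_simps)
      ultimately show ?thesis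
        using step[of n] n by linarith
    qed
    also have "\<dots> < e / 2 * b n + e / 2 * b n"
      using N3[of n] n e by (simp add: field_simps)
    finally have "\<bar>a n - L * b n\<bar> < e * b n"
      by simp
    moreover have "a n / b n - L = (a n - L * b n) / b n"
      using bn by (simp add: field_simps)
    ultimately show "norm (a n / b n - L) < e"
      using bn by (simp add: field_simps)
  qed
qed

section \<open>Summation by parts for decreasing sequences\<close>

lemma abel_partial:
  fixes w :: "nat \<Rightarrow> 'a::comm_ring_1"
  shows "(\<Sum>n<N. w n * (z ^ n - z ^ Suc n)) = w 0 - (\<Sum>n<N. (w n - w (Suc n)) * z ^ Suc n) - w N * z ^ N"
  by (induction N) (simp_all add: algebra_simps)

text \<open>The decrements of \<open>w\<close> telescope, so the series obtained by parts converges
  absolutely on the whole closed disc, the circle included.\<close>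

lemma abel_sums:
  fixes w :: "nat \<Rightarrow> real" and z :: complex
  assumes dec: "decseq w" and lim: "w \<longlonglongrightarrow> 0" and z: "norm z \<le> 1"
  shows "summable (\<lambda>n. norm (of_real (w n - w (Suc n)) * z ^ Suc n))"
    and "(\<lambda>n. of_real (w n) * (z ^ n - z ^ Suc n)) sums (of_real (w 0) - (\<Sum>n. of_real (w n - w (Suc n)) * z ^ Suc n))"
proof -
  have w0: "0 \<le> w n" for n
    using decseq_ge[OF dec lim] by simp
  have d: "0 \<le> w n - w (Suc n)" for n
    using dec by (simp add: decseq_Suc_iff)
  have zn: "norm (z ^ n) \<le> 1" for n
    using z by (simp add: norm_power power_le_one)
  have "summable (\<lambda>n. w n - w (Suc n))"
    using telescope_summable'[OF lim] by simp
  then show s: "summable (\<lambda>n. norm (of_real (w n - w (Suc n)) * z ^ Suc n))"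
  proof (rule summable_comparison_test'[where N = 0])
    show "norm (norm (of_real (w n - w (Suc n)) * z ^ Suc n)) \<le> w n - w (Suc n)" for n
      using mult_left_mono[OF zn[of "Suc n"] d[of n]] d[of n]
      by (simp add: norm_mult norm_power del: of_real_diff power_Suc)
  qed
  have "(\<lambda>N. of_real (w N) * z ^ N) \<longlonglongrightarrow> 0"
  proof (rule Lim_null_comparison[OF _ lim])
    show "\<forall>\<^sub>F n in sequentially. norm (of_real (w n) * z ^ n) \<le> w n"
      using mult_left_mono[OF zn w0] w0 by (intro always_eventually allI) (simp add: norm_mult)
  qed
  then have "(\<lambda>N. of_real (w 0) - (\<Sum>n<N. of_real (w n - w (Suc n)) * z ^ Suc n) - of_real (w N) * z ^ N)
     \<longlonglongrightarrow> of_real (w 0) - (\<Sum>n. of_real (w n - w (Suc n)) * z ^ Suc n) - 0"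
    by (intro tendsto_diff tendsto_const summable_LIMSEQ summable_norm_cancel[OF s])
  then show "(\<lambda>n. of_real (w n) * (z ^ n - z ^ Suc n)) sums (of_real (w 0) - (\<Sum>n. of_real (w n - w (Suc n)) * z ^ Suc n))"
    unfolding sums_def using abel_partial[of "\<lambda>n. of_real (w n)" z] by simp
qed

text \<open>The bound does not depend on \<open>z\<close>, in particular not on its distance to 1;
  this uniformity is what survives the limit t -> 0.\<close>

lemma abel_tail:
  fixes w :: "nat \<Rightarrow> real" and z :: complex
  assumes dec: "decseq w" and lim: "w \<longlonglongrightarrow> 0" and z: "norm z \<le> 1"
    and S: "(\<lambda>n. of_real (w n) * (z ^ n - z ^ Suc n)) sums S"
  shows "norm (S - (\<Sum>n<N. of_real (w n) * (z ^ n - z ^ Suc n))) \<le> 2 * w N"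
proof -
  have w0: "0 \<le> w n" for n
    using decseq_ge[OF dec lim] by simp
  have d: "0 \<le> w n - w (Suc n)" for n
    using dec by (simp add: decseq_Suc_iff)
  have zn: "norm (z ^ n) \<le> 1" for n
    using z by (simp add: norm_power power_le_one)
  let ?P = "\<lambda>N. \<Sum>n<N. complex_of_real (w n) * (z ^ n - z ^ Suc n)"
  \<comment> \<open>Carrying the boundary term \<open>w (N + M) * z ^ (N + M)\<close> along makes
    each increment a single decrement of \<open>w\<close>, so the bounds telescope.\<close>
  have part: "norm (?P (N + M) - ?P N + of_real (w (N + M)) * z ^ (N + M)) \<le> 2 * w N - w (N + M)" for M
  proof (induction M)
    case 0
    show ?case
      using mult_left_mono[OF zn[of N] w0[of N]] w0[of N] by (simp add: norm_mult)
  next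
    case (Suc M)
    have "?P (N + Suc M) - ?P N + of_real (w (N + Suc M)) * z ^ (N + Suc M) =
       (?P (N + M) - ?P N + of_real (w (N + M)) * z ^ (N + M)) - of_real (w (N + M) - w (Suc (N + M))) * z ^ Suc (N + M)"
      by (simp add: algebra_simps)
    also have "norm \<dots> \<le> (2 * w N - w (N + M)) + (w (N + M) - w (Suc (N + M))) * 1"
      by (intro order.trans[OF norm_triangle_ineq4] add_mono Suc, unfold norm_mult norm_of_real)
         (intro mult_mono zn, use d in auto)
    finally show ?case by simp
  qed
  have "(\<lambda>M. of_real (w (N + M)) * z ^ (N + M)) \<longlonglongrightarrow> 0"
  proof (rule Lim_null_comparison)
    show "\<forall>\<^sub>F M in sequentially. norm (of_real (w (N + M)) * z ^ (N + M)) \<le> w (N + M)"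
      using mult_left_mono[OF zn w0] w0 by (intro always_eventually allI) (simp add: norm_mult)
    show "(\<lambda>M. w (N + M)) \<longlonglongrightarrow> 0"
      using LIMSEQ_ignore_initial_segment[OF lim, of N] by (simp add: add.commute)
  qed
  moreover have "(\<lambda>M. ?P (N + M)) \<longlonglongrightarrow> S"
    using LIMSEQ_ignore_initial_segment[OF S[unfolded sums_def], of N] by (simp add: add.commute)
  ultimately have "(\<lambda>M. ?P (N + M) - ?P N + of_real (w (N + M)) * z ^ (N + M)) \<longlonglongrightarrow> S - ?P N + 0"
    by (intro tendsto_intros)
  then have "norm (S - ?P N + 0) \<le> 2 * w N"
  proof (rule Lim_bounded[OF tendsto_norm])
    show "\<forall>M\<ge>0. norm (?P (N + M) - ?P N + of_real (w (N + M)) * z ^ (N + M)) \<le> 2 * w N"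
    proof (intro allI impI)
      show "norm (?P (N + M) - ?P N + of_real (w (N + M)) * z ^ (N + M)) \<le> 2 * w N" for M
        using part[of M] w0[of "N + M"] by linarith
    qed
  qed
  then show ?thesis by simp
qed

text \<open>The Taylor coefficients of \<open>(1 - z) powr (\<beta> - 1)\<close>.\<close>

definition bin_seq :: "real \<Rightarrow> nat \<Rightarrow> real" where
  "bin_seq \<beta> n = (-1) ^ n * ((\<beta> - 1) gchoose n)"

context
  fixes \<beta> :: real
  assumes beta: "0 < \<beta>" "\<beta> < 1"
begin

lemma bin_seq_0: "bin_seq \<beta> 0 = 1"
  by (simp add: bin_seq_def)

lemma bin_seq_Suc: "bin_seq \<beta> (Suc n) = bin_seq \<beta> n * ((real n + 1 - \<beta>) / (real n + 1))"
proof -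
  have E: "(real n + 1) * (\<beta> - 1 gchoose Suc n) = (\<beta> - 1 - real n) * (\<beta> - 1 gchoose n)"
    using gbinomial_absorb_comp[of "\<beta> - 1" n] gbinomial_absorption[of n "\<beta> - 1"] by (simp add: add.commute)
  have "(real n + 1) * bin_seq \<beta> (Suc n) = - ((-1) ^ n) * ((real n + 1) * (\<beta> - 1 gchoose Suc n))"
    by (simp add: bin_seq_def)
  then have "(real n + 1) * bin_seq \<beta> (Suc n) = bin_seq \<beta> n * (real n + 1 - \<beta>)"
    unfolding E by (simp add: bin_seq_def algebra_simps)
  then show ?thesis
    by (simp add: field_simps)
qed

lemma bin_seq_pos: "0 < bin_seq \<beta> n"
  using beta by (induction n) (simp_all add: bin_seq_0 bin_seq_Suc)

lemma decseq_bin_seq: "decseq (bin_seq \<beta>)"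
proof (rule decseq_SucI)
  show "bin_seq \<beta> (Suc n) \<le> bin_seq \<beta> n" for n
    unfolding bin_seq_Suc using beta bin_seq_pos[of n] by (intro mult_left_le) auto
qed

lemma bin_seq_asymp: "(\<lambda>n. bin_seq \<beta> n * real n powr \<beta>) \<longlonglongrightarrow> 1 / Gamma (1 - \<beta>)"
proof -
  have "(\<lambda>n. (\<beta> - 1 gchoose n) / ((-1) ^ n / exp (\<beta> * ln (real n)))) \<longlonglongrightarrow> inverse (Gamma (1 - \<beta>))"
    using gbinomial_asymptotic[of "\<beta> - 1"] by simp
  moreover have "\<forall>\<^sub>F n in sequentially. (\<beta> - 1 gchoose n) / ((-1) ^ n / exp (\<beta> * ln (real n))) = bin_seq \<beta> n * real n powr \<beta>"
    using eventually_gt_at_top[of 0]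
  proof eventually_elim
    case (elim n)
    have "inverse ((-1::real) ^ n) = (-1) ^ n"
      by (simp add: power_inverse[symmetric])
    with elim show ?case
      by (simp add: bin_seq_def powr_def divide_inverse mult_ac)
  qed
  ultimately show ?thesis
    using Lim_transform_eventually by (fastforce simp: inverse_eq_divide)
qed

lemma bin_seq_tendsto_0: "bin_seq \<beta> \<longlonglongrightarrow> 0"
proof -
  have "(\<lambda>n. bin_seq \<beta> n * real n powr \<beta> * real n powr - \<beta>) \<longlonglongrightarrow> 1 / Gamma (1 - \<beta>) * 0"
    by (intro tendsto_mult bin_seq_asymp) (use beta in real_asymp)
  moreover have "\<forall>\<^sub>F n in sequentially. bin_seq \<beta> n * real n powr \<beta> * real n powr - \<beta> = bin_seq \<beta> n"
    using eventually_gt_at_top[of 0] by eventually_elim (simp flip: powr_add)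
  ultimately show ?thesis
    using Lim_transform_eventually by fastforce
qed

text \<open>Pascal's rule: up to sign the decrements are the Taylor coefficients of (1 - z) powr
  \<open>\<beta>\<close>. They are absolutely summable, unlike \<open>bin_seq\<close>
  itself.\<close>

lemma bin_seq_diff: "bin_seq \<beta> n - bin_seq \<beta> (Suc n) = (-1) ^ n * (\<beta> gchoose Suc n)"
  using gbinomial_Suc_Suc[of "\<beta> - 1" n] by (simp add: bin_seq_def algebra_simps)

lemma bin_seq_gf_inside:
  fixes z :: complex
  assumes "norm z < 1"
  shows "1 - (\<Sum>n. of_real (bin_seq \<beta> n - bin_seq \<beta> (Suc n)) * z ^ Suc n) = (1 - z) powr of_real \<beta>"
proof -
  have "(\<lambda>n. (of_real \<beta> gchoose n) * (- z) ^ n) sums (1 - z) powr of_real \<beta>"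
    using gen_binomial_complex[of "- z" "of_real \<beta>"] assms by simp
  then have "(\<lambda>n. (of_real \<beta> gchoose Suc n) * (- z) ^ Suc n) sums ((1 - z) powr of_real \<beta> - 1)"
    by (subst sums_Suc_iff) simp
  moreover have "(of_real \<beta> gchoose Suc n) * (- z) ^ Suc n = - (of_real (bin_seq \<beta> n - bin_seq \<beta> (Suc n)) * z ^ Suc n)" for n
  proof -
    have "(complex_of_real \<beta> gchoose Suc n) = of_real (\<beta> gchoose Suc n)"
      unfolding gbinomial_pochhammer of_real_minus[symmetric] pochhammer_of_real by simp
    then show ?thesis
      unfolding bin_seq_diff by (simp add: power_minus[of z])
  qed
  ultimately have "(\<lambda>n. - (of_real (bin_seq \<beta> n - bin_seq \<beta> (Suc n)) * z ^ Suc n)) sums ((1 - z) powr of_real \<beta> - 1)"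
    by (simp only:)
  from sums_minus[OF this]
  have "(\<lambda>n. of_real (bin_seq \<beta> n - bin_seq \<beta> (Suc n)) * z ^ Suc n) sums - ((1 - z) powr of_real \<beta> - 1)"
    by simp
  then show ?thesis
    by (simp add: sums_iff)
qed

text \<open>Abel's boundary limit: the identity inside the disc is carried along the radius through
  \<open>z\<close>, the series being dominated by the summable decrements.\<close>

lemma bin_seq_gf:
  fixes z :: complex
  assumes z: "norm z = 1" "z \<noteq> 1"
  shows "(\<lambda>n. of_real (bin_seq \<beta> n) * (z ^ n - z ^ Suc n)) sums ((1 - z) powr of_real \<beta>)"
proof -
  let ?c = "\<lambda>n. bin_seq \<beta> n - bin_seq \<beta> (Suc n)"
  define q where "q k = 1 - inverse (real (Suc k))" for k
  have q: "0 \<le> q k" "q k < 1" for k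
    by (auto simp: q_def field_simps)
  have q_lim: "(\<lambda>k. of_real (q k) * z) \<longlonglongrightarrow> z"
  proof -
    have "q \<longlonglongrightarrow> 1"
      unfolding q_def using tendsto_diff[OF tendsto_const LIMSEQ_inverse_real_of_nat, of 1] by simp
    then have "(\<lambda>k. of_real (q k) * z) \<longlonglongrightarrow> of_real 1 * z"
      by (intro tendsto_intros)
    then show ?thesis by simp
  qed
  have c0: "0 \<le> ?c n" for n
    using decseq_bin_seq by (simp add: decseq_Suc_iff)
  have "(\<lambda>k. \<Sum>n. of_real (?c n) * (of_real (q k) * z) ^ Suc n) \<longlonglongrightarrow> (\<Sum>n. of_real (?c n) * z ^ Suc n)"
  proof (rule tannerys_theorem[THEN conjunct2, THEN conjunct2])
    show "(\<lambda>k. of_real (?c n) * (of_real (q k) * z) ^ Suc n) \<longlonglongrightarrow> of_real (?c n) * z ^ Suc n" for n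
      by (intro tendsto_intros q_lim)
    show "\<forall>\<^sub>F (n, k) in at_top \<times>\<^sub>F sequentially. norm (of_real (?c n) * (of_real (q k) * z) ^ Suc n) \<le> ?c n"
    proof (intro always_eventually allI, clarify)
      fix n k
      have "norm ((of_real (q k) * z) ^ Suc n) \<le> 1"
        unfolding norm_power using q[of k] z by (intro power_le_one) (auto simp: norm_mult)
      from mult_left_mono[OF this c0[of n]] show "norm (of_real (?c n) * (of_real (q k) * z) ^ Suc n) \<le> ?c n"
        unfolding norm_mult norm_of_real using c0[of n] by simp
    qed
    show "summable ?c"
      using telescope_summable'[OF bin_seq_tendsto_0] by simp
  qed simp
  then have "(\<lambda>k. 1 - (\<Sum>n. of_real (?c n) * (of_real (q k) * z) ^ Suc n)) \<longlonglongrightarrow> 1 - (\<Sum>n. of_real (?c n) * z ^ Suc n)"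
    by (intro tendsto_intros)
  moreover have "1 - (\<Sum>n. of_real (?c n) * (of_real (q k) * z) ^ Suc n) = (1 - of_real (q k) * z) powr of_real \<beta>" for k
    by (rule bin_seq_gf_inside) (use q[of k] z in \<open>simp add: norm_mult\<close>)
  moreover have "(\<lambda>k. (1 - of_real (q k) * z) powr of_real \<beta>) \<longlonglongrightarrow> (1 - z) powr of_real \<beta>"
  proof (intro tendsto_powr_complex tendsto_diff tendsto_const q_lim)
    \<comment> \<open>This keeps 1 - z off the negative real axis, where the complex power is
      discontinuous.\<close>
    have "Re z < 1"
    proof (rule ccontr)
      assume "\<not> Re z < 1"
      then have "Re z = 1"
        using complex_Re_le_cmod[of z] z by simp
      then have "Im z = 0"
        using z(1) by (simp add: cmod_def)
      then show False
        using z(2) \<open>Re z = 1\<close> by (simp add: complex_eq_iff)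
    qed
    then show "1 - z \<notin> \<real>\<^sub>\<le>\<^sub>0"
      by (auto simp: complex_nonpos_Reals_iff)
  qed
  ultimately have "1 - (\<Sum>n. of_real (?c n) * z ^ Suc n) = (1 - z) powr of_real \<beta>"
    using LIMSEQ_unique by simp
  then show ?thesis
    using abel_sums(2)[OF decseq_bin_seq bin_seq_tendsto_0, of z] z by (simp add: bin_seq_0)
qed

end

lemma cis_minus_one_tendsto: "((\<lambda>t. (1 - cis t) / of_real t) \<longlongrightarrow> - \<i>) (at_right 0)"
proof -
  have "((\<lambda>t. cis t) has_vector_derivative \<i> * cis 0) (at 0)"
    unfolding cis_conv_exp by (auto intro!: derivative_eq_intros)
  then have "((\<lambda>t. (cis t - cis 0 - (t - 0) *\<^sub>R (\<i> * cis 0)) /\<^sub>R norm (t - 0)) \<longlongrightarrow> 0) (at 0)"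
    by (simp add: has_vector_derivative_def has_derivative_at_within)
  then have "((\<lambda>t. (cis t - cis 0 - (t - 0) *\<^sub>R (\<i> * cis 0)) /\<^sub>R norm (t - 0)) \<longlongrightarrow> 0) (at_right 0)"
    by (rule tendsto_mono[rotated]) (simp add: at_le)
  then have "((\<lambda>t. - ((cis t - cis 0 - (t - 0) *\<^sub>R (\<i> * cis 0)) /\<^sub>R norm (t - 0)) - \<i>) \<longlongrightarrow> - 0 - \<i>) (at_right 0)"
    by (intro tendsto_intros)
  moreover have "\<forall>\<^sub>F t in at_right 0. - ((cis t - cis 0 - (t - 0) *\<^sub>R (\<i> * cis 0)) /\<^sub>R norm (t - 0)) - \<i> = (1 - cis t) / of_real t"
    unfolding eventually_at_filter
    by (intro always_eventually allI impI) (auto simp: scaleR_conv_of_real field_simps)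
  ultimately show ?thesis
    using Lim_transform_eventually by fastforce
qed

lemma minus_ii_powr: "(- \<i>) powr of_real \<beta> = cis (- (pi * \<beta> / 2))"
  by (simp add: powr_def cis_conv_exp mult_ac)

text \<open>A positive factor t may be pulled out of the complex power; what remains tends to -i,
  away from the branch cut.\<close>

lemma bin_gf_asymp:
  "((\<lambda>t. (1 - cis t) powr of_real \<beta> / of_real (t powr \<beta>)) \<longlongrightarrow> cis (- (pi * \<beta> / 2))) (at_right 0)"
proof -
  have "((\<lambda>t. ((1 - cis t) / of_real t) powr of_real \<beta>) \<longlongrightarrow> (- \<i>) powr of_real \<beta>) (at_right 0)"
    by (intro tendsto_powr_complex cis_minus_one_tendsto tendsto_const) (simp add: complex_nonpos_Reals_iff)
  moreover have "\<forall>\<^sub>F t in at_right 0. ((1 - cis t) / of_real t) powr of_real \<beta> = (1 - cis t) powr of_real \<beta> / of_real (t powr \<beta>)"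
    unfolding eventually_at_filter
  proof (intro always_eventually allI impI)
    fix t :: real assume "t \<noteq> 0" "t \<in> {0<..}"
    then have t: "0 < t" by simp
    have "(of_real t * ((1 - cis t) / of_real t)) powr of_real \<beta> =
        of_real t powr of_real \<beta> * ((1 - cis t) / of_real t) powr of_real \<beta>"
      using t by (intro powr_times_real_left) auto
    moreover have "of_real t * ((1 - cis t) / of_real t) = 1 - cis t"
      using t by simp
    ultimately have "(1 - cis t) powr of_real \<beta> = of_real t powr of_real \<beta> * ((1 - cis t) / of_real t) powr of_real \<beta>"
      by (simp only:)
    then show "((1 - cis t) / of_real t) powr of_real \<beta> = (1 - cis t) powr of_real \<beta> / of_real (t powr \<beta>)"
      using t by (simp add: powr_of_real field_simps)
  qed
  ultimately show ?thesis
    unfolding minus_ii_powr using Lim_transform_eventually by fast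
qed

text \<open>The increments of n powr (1 - \<open>\<beta>\<close>) are asymptotic to (1 -
  \<open>\<beta>\<close>) * n powr -\<open>\<beta>\<close>, so Stolz-Cesaro applies. With L = 0 it
  is the little-o statement used below.\<close>

lemma sum_little_o:
  fixes \<delta> :: "nat \<Rightarrow> real"
  assumes beta: "0 < \<beta>" "\<beta> < 1" and lim: "(\<lambda>n. \<delta> n * real n powr \<beta>) \<longlonglongrightarrow> L"
  shows "(\<lambda>N. (\<Sum>n<N. \<delta> n) / real N powr (1 - \<beta>)) \<longlonglongrightarrow> L / (1 - \<beta>)"
proof (rule stolz_cesaro)
  show "real n powr (1 - \<beta>) < real (Suc n) powr (1 - \<beta>)" for n
    using beta by (intro powr_less_mono2) auto
  show "filterlim (\<lambda>n. real n powr (1 - \<beta>)) at_top sequentially"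
    using beta by real_asymp
  have "(\<lambda>n. real n powr - \<beta> / (real (Suc n) powr (1 - \<beta>) - real n powr (1 - \<beta>))) \<longlonglongrightarrow> 1 / (1 - \<beta>)"
    using beta by (real_asymp simp: field_simps)
  then have "(\<lambda>n. (\<delta> n * real n powr \<beta>) * (real n powr - \<beta> / (real (Suc n) powr (1 - \<beta>) - real n powr (1 - \<beta>)))) \<longlonglongrightarrow> L * (1 / (1 - \<beta>))"
    by (intro tendsto_mult lim)
  moreover have "\<forall>\<^sub>F n in sequentially. (\<delta> n * real n powr \<beta>) * (real n powr - \<beta> / (real (Suc n) powr (1 - \<beta>) - real n powr (1 - \<beta>))) =
     ((\<Sum>n<Suc n. \<delta> n) - (\<Sum>n<n. \<delta> n)) / (real (Suc n) powr (1 - \<beta>) - real n powr (1 - \<beta>))"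
    using eventually_gt_at_top[of 0]
    by eventually_elim (simp flip: powr_add)
  ultimately show "(\<lambda>n. ((\<Sum>n<Suc n. \<delta> n) - (\<Sum>n<n. \<delta> n)) / (real (Suc n) powr (1 - \<beta>) - real n powr (1 - \<beta>))) \<longlonglongrightarrow> L / (1 - \<beta>)"
    using Lim_transform_eventually by fastforce
qed

text \<open>The sequence is compared with a multiple of the binomial sequence, whose
  generating function is known exactly. The sums are split at \<open>N \<approx> M / t\<close>: below \<open>N\<close> the difference
  of the two sequences is small, above \<open>N\<close> monotonicity gives a bound of order \<open>M powr - \<beta>\<close>.\<close>

lemma abelian:
  fixes w :: "nat \<Rightarrow> real" and S :: "real \<Rightarrow> complex"
  assumes beta: "0 < \<beta>" "\<beta> < 1"
    and dec: "decseq w" and w0: "w \<longlonglongrightarrow> 0"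
    and w: "(\<lambda>n. w n * real n powr \<beta>) \<longlonglongrightarrow> C"
    and S: "\<And>t. (\<lambda>n. of_real (w n) * (cis t ^ n - cis t ^ Suc n)) sums S t"
  shows "((\<lambda>t. S t / of_real (t powr \<beta>)) \<longlongrightarrow> of_real (C * Gamma (1 - \<beta>)) * cis (- (pi * \<beta> / 2))) (at_right 0)"
proof -
  \<comment> \<open>The factor Gamma (1 - \<open>\<beta>\<close>) matches the leading terms of
    \<open>w\<close> and \<open>K * a\<close>, so their difference is o(n powr
    -\<open>\<beta>\<close>).\<close>
  define K where "K = C * Gamma (1 - \<beta>)"
  define a where "a = bin_seq \<beta>"
  define \<delta> where "\<delta> n = \<bar>w n - K * a n\<bar>" for n
  define R where "R t = S t - of_real K * (1 - cis t) powr of_real \<beta>" for t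
  have G: "Gamma (1 - \<beta>) > 0"
    using beta by (intro Gamma_real_pos) auto
  have a_nonneg: "0 \<le> a n" for n
    using bin_seq_pos[OF beta] by (simp add: a_def less_imp_le)
  have w_nonneg: "0 \<le> w n" for n
    using decseq_ge[OF dec w0] by simp
  have C0: "0 \<le> C"
    by (rule LIMSEQ_le_const[OF w]) (use w_nonneg in auto)
  then have K0: "0 \<le> K"
    using G by (simp add: K_def)
  have a_lim: "(\<lambda>n. a n * real n powr \<beta>) \<longlonglongrightarrow> 1 / Gamma (1 - \<beta>)"
    unfolding a_def by (rule bin_seq_asymp[OF beta])
  have "(\<lambda>n. \<bar>w n * real n powr \<beta> - K * (a n * real n powr \<beta>)\<bar>) \<longlonglongrightarrow> \<bar>C - K * (1 / Gamma (1 - \<beta>))\<bar>"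
    by (intro tendsto_intros w a_lim)
  moreover have "\<bar>w n * real n powr \<beta> - K * (a n * real n powr \<beta>)\<bar> = \<delta> n * real n powr \<beta>" for n
  proof -
    have "w n * real n powr \<beta> - K * (a n * real n powr \<beta>) = (w n - K * a n) * real n powr \<beta>"
      by (simp add: algebra_simps)
    then show ?thesis by (simp add: \<delta>_def abs_mult)
  qed
  ultimately have "(\<lambda>n. \<delta> n * real n powr \<beta>) \<longlonglongrightarrow> 0"
    using G by (simp add: K_def)
  from sum_little_o[OF beta this] have head: "(\<lambda>N. (\<Sum>n<N. \<delta> n) / real N powr (1 - \<beta>)) \<longlonglongrightarrow> 0"
    by simp
  have "convergent (\<lambda>n. w n * real n powr \<beta> + K * (a n * real n powr \<beta>))"
    by (rule convergentI) (rule tendsto_add[OF w tendsto_mult[OF tendsto_const a_lim]])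
  then have "convergent (\<lambda>n. (w n + K * a n) * real n powr \<beta>)"
    by (simp add: distrib_right mult.assoc)
  then obtain B where B: "\<And>n. \<bar>(w n + K * a n) * real n powr \<beta>\<bar> \<le> B" "0 < B"
    using convergent_imp_Bseq[of "\<lambda>n. (w n + K * a n) * real n powr \<beta>"] by (auto simp: Bseq_def)
  have R_bound: "norm (R t) \<le> \<bar>t\<bar> * (\<Sum>n<N. \<delta> n) + 2 * (w N + K * a N)" if t: "cis t \<noteq> 1" for t N
  proof -
    let ?d = "\<lambda>n. cis t ^ n - cis t ^ Suc n"
    have gf: "(\<lambda>n. of_real (a n) * ?d n) sums ((1 - cis t) powr of_real \<beta>)"
      unfolding a_def by (rule bin_seq_gf[OF beta]) (use t in auto)
    have 1: "norm (S t - (\<Sum>n<N. of_real (w n) * ?d n)) \<le> 2 * w N"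
      by (rule abel_tail[OF dec w0 _ S]) simp
    have 2: "norm ((1 - cis t) powr of_real \<beta> - (\<Sum>n<N. of_real (a n) * ?d n)) \<le> 2 * a N"
      unfolding a_def
      by (rule abel_tail[OF decseq_bin_seq[OF beta] bin_seq_tendsto_0[OF beta] _ gf[unfolded a_def]]) simp
    have "R t = (S t - (\<Sum>n<N. of_real (w n) * ?d n))
        - of_real K * ((1 - cis t) powr of_real \<beta> - (\<Sum>n<N. of_real (a n) * ?d n))
        + (\<Sum>n<N. of_real (w n - K * a n) * ?d n)"
      by (simp add: R_def sum_subtractf sum_distrib_left right_diff_distrib left_diff_distrib mult.assoc)
    then have "norm (R t) \<le> norm (S t - (\<Sum>n<N. of_real (w n) * ?d n))
        + norm (of_real K * ((1 - cis t) powr of_real \<beta> - (\<Sum>n<N. of_real (a n) * ?d n)))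
        + norm (\<Sum>n<N. of_real (w n - K * a n) * ?d n)"
      by (simp only:) (rule order.trans[OF norm_triangle_ineq add_right_mono[OF norm_triangle_ineq4]])
    moreover have "\<dots> \<le> (2 * w N + K * (2 * a N)) + (\<Sum>n<N. \<delta> n * \<bar>t\<bar>)"
    proof (rule add_mono[OF add_mono[OF 1]])
      show "norm (of_real K * ((1 - cis t) powr of_real \<beta> - (\<Sum>n<N. of_real (a n) * ?d n))) \<le> K * (2 * a N)"
        using mult_left_mono[OF 2 K0] K0 by (simp add: norm_mult)
      have "norm (of_real (w n - K * a n) * ?d n) \<le> \<delta> n * \<bar>t\<bar>" for n
      proof -
        have "norm (?d n) = norm (cis t ^ n * (cis 0 - cis t))"
          by (simp add: algebra_simps)
        also have "\<dots> \<le> \<bar>t\<bar>"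
          using norm_cis_diff_le[of 0 t] by (simp add: norm_mult norm_power)
        finally show ?thesis
          unfolding norm_mult norm_of_real \<delta>_def by (rule mult_left_mono) simp
      qed
      then show "norm (\<Sum>n<N. of_real (w n - K * a n) * ?d n) \<le> (\<Sum>n<N. \<delta> n * \<bar>t\<bar>)"
        by (rule sum_norm_le)
    qed
    ultimately have "norm (R t) \<le> (2 * w N + K * (2 * a N)) + (\<Sum>n<N. \<delta> n * \<bar>t\<bar>)"
      by (rule order.trans)
    then show ?thesis
      by (simp add: sum_distrib_left mult.commute)
  qed
  have "((\<lambda>t. R t / of_real (t powr \<beta>)) \<longlongrightarrow> 0) (at_right 0)"
  proof (rule tendstoI)
    fix e :: real assume e: "0 < e"
    have "((\<lambda>M. 2 * (B * M powr - \<beta>)) \<longlongrightarrow> 0) at_top"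
      using beta by real_asymp
    then have "\<forall>\<^sub>F M in at_top. 2 * (B * M powr - \<beta>) < e / 2"
      using e by (intro order_tendstoD) auto
    then have "\<forall>\<^sub>F M in at_top. 2 * (B * M powr - \<beta>) < e / 2 \<and> 1 < M"
      using eventually_gt_at_top by (rule eventually_conj)
    then obtain M :: real where M: "2 * (B * M powr - \<beta>) < e / 2" "1 < M"
      using eventually_happens'[OF trivial_limit_at_top_linorder] by blast
    \<comment> \<open>\<open>M\<close> is fixed before t, large enough to make the tail beyond the
      cut small. As \<open>N t \<le> 2 * M / t\<close>, the head then picks up only the constant
      factor (2 * M) powr (1 - \<open>\<beta>\<close>) in front of a quantity tending to 0.\<close>
    define N where "N t = nat \<lceil>M / t\<rceil>" for t
    have N_top: "filterlim N sequentially (at_right 0)"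
      unfolding N_def using M(2) by real_asymp
    have "((\<lambda>t. (2 * M) powr (1 - \<beta>) * ((\<Sum>n<N t. \<delta> n) / real (N t) powr (1 - \<beta>))) \<longlongrightarrow> (2 * M) powr (1 - \<beta>) * 0) (at_right 0)"
      by (intro tendsto_mult tendsto_const filterlim_compose[OF head N_top])
    then have "\<forall>\<^sub>F t in at_right 0. (2 * M) powr (1 - \<beta>) * ((\<Sum>n<N t. \<delta> n) / real (N t) powr (1 - \<beta>)) < e / 2"
      using e by (intro order_tendstoD) auto
    moreover have "\<forall>\<^sub>F t in at_right 0. t \<in> {0<..<1::real}"
      by (rule eventually_at_right_real) simp
    ultimately show "\<forall>\<^sub>F t in at_right 0. dist (R t / of_real (t powr \<beta>)) 0 < e"
    proof eventually_elim
      case (elim t)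
      then have t: "0 < t" "t < 1" by auto
      have cis1: "cis t \<noteq> 1"
      proof
        assume "cis t = 1"
        then have "sin t = 0" by (simp add: complex_eq_iff)
        then show False
          using sin_gt_zero[of t] t pi_gt3 by simp
      qed
      have N1: "M / t \<le> real (N t)" "real (N t) \<le> 2 * M / t" "1 \<le> M / t"
      proof -
        show 1: "1 \<le> M / t"
          using t M by (simp add: field_simps)
        have "real (N t) = of_int \<lceil>M / t\<rceil>"
          unfolding N_def using 1 by (subst of_nat_nat) auto
        moreover have "of_int \<lceil>M / t\<rceil> < M / t + 1"
          by linarith
        ultimately show "M / t \<le> real (N t)" "real (N t) \<le> 2 * M / t"
          using 1 by (simp_all add: add_divide_distrib[symmetric]) 
      qed
      have Npos: "0 < real (N t)"
        using N1 by linarith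
      let ?s = "\<Sum>n<N t. \<delta> n"
      have s0: "0 \<le> ?s"
        by (intro sum_nonneg) (simp add: \<delta>_def)
      have "t * ?s / t powr \<beta> = t powr (1 - \<beta>) * real (N t) powr (1 - \<beta>) * (?s / real (N t) powr (1 - \<beta>))"
        using t Npos by (simp add: powr_diff)
      also have "\<dots> = (t * real (N t)) powr (1 - \<beta>) * (?s / real (N t) powr (1 - \<beta>))"
        using t Npos by (simp add: powr_mult)
      also have "\<dots> \<le> (2 * M) powr (1 - \<beta>) * (?s / real (N t) powr (1 - \<beta>))"
        using t N1 beta s0 by (intro mult_right_mono powr_mono2) (auto simp: field_simps)
      also have "\<dots> < e / 2"
        using elim by simp
      finally have h: "t * ?s / t powr \<beta> < e / 2" .
      have "w (N t) + K * a (N t) \<le> B / real (N t) powr \<beta>"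
        using B(1)[of "N t"] Npos w_nonneg a_nonneg K0 by (simp add: field_simps)
      also have "\<dots> \<le> B / (M / t) powr \<beta>"
        using B(2) N1 Npos beta t M by (intro divide_left_mono powr_mono2 mult_pos_pos) auto
      finally have "2 * (w (N t) + K * a (N t)) / t powr \<beta> \<le> 2 * (B / (M / t) powr \<beta>) / t powr \<beta>"
        by (intro divide_right_mono mult_left_mono) auto
      also have "\<dots> = 2 * (B * M powr - \<beta>)"
        using t M by (simp add: powr_divide powr_minus field_simps)
      also note M(1)
      finally have l: "2 * (w (N t) + K * a (N t)) / t powr \<beta> < e / 2" .
      have "norm (R t) / t powr \<beta> \<le> (t * ?s + 2 * (w (N t) + K * a (N t))) / t powr \<beta>"
        using R_bound[OF cis1, of "N t"] t by (intro divide_right_mono) auto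
      also have "\<dots> = t * ?s / t powr \<beta> + 2 * (w (N t) + K * a (N t)) / t powr \<beta>"
        by (rule add_divide_distrib)
      also have "\<dots> < e / 2 + e / 2"
        by (rule add_strict_mono[OF h l])
      also have "\<dots> = e"
        by simp
      finally show "dist (R t / of_real (t powr \<beta>)) 0 < e"
        using t by (simp add: norm_divide)
    qed
  qed
  then have "((\<lambda>t. R t / of_real (t powr \<beta>) + of_real K * ((1 - cis t) powr of_real \<beta> / of_real (t powr \<beta>)))
      \<longlongrightarrow> 0 + of_real K * cis (- (pi * \<beta> / 2))) (at_right 0)"
    by (intro tendsto_intros bin_gf_asymp)
  then show ?thesis
    by (simp add: R_def K_def flip: add_divide_distrib)
qed

section \<open>The Thaler map and its first return map\<close>

locale thaler =
  fixes \<gamma> :: real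
  assumes gamma_pos: "0 < \<gamma>" and gamma_neq_1: "\<gamma> \<noteq> 1"
begin

text \<open>Normalised so that b 2 - b 1 = 1, which makes U 1 = 1. Its sign is that of 1 -
  \<open>\<gamma>\<close>, so \<open>b\<close> increases in both regimes and one argument serves
  them.\<close>

definition c :: real where "c = 1 / (2 powr (1 - \<gamma>) - 1)"

definition \<kappa> :: real where "\<kappa> = c * (1 - \<gamma>)"

definition b :: "real \<Rightarrow> real" where "b x = c * x powr (1 - \<gamma>)"

definition U :: "real \<Rightarrow> real" where "U x = b x + b (1 + x) - 2 * c"

abbreviation h :: "real \<Rightarrow> real" where "h \<equiv> thaler_h \<gamma>"

lemma c_denom: "2 powr (1 - \<gamma>) \<noteq> 1"
  using gamma_neq_1 by simp

lemma kappa_pos: "0 < \<kappa>"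
proof (cases "\<gamma> < 1")
  case True
  then have "1 < 2 powr (1 - \<gamma>)"
    using powr_less_cancel_iff[of 2 0 "1 - \<gamma>"] by simp
  then show ?thesis
    using True by (simp add: \<kappa>_def c_def)
next
  case False
  then have "2 powr (1 - \<gamma>) < 1" "1 - \<gamma> < 0"
    using powr_less_cancel_iff[of 2 "1 - \<gamma>" 0] gamma_neq_1 by auto
  then show ?thesis
    by (simp add: \<kappa>_def c_def divide_neg_neg)
qed

lemma kappa_eq: "\<kappa> = (1 - \<gamma>) / (2 powr (1 - \<gamma>) - 1)"
  by (simp add: \<kappa>_def c_def)

lemma b_1: "b 1 = c"
  by (simp add: b_def)

lemma b_2: "b 2 = c + 1"
  using c_denom by (simp add: b_def c_def divide_simps)

lemma b_deriv: "0 < x \<Longrightarrow> (b has_real_derivative \<kappa> * x powr (- \<gamma>)) (at x)"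
  unfolding b_def [abs_def] \<kappa>_def by (auto intro!: derivative_eq_intros)

lemma b_less: "0 < x \<Longrightarrow> x < y \<Longrightarrow> b x < b y"
  using kappa_pos by (intro DERIV_pos_imp_increasing[of x y b]) (force intro!: b_deriv mult_pos_pos)+

lemma b_le: "0 < x \<Longrightarrow> x \<le> y \<Longrightarrow> b x \<le> b y"
  using b_less[of x y] by (cases "x = y") auto

lemma b_less_iff: "0 < x \<Longrightarrow> 0 < y \<Longrightarrow> b x < b y \<longleftrightarrow> x < y"
  using b_less[of x y] b_le[of y x] by (meson not_le)

lemma h_pos: "0 < x \<Longrightarrow> 0 < h x"
  by (simp add: thaler_h_def add_pos_pos)

lemma U_deriv: "0 < x \<Longrightarrow> (U has_real_derivative \<kappa> * h x) (at x)"
proof -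
  assume "0 < x"
  then have "((\<lambda>x. b x + b (1 + x) - 2 * c) has_real_derivative \<kappa> * x powr (- \<gamma>) + \<kappa> * (1 + x) powr (- \<gamma>) * 1 - 0) (at x)"
    by (intro DERIV_diff DERIV_add b_deriv DERIV_chain2[where f = b] DERIV_const)
      (auto intro!: derivative_eq_intros)
  then show ?thesis
    by (simp add: U_def [abs_def] thaler_h_def algebra_simps)
qed

lemma U_less: "0 < x \<Longrightarrow> x < y \<Longrightarrow> U x < U y"
  using kappa_pos by (intro DERIV_pos_imp_increasing[of x y U]) (force intro!: U_deriv mult_pos_pos h_pos)+

lemma U_less_iff: "0 < x \<Longrightarrow> 0 < y \<Longrightarrow> U x < U y \<longleftrightarrow> x < y"
  using U_less[of x y] U_less[of y x] by (cases x y rule: linorder_cases) auto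

lemma U_inj: "0 < x \<Longrightarrow> 0 < y \<Longrightarrow> U x = U y \<longleftrightarrow> x = y"
  using U_less_iff[of x y] U_less_iff[of y x] by auto

lemma U_continuous: "continuous_on {0<..} U"
  by (intro continuous_at_imp_continuous_on ballI) (use U_deriv in \<open>auto intro: DERIV_isCont\<close>)

text \<open>Concavity of \<open>b\<close>: its increments over intervals of length \<open>x\<close> decrease.\<close>

lemma b_increment_le:
  assumes "0 < x" "x \<le> 1"
  shows "b (1 + x) - b 1 \<le> b (2 * x) - b x"
proof -
  have "(\<lambda>s. b (s + x) - b s) 1 \<le> (\<lambda>s. b (s + x) - b s) x"
  proof (rule DERIV_nonpos_imp_nonincreasing[OF assms(2)])
    fix s assume s: "x \<le> s" "s \<le> 1"
    have "((\<lambda>s. b (s + x) - b s) has_real_derivative \<kappa> * (s + x) powr (- \<gamma>) * 1 - \<kappa> * s powr (- \<gamma>)) (at s)"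
      using s assms by (intro DERIV_diff b_deriv DERIV_chain2[where f = b]) (auto intro!: derivative_eq_intros)
    moreover have "(s + x) powr (- \<gamma>) \<le> s powr (- \<gamma>)"
      using s assms gamma_pos by (intro powr_mono2') auto
    ultimately show "\<exists>y. ((\<lambda>s. b (s + x) - b s) has_real_derivative y) (at s) \<and> y \<le> 0"
      using kappa_pos by (auto simp: mult_left_mono)
  qed
  then show ?thesis by simp
qed

definition V :: "real \<Rightarrow> real" where
  "V z = (THE x. 0 < x \<and> U x = b z - b 1)"

lemma V_ex:
  assumes "0 < z"
  shows "\<exists>x. 0 < x \<and> x < z \<and> U x = b z - b 1"
proof -
  \<comment> \<open>The lower end for the intermediate value theorem: since 2 * a lies below
    \<open>z\<close>, the concavity estimate gives b (1 + a) - b 1 <= b z - b a, that is, U a <= b z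
    - b 1. The cap at 1 is the range of that estimate.\<close>
  define a where "a = min 1 (z / 2)"
  have a: "0 < a" "a \<le> 1" "2 * a \<le> z" "a < z"
    using assms by (auto simp: a_def)
  have "U a \<le> b z - b 1"
    using b_increment_le[OF a(1,2)] b_le[of "2 * a" z] a by (simp add: U_def b_1)
  moreover have "b z - b 1 < U z"
    using b_less[of 1 "1 + z"] assms by (simp add: U_def b_1)
  moreover have "continuous_on {a..z} U"
    using a by (intro continuous_on_subset[OF U_continuous]) auto
  ultimately obtain x where "a \<le> x" "x \<le> z" "U x = b z - b 1"
    using IVT'[of U a "b z - b 1" z] a by auto
  with a \<open>b z - b 1 < U z\<close> show ?thesis
    by (intro exI[of _ x]) (cases "x = z", auto)
qed

lemma V_eqI: "0 < x \<Longrightarrow> U x = b z - b 1 \<Longrightarrow> V z = x"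
  unfolding V_def by (rule the_equality) (simp, metis U_inj)

lemma
  assumes "0 < z"
  shows V_pos: "0 < V z" and V_less_self: "V z < z" and U_V: "U (V z) = b z - b 1"
  using V_ex[OF assms] V_eqI by auto

lemma V_less_iff: "0 < y \<Longrightarrow> 0 < z \<Longrightarrow> V y < V z \<longleftrightarrow> y < z"
  using U_less_iff[of "V y" "V z"] b_less_iff[of y z] by (simp add: V_pos U_V)

lemma V_le_iff: "0 < y \<Longrightarrow> 0 < z \<Longrightarrow> V y \<le> V z \<longleftrightarrow> y \<le> z"
  using V_less_iff[of z y] by (simp add: not_less[symmetric])

lemma V_deriv:
  assumes "0 < z"
  shows "(V has_real_derivative z powr (- \<gamma>) / h (V z)) (at z)"
proof -
  \<comment> \<open>\<open>V\<close> becomes the inverse of \<open>U\<close> composed with the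
    explicit function b - b 1, which brings it within reach of the inverse function theorem.\<close>
  have bV: "V z' = (inv_into {0<..} U) (b z' - b 1)" if "0 < z'" for z'
    using that U_inj by (subst U_V[OF that, symmetric], subst inv_into_f_f) (auto simp: inj_on_def V_pos)
  have inv: "(inv_into {0<..} U has_real_derivative inverse (\<kappa> * h (V z))) (at (b z - b 1))"
    unfolding has_field_derivative_def
  proof (rule has_derivative_inverse_strong_x[where S = "{0<..}" and f = U])
    show "(U has_derivative (*) (\<kappa> * h (V z))) (at (inv_into {0<..} U (b z - b 1)))"
      unfolding bV[OF assms, symmetric] has_field_derivative_def[symmetric] by (rule U_deriv[OF V_pos[OF assms]])
    show "(*) (\<kappa> * h (V z)) \<circ> (*) (inverse (\<kappa> * h (V z))) = id"
      using kappa_pos h_pos[OF V_pos[OF assms]]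
      by (simp add: fun_eq_iff mult.assoc[symmetric] del: inverse_mult_distrib)
    show "inv_into {0<..} U (b z - b 1) \<in> {0<..}" "U (inv_into {0<..} U (b z - b 1)) = b z - b 1"
      unfolding bV[OF assms, symmetric] by (simp_all add: V_pos U_V assms)
    show "inv_into {0<..} U (U x) = x" if "x \<in> {0<..}" for x
      using that U_inj by (intro inv_into_f_f) (auto simp: inj_on_def)
  qed (auto intro: U_continuous)
  have "((\<lambda>z. inv_into {0<..} U (b z - b 1)) has_real_derivative inverse (\<kappa> * h (V z)) * (\<kappa> * z powr (- \<gamma>) - 0)) (at z)"
    by (rule DERIV_chain2[where f = "inv_into {0<..} U" and g = "\<lambda>z. b z - b 1", OF inv]) (intro DERIV_diff DERIV_const b_deriv assms)
  then have "((\<lambda>z. inv_into {0<..} U (b z - b 1)) has_real_derivative z powr (- \<gamma>) / h (V z)) (at z)"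
    using kappa_pos h_pos[OF V_pos[OF assms]] by (simp add: field_simps)
  then show ?thesis
    by (rule has_field_derivative_transform_within_open[where S = "{0<..}"]) (use assms bV in auto)
qed

lemma V_2: "V 2 = 1"
  using b_2 by (intro V_eqI) (auto simp: U_def b_1)

definition xstar :: real where "xstar = V 1"

lemma xstar_pos: "0 < xstar" and xstar_less_1: "xstar < 1" and U_xstar: "U xstar = 0"
  by (simp_all add: xstar_def V_pos V_less_self U_V)

lemma U_0_iff: "U x = 0 \<longleftrightarrow> x powr (1 - \<gamma>) + (1 + x) powr (1 - \<gamma>) = 2"
proof -
  have "c \<noteq> 0"
    using c_denom by (simp add: c_def)
  moreover have "U x = c * (x powr (1 - \<gamma>) + (1 + x) powr (1 - \<gamma>) - 2)"
    by (simp add: U_def b_def algebra_simps)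
  ultimately show ?thesis by simp
qed

lemma thaler_star_eq: "thaler_star \<gamma> = xstar"
  unfolding thaler_star_def U_0_iff[symmetric]
  by (rule the_equality) (use xstar_pos xstar_less_1 U_xstar U_inj[of _ xstar] in auto)

lemma thaler_Y_eq: "thaler_Y \<gamma> = {xstar<..1}"
  by (simp add: thaler_Y_def thaler_star_eq)

text \<open>A point y of (0,1) has the two preimages \<open>V y\<close> and \<open>V (1 + y)\<close>
  under the Thaler map. Relative to the density \<open>h\<close> these branches have weights
  \<open>r y\<close> and \<open>1 - r y\<close>; that they sum to 1 is the invariance of
  \<open>h\<close>.\<close>

definition r :: "real \<Rightarrow> real" where "r x = x powr (- \<gamma>) / h x"

lemma r_eq: "0 < x \<Longrightarrow> r x = 1 / (1 + (x / (1 + x)) powr \<gamma>)"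
  by (simp add: r_def thaler_h_def powr_minus powr_divide divide_simps add.commute)

lemma r_nonneg: "0 \<le> r x"
  by (simp add: r_def thaler_h_def)

lemma r_le_1: "r x \<le> 1"
proof (cases "h x = 0")
  case False
  then have "0 < h x"
    using powr_ge_zero[of x "- \<gamma>"] powr_ge_zero[of "x + 1" "- \<gamma>"] by (simp add: thaler_h_def less_le)
  then show ?thesis
    by (simp add: r_def thaler_h_def divide_le_eq)
qed (simp add: r_def)

text \<open>The sole source of monotonicity for the products \<open>Q n\<close>, and through them
  for the transfer operator.\<close>

lemma r_antimono:
  assumes "0 < x" "x \<le> y"
  shows "r y \<le> r x"
proof -
  have "x / (1 + x) \<le> y / (1 + y)"
    using assms by (simp add: divide_simps algebra_simps)
  then have "(x / (1 + x)) powr \<gamma> \<le> (y / (1 + y)) powr \<gamma>"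
    using assms gamma_pos by (intro powr_mono2) auto
  then show ?thesis
    using assms by (simp add: r_eq frac_le add_pos_nonneg)
qed

text \<open>The origin of the contraction factor 1/2 and of the factor 2 in the bound by the
  mean.\<close>

lemma r_1_ge: "1 / 2 \<le> r 1"
proof -
  have "(1 / 2) powr \<gamma> \<le> 1"
    using gamma_pos by (intro powr_le1) auto
  then show ?thesis
    by (simp add: r_eq field_simps add_pos_nonneg)
qed

lemma r_continuous: "continuous_on {0<..} r"
  unfolding r_def [abs_def] thaler_h_def
proof (intro continuous_intros ballI)
  fix x :: real assume "x \<in> {0<..}"
  then show "x powr - \<gamma> + (x + 1) powr - \<gamma> \<noteq> 0"
    using h_pos[of x] by (simp add: thaler_h_def)
qed auto

lemma one_minus_r: "0 < x \<Longrightarrow> 1 - r x = (1 + x) powr (- \<gamma>) / h x"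
  using h_pos[of x] by (simp add: r_def thaler_h_def field_simps add.commute)

lemma V_isCont: "0 < z \<Longrightarrow> isCont V z"
  using V_deriv by (blast intro: DERIV_isCont)

section \<open>Inverse branches of the return map and their weights\<close>

lemma V_pow_pos: "0 < y \<Longrightarrow> 0 < (V ^^ n) y"
  by (induction n) (simp_all add: V_pos)

lemma V_pow_le_iff: "0 < y \<Longrightarrow> 0 < z \<Longrightarrow> (V ^^ n) y \<le> (V ^^ n) z \<longleftrightarrow> y \<le> z"
  by (induction n) (simp_all add: V_le_iff V_pow_pos)

lemma V_pow_Suc_less: "0 < y \<Longrightarrow> (V ^^ Suc n) y < (V ^^ n) y"
  by (simp add: V_less_self V_pow_pos)

lemma V_pow_antimono: "0 < y \<Longrightarrow> m \<le> n \<Longrightarrow> (V ^^ n) y \<le> (V ^^ m) y"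
  by (rule lift_Suc_antimono_le[of "\<lambda>n. (V ^^ n) y"]) (use V_pow_Suc_less in \<open>auto intro: less_imp_le\<close>)

text \<open>The total weight of taking the left preimage \<open>n\<close> times in a row, starting
  from \<open>y\<close>.\<close>

definition Q :: "nat \<Rightarrow> real \<Rightarrow> real" where "Q n y = (\<Prod>j<n. r ((V ^^ j) y))"

lemma Q_Suc: "Q (Suc n) y = Q n y * r ((V ^^ n) y)"
  by (simp add: Q_def)

lemma Q_Suc': "Q (Suc n) y = r y * Q n (V y)"
  unfolding Q_def by (subst prod.lessThan_Suc_shift) (simp add: funpow_swap1)

lemma Q_nonneg: "0 \<le> Q n y"
  unfolding Q_def by (intro prod_nonneg ballI r_nonneg)

lemma Q_Suc_le: "Q (Suc n) y \<le> Q n y"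
  using mult_left_mono[OF r_le_1[of "(V ^^ n) y"] Q_nonneg[of n y]] by (simp add: Q_Suc)

lemma Q_antimono: "0 < y \<Longrightarrow> y \<le> z \<Longrightarrow> Q n z \<le> Q n y"
  unfolding Q_def by (intro prod_mono conjI r_nonneg r_antimono) (auto simp: V_pow_pos V_pow_le_iff)

lemma V_pow_deriv:
  assumes "0 < y"
  shows "((V ^^ n) has_real_derivative Q n y * h y / h ((V ^^ n) y)) (at y)"
proof (induction n)
  case 0
  show ?case
    using h_pos[OF assms] by (auto simp: Q_def id_def intro!: derivative_eq_intros)
next
  case (Suc n)
  have "((\<lambda>y. V ((V ^^ n) y)) has_real_derivative
      ((V ^^ n) y) powr (- \<gamma>) / h (V ((V ^^ n) y)) * (Q n y * h y / h ((V ^^ n) y))) (at y)"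
    by (rule DERIV_chain2[OF V_deriv Suc]) (rule V_pow_pos[OF assms])
  then show ?case
    by (simp add: o_def Q_Suc r_def mult_ac)
qed

definition \<psi> :: "nat \<Rightarrow> real \<Rightarrow> real" where "\<psi> n y = V (1 + (V ^^ n) y)"

definition w :: "nat \<Rightarrow> real \<Rightarrow> real" where "w n y = Q n y - Q (Suc n) y"

lemma w_nonneg: "0 \<le> w n y"
  using Q_Suc_le by (simp add: w_def)

lemma psi_pos: "0 < y \<Longrightarrow> 0 < \<psi> n y"
  by (simp add: \<psi>_def V_pos V_pow_pos add_pos_pos)

lemma psi_le_iff: "0 < y \<Longrightarrow> 0 < z \<Longrightarrow> \<psi> n y \<le> \<psi> n z \<longleftrightarrow> y \<le> z"
  by (simp add: \<psi>_def V_le_iff V_pow_pos add_pos_pos V_pow_le_iff)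

lemma psi_antimono: "0 < y \<Longrightarrow> m \<le> n \<Longrightarrow> \<psi> n y \<le> \<psi> m y"
  by (simp add: \<psi>_def V_le_iff V_pow_pos add_pos_pos V_pow_antimono)

lemma xstar_less_psi: "0 < y \<Longrightarrow> xstar < \<psi> n y"
  by (simp add: \<psi>_def xstar_def V_less_iff V_pow_pos add_pos_pos)

lemma psi_le_1: "0 < y \<Longrightarrow> y \<le> 1 \<Longrightarrow> \<psi> n y \<le> 1"
  using V_pow_antimono[of y 0 n] by (subst V_2[symmetric]) (simp add: \<psi>_def V_le_iff V_pow_pos add_pos_pos)

text \<open>In the form h (\<open>\<psi>\<close> n y) * \<open>\<psi>\<close>' = w n y * h y: the
  weight is the Jacobian of the branch with respect to the measure with density
  \<open>h\<close>.\<close>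

lemma psi_deriv:
  assumes "0 < y"
  shows "((\<psi> n) has_real_derivative w n y * h y / h (\<psi> n y)) (at y)"
proof -
  let ?v = "(V ^^ n) y"
  have v: "0 < ?v" by (rule V_pow_pos[OF assms])
  have "((\<lambda>y. V (1 + (V ^^ n) y)) has_real_derivative
      (1 + ?v) powr (- \<gamma>) / h (V (1 + ?v)) * (0 + Q n y * h y / h ?v)) (at y)"
    by (rule DERIV_chain2[OF V_deriv DERIV_add[OF DERIV_const V_pow_deriv[OF assms]]]) (use v in simp)
  moreover have "(1 + ?v) powr (- \<gamma>) / h (V (1 + ?v)) * (0 + Q n y * h y / h ?v) = w n y * h y / h (\<psi> n y)"
  proof -
    have "w n y = Q n y * ((1 + ?v) powr (- \<gamma>) / h ?v)"
      unfolding one_minus_r[OF v, symmetric] by (simp add: w_def Q_Suc right_diff_distrib)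
    then show ?thesis
      by (simp add: \<psi>_def mult_ac)
  qed
  ultimately show ?thesis
    by (simp add: \<psi>_def [abs_def])
qed

lemma psi_isCont: "0 < y \<Longrightarrow> isCont (\<psi> n) y"
  using psi_deriv by (blast intro: DERIV_isCont)

lemma V_pow_tendsto_0:
  assumes "0 < y"
  shows "(\<lambda>n. (V ^^ n) y) \<longlonglongrightarrow> 0"
proof -
  have "decseq (\<lambda>n. (V ^^ n) y)"
    using V_pow_antimono[OF assms] by (simp add: decseq_def)
  then obtain l where l: "(\<lambda>n. (V ^^ n) y) \<longlonglongrightarrow> l"
    using decseq_convergent[of _ 0] V_pow_pos[OF assms] less_imp_le by metis
  then have "0 \<le> l"
    by (rule LIMSEQ_le_const) (use V_pow_pos[OF assms] in \<open>auto intro: less_imp_le\<close>)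
  moreover have False if "0 < l"
  proof -
    have "(\<lambda>n. V ((V ^^ n) y)) \<longlonglongrightarrow> V l"
      by (rule isCont_tendsto_compose[OF V_isCont[OF that] l])
    moreover have "(\<lambda>n. V ((V ^^ n) y)) \<longlonglongrightarrow> l"
      using LIMSEQ_Suc[OF l] by simp
    ultimately show False
      using LIMSEQ_unique V_less_self[OF that] by fastforce
  qed
  ultimately show ?thesis
    using l by (cases "l = 0") auto
qed

lemma psi_tendsto_xstar:
  assumes "0 < y"
  shows "(\<lambda>n. \<psi> n y) \<longlonglongrightarrow> xstar"
  unfolding \<psi>_def xstar_def
  by (rule isCont_tendsto_compose[OF V_isCont])
     (use tendsto_add[OF tendsto_const[of 1] V_pow_tendsto_0[OF assms]] in simp_all)

text \<open>Because V 1 = \<open>xstar\<close>, consecutive branch images of \<open>Y\<close> share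
  an endpoint and tile \<open>Y\<close> without gaps.\<close>

lemma psi_Suc_1: "\<psi> (Suc n) 1 = \<psi> n xstar"
  by (simp add: \<psi>_def xstar_def funpow_swap1)

lemma psi_0_1: "\<psi> 0 1 = 1"
  by (simp add: \<psi>_def V_2)

lemma U_psi: "0 < y \<Longrightarrow> U (\<psi> n y) = b (1 + (V ^^ n) y) - b 1"
  unfolding \<psi>_def by (rule U_V) (simp add: V_pow_pos add_pos_pos)

lemma U_diff_V_pow: "0 < y \<Longrightarrow> U ((V ^^ n) y) - U ((V ^^ Suc n) y) = b (1 + (V ^^ n) y) - b 1"
  using U_V[OF V_pow_pos, of y n] by (simp add: U_def b_1)

lemma b_isCont: "0 < x \<Longrightarrow> isCont b x"
  using b_deriv by (blast intro: DERIV_isCont)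

lemma h_antimono: "0 < x \<Longrightarrow> x \<le> y \<Longrightarrow> h y \<le> h x"
  using gamma_pos by (simp add: thaler_h_def add_mono powr_mono2')

text \<open>This says that no mass escapes, so that the branch weights sum to 1. The factors of the
  product tend to 1, so it is bounded globally: \<open>Q n\<close> times \<open>\<kappa> * h\<close>
  is the derivative of U along V^n, whose increment from \<open>xstar\<close> to 1 is b (1 + V^n 1)
  - b 1 and tends to 0. As \<open>Q n\<close> and \<open>h\<close> decrease, the mean value
  dominates the value at 1.\<close>

lemma Q_1_tendsto_0: "(\<lambda>n. Q n 1) \<longlonglongrightarrow> 0"
proof (rule tendsto_sandwich)
  show "\<forall>\<^sub>F n in sequentially. 0 \<le> Q n 1"
    by (simp add: Q_nonneg)
  show "\<forall>\<^sub>F n in sequentially. Q n 1 \<le> (b (1 + (V ^^ n) 1) - b 1) / ((1 - xstar) * (\<kappa> * h 1))"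
  proof (intro always_eventually allI)
    fix n
    have d: "((\<lambda>y. U ((V ^^ n) y)) has_real_derivative Q n y * (\<kappa> * h y)) (at y)" if "0 < y" for y
    proof -
      have "((\<lambda>y. U ((V ^^ n) y)) has_real_derivative \<kappa> * h ((V ^^ n) y) * (Q n y * h y / h ((V ^^ n) y))) (at y)"
        by (rule DERIV_chain2[OF U_deriv V_pow_deriv]) (simp_all add: that V_pow_pos)
      then show ?thesis
        using h_pos[OF V_pow_pos[OF that, of n]] by (simp add: mult_ac)
    qed
    obtain z where z: "xstar < z" "z < 1" "U ((V ^^ n) 1) - U ((V ^^ n) xstar) = (1 - xstar) * (Q n z * (\<kappa> * h z))"
      using MVT2[OF xstar_less_1, of "\<lambda>y. U ((V ^^ n) y)" "\<lambda>y. Q n y * (\<kappa> * h y)"] d xstar_pos by auto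
    have "(1 - xstar) * (Q n 1 * (\<kappa> * h 1)) \<le> (1 - xstar) * (Q n z * (\<kappa> * h z))"
      using z(1,2) xstar_pos xstar_less_1 kappa_pos h_pos[of 1] h_pos[of z]
      by (intro mult_left_mono mult_mono Q_antimono h_antimono Q_nonneg mult_nonneg_nonneg) auto
    also have "\<dots> = b (1 + (V ^^ n) 1) - b 1"
      unfolding z(3)[symmetric] using U_diff_V_pow[of 1 n] by (simp add: xstar_def funpow_swap1)
    finally show "Q n 1 \<le> (b (1 + (V ^^ n) 1) - b 1) / ((1 - xstar) * (\<kappa> * h 1))"
      using xstar_less_1 kappa_pos h_pos[of 1] by (simp add: field_simps)
  qed
  have "(\<lambda>n. b (1 + (V ^^ n) 1)) \<longlonglongrightarrow> b 1"
    by (rule isCont_tendsto_compose[OF b_isCont])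
       (use tendsto_add[OF tendsto_const[of 1] V_pow_tendsto_0[of 1]] in simp_all)
  then have "(\<lambda>n. (b (1 + (V ^^ n) 1) - b 1) / ((1 - xstar) * (\<kappa> * h 1))) \<longlonglongrightarrow> (b 1 - b 1) / ((1 - xstar) * (\<kappa> * h 1))"
    using xstar_less_1 kappa_pos h_pos[of 1] by (intro tendsto_intros) auto
  then show "(\<lambda>n. (b (1 + (V ^^ n) 1) - b 1) / ((1 - xstar) * (\<kappa> * h 1))) \<longlonglongrightarrow> 0"
    by simp
qed simp

text \<open>Monotonicity reduces the claim to \<open>xstar\<close>, and \<open>xstar\<close> = V 1
  reduces it to the point 1 at the cost of one factor \<open>r 1\<close>.\<close>

lemma Q_tendsto_0:
  assumes "xstar \<le> y"
  shows "(\<lambda>n. Q n y) \<longlonglongrightarrow> 0"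
proof (rule tendsto_sandwich[where f = "\<lambda>_. 0" and h = "\<lambda>n. Q (Suc n) 1 / r 1"])
  show "\<forall>\<^sub>F n in sequentially. Q n y \<le> Q (Suc n) 1 / r 1"
  proof (intro always_eventually allI)
    fix n
    have "Q n y \<le> Q n xstar"
      by (rule Q_antimono[OF xstar_pos assms])
    also have "\<dots> = Q (Suc n) 1 / r 1"
      using r_1_ge by (simp add: Q_Suc' xstar_def)
    finally show "Q n y \<le> Q (Suc n) 1 / r 1" .
  qed
  show "(\<lambda>n. Q (Suc n) 1 / r 1) \<longlonglongrightarrow> 0"
    using tendsto_divide[OF LIMSEQ_Suc[OF Q_1_tendsto_0] tendsto_const[of "r 1"]] r_1_ge by simp
qed (simp_all add: Q_nonneg)

lemma w_sums_1: "xstar \<le> y \<Longrightarrow> (\<lambda>n. w n y) sums 1"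
  using telescope_sums'[OF Q_tendsto_0, of y] by (simp add: w_def) (simp add: Q_def)

section \<open>The transfer operator on monotone functions\<close>

definition K :: "(real \<Rightarrow> real) \<Rightarrow> real \<Rightarrow> real" where
  "K f y = (\<Sum>n. w n y * f (\<psi> n y))"

context
  fixes f :: "real \<Rightarrow> real" and lo hi :: real
  assumes f_antimono: "antimono_on {xstar<..1} f"
    and f_range: "\<And>y. y \<in> {xstar<..1} \<Longrightarrow> f y \<in> {lo..hi}"
    and lo_nonneg: "0 \<le> lo"
begin

lemma f_psi_range: "y \<in> {xstar..1} \<Longrightarrow> f (\<psi> n y) \<in> {lo..hi}"
  using xstar_pos by (intro f_range) (auto simp: xstar_less_psi psi_le_1)

lemma summable_w: "y \<in> {xstar..1} \<Longrightarrow> z \<in> {xstar..1} \<Longrightarrow> summable (\<lambda>n. w n y * f (\<psi> n z))"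
proof (rule summable_comparison_test')
  assume yz: "y \<in> {xstar..1}" "z \<in> {xstar..1}"
  then show "summable (\<lambda>n. w n y * hi)"
    using w_sums_1[of y] by (intro summable_mult2) (auto simp: sums_iff)
  show "norm (w n y * f (\<psi> n z)) \<le> w n y * hi" for n
    using f_psi_range[OF yz(2), of n] lo_nonneg w_nonneg by (auto simp: abs_mult intro!: mult_left_mono)
qed

lemma K_range: 
  assumes y: "y \<in> {xstar..1}"
  shows "K f y \<in> {lo..hi}"
proof -
  have s: "(\<lambda>n. w n y * a) sums a" for a
    using sums_mult2[OF w_sums_1, of y a] y by simp
  have "lo \<le> K f y"
    unfolding K_def by (rule sums_le[OF _ s summable_sums[OF summable_w]])
      (use y f_psi_range w_nonneg in \<open>auto intro!: mult_left_mono\<close>)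
  moreover have "K f y \<le> hi"
    unfolding K_def by (rule sums_le[OF _ summable_sums[OF summable_w] s])
      (use y f_psi_range w_nonneg in \<open>auto intro!: mult_left_mono\<close>)
  ultimately show ?thesis by simp
qed

text \<open>Raising \<open>y\<close> moves the branch weights towards the branches with small index, because the
  tails \<open>Q n y\<close> of the weights decrease in \<open>y\<close>, and these branches have the largest values.\<close>

lemma K_antimono:
  assumes y: "y \<in> {xstar..1}" and z: "z \<in> {xstar..1}" and "y \<le> z"
  shows "K f z \<le> K f y"
proof -
  define g where "g n = f (\<psi> n z)" for n
  have y0: "0 < y" "0 < z"
    using y z xstar_pos by auto
  have g: "g n \<le> g (Suc n)" for n
    unfolding g_def using f_antimono psi_antimono[OF y0(2), of n "Suc n"] xstar_less_psi[OF y0(2)] psi_le_1[OF y0(2)] z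
    by (auto simp: monotone_on_def)
  \<comment> \<open>Summation by parts in disguise: all mass beyond branch \<open>N\<close> is
    placed on the value \<open>g N\<close>. Passing to \<open>Suc N\<close> then adds
    \<open>Q (Suc N) u\<close> times a nonnegative increment of \<open>g\<close>, and the dependence
    on \<open>u\<close> is visible through \<open>Q\<close> alone.\<close>
  define R where "R N u = (\<Sum>n<N. w n u * g n) + Q N u * g N" for N u
  have "R N z \<le> R N y" for N
  proof (induction N)
    case (Suc N)
    have R: "R (Suc N) u = R N u + Q (Suc N) u * (g (Suc N) - g N)" for u
      by (simp add: R_def w_def algebra_simps)
    show ?case
      unfolding R using Suc g[of N] Q_antimono[OF y0(1) assms(3)] by (intro add_mono mult_right_mono) auto
  qed (simp add: R_def Q_def)
  moreover have lim: "(\<lambda>N. R N u) \<longlonglongrightarrow> (\<Sum>n. w n u * g n)" if u: "u \<in> {xstar..1}" for u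
  proof -
    have "(\<lambda>N. Q N u * g N) \<longlonglongrightarrow> 0"
    proof (rule Lim_null_comparison)
      have "\<bar>g n\<bar> \<le> hi" for n
        using f_psi_range[OF z, of n] lo_nonneg by (simp add: g_def)
      then show "\<forall>\<^sub>F n in sequentially. norm (Q n u * g n) \<le> Q n u * hi"
        by (intro always_eventually allI) (simp add: abs_mult Q_nonneg mult_left_mono)
      show "(\<lambda>n. Q n u * hi) \<longlonglongrightarrow> 0"
        using tendsto_mult_right[OF Q_tendsto_0, of u hi] u by simp
    qed
    then show ?thesis
      unfolding R_def using tendsto_add[OF summable_LIMSEQ[OF summable_w[OF u z]], of "\<lambda>N. Q N u * g N" 0]
      by (simp add: g_def)
  qed
  ultimately have "(\<Sum>n. w n z * g n) \<le> (\<Sum>n. w n y * g n)"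
    by (intro LIMSEQ_le[OF lim[OF z] lim[OF y]]) auto
  \<comment> \<open>With the weights now those of \<open>y\<close>, moving the branch points from
    \<open>z\<close> down to \<open>y\<close> only raises the antimonotone \<open>f\<close>.\<close>
  also have "\<dots> \<le> K f y"
    unfolding K_def g_def
  proof (intro suminf_le summable_w y z mult_left_mono w_nonneg)
    show "f (\<psi> n z) \<le> f (\<psi> n y)" for n
      using f_antimono assms y0 xstar_less_psi psi_le_1 psi_le_iff by (auto simp: monotone_on_def)
  qed
  finally show ?thesis
    by (simp add: K_def g_def)
qed

text \<open>All branches of 1 except the zeroth are the branches of \<open>xstar\<close> shifted by
  one index, with weights scaled by \<open>r 1\<close>; the zeroth ends at 1 itself.\<close>

lemma K_1: "K f 1 = (1 - r 1) * f 1 + r 1 * K f xstar"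
proof -
  have s: "summable (\<lambda>n. w n 1 * f (\<psi> n 1))" "summable (\<lambda>n. w n xstar * f (\<psi> n xstar))"
    using xstar_less_1 by (auto intro!: summable_w)
  have "K f 1 = w 0 1 * f (\<psi> 0 1) + (\<Sum>n. w (Suc n) 1 * f (\<psi> (Suc n) 1))"
    unfolding K_def by (subst suminf_split_head[OF s(1)]) simp
  also have "(\<lambda>n. w (Suc n) 1 * f (\<psi> (Suc n) 1)) = (\<lambda>n. r 1 * (w n xstar * f (\<psi> n xstar)))"
    by (simp add: fun_eq_iff w_def Q_Suc'[of _ 1] psi_Suc_1 algebra_simps flip: xstar_def)
  also have "suminf \<dots> = r 1 * K f xstar"
    unfolding K_def by (rule suminf_mult[OF s(2)])
  finally show ?thesis
    by (simp add: psi_0_1 w_def Q_def)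
qed

end

section \<open>The first return map in closed form\<close>

definition lift_map :: "real \<Rightarrow> real" where
  "lift_map x = (x powr (1 - \<gamma>) + (1 + x) powr (1 - \<gamma>) - 1) powr (1 / (1 - \<gamma>))"

lemma lift_map_V:
  assumes "0 < z"
  shows "lift_map (V z) = z"
proof -
  have "c \<noteq> 0"
    using c_denom by (simp add: c_def)
  moreover have "c * (V z powr (1 - \<gamma>) + (1 + V z) powr (1 - \<gamma>) - 1) = c * z powr (1 - \<gamma>)"
    using U_V[OF assms] by (simp add: U_def b_def algebra_simps)
  ultimately have "V z powr (1 - \<gamma>) + (1 + V z) powr (1 - \<gamma>) - 1 = z powr (1 - \<gamma>)"
    by simp
  then show ?thesis
    using assms gamma_neq_1 by (simp add: lift_map_def powr_powr)
qed

lemma lift_map_V_pow: "0 < z \<Longrightarrow> (lift_map ^^ n) ((V ^^ n) z) = z"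
proof (induction n)
  case (Suc n)
  have "(lift_map ^^ Suc n) ((V ^^ Suc n) z) = (lift_map ^^ n) (lift_map (V ((V ^^ n) z)))"
    by (simp add: funpow_swap1)
  then show ?case
    using Suc by (simp add: lift_map_V V_pow_pos)
qed simp

text \<open>The points \<open>\<psi> n 1\<close> decrease from 1 to \<open>xstar\<close> and cut
  \<open>Y\<close> into half-open cells; this is the number of the cell. A point of cell n needs one
  step through the right branch and n through the left one, so its return time is
  \<open>Suc n\<close>.\<close>

definition idx :: "real \<Rightarrow> nat" where
  "idx y = (LEAST n. \<psi> (Suc n) 1 < y)"

text \<open>Built from the unreduced map, so that it inverts the branches at every point of
  \<open>Y\<close>. The iterates of the Thaler map disagree with it where the orbit lands on 1,
  since \<open>frac\<close> then yields 0.\<close>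

definition F :: "real \<Rightarrow> real" where
  "F y = (lift_map ^^ idx y) (lift_map y - 1)"

lemma idx_psi:
  assumes "z \<in> {xstar<..1}"
  shows "idx (\<psi> n z) = n"
  unfolding idx_def
proof (rule Least_equality)
  have z: "0 < z"
    using assms xstar_pos by auto
  show "\<psi> (Suc n) 1 < \<psi> n z"
    using psi_le_iff[OF z xstar_pos, of n] assms by (simp add: psi_Suc_1 not_le[symmetric])
  fix m assume m: "\<psi> (Suc m) 1 < \<psi> n z"
  show "n \<le> m"
  proof (rule ccontr)
    assume "\<not> n \<le> m"
    then have "\<psi> n z \<le> \<psi> (Suc m) z"
      by (intro psi_antimono z) auto
    also have "\<dots> \<le> \<psi> (Suc m) 1"
      using assms z by (simp add: psi_le_iff)
    finally show False
      using m by simp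
  qed
qed

lemma F_psi: "z \<in> {xstar<..1} \<Longrightarrow> F (\<psi> n z) = z"
  using xstar_pos unfolding F_def idx_psi by (simp add: \<psi>_def lift_map_V add_pos_pos V_pow_pos lift_map_V_pow)

lemma psi_Suc_idx_less:
  assumes "y \<in> {xstar<..1}"
  shows "\<psi> (Suc (idx y)) 1 < y"
proof -
  have "\<forall>\<^sub>F n in sequentially. \<psi> (Suc n) 1 < y"
    using order_tendstoD(2)[OF LIMSEQ_Suc[OF psi_tendsto_xstar[of 1]], of y] assms by simp
  then have "\<exists>n. \<psi> (Suc n) 1 < y"
    by (rule eventually_happens'[rotated]) simp
  then show ?thesis
    unfolding idx_def by (rule LeastI_ex)
qed

lemma le_psi_idx:
  assumes "y \<in> {xstar<..1}"
  shows "y \<le> \<psi> (idx y) 1"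
proof (cases "idx y")
  case 0
  then show ?thesis
    using assms by (simp add: psi_0_1)
next
  case (Suc n)
  then have "\<not> \<psi> (Suc n) 1 < y"
    using not_less_Least[of n "\<lambda>n. \<psi> (Suc n) 1 < y"] by (simp add: idx_def)
  then show ?thesis
    by (simp add: Suc)
qed

text \<open>Turns events about the return time into intervals starting at \<open>xstar\<close>,
  whose measure is a value of \<open>U\<close>.\<close>

lemma less_idx_iff:
  assumes "y \<in> {xstar<..1}"
  shows "n < Suc (idx y) \<longleftrightarrow> y \<le> \<psi> n 1"
proof
  assume "n < Suc (idx y)"
  then show "y \<le> \<psi> n 1"
    using le_psi_idx[OF assms] psi_antimono[of 1 n "idx y"] by simp
next
  assume "y \<le> \<psi> n 1"
  then show "n < Suc (idx y)"
    using psi_Suc_idx_less[OF assms] psi_antimono[of 1 "Suc (idx y)" n] by (cases "n < Suc (idx y)") auto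
qed

lemma psi_F:
  assumes "y \<in> {xstar<..1}"
  shows "F y \<in> {xstar<..1}" "\<psi> (idx y) (F y) = y"
proof -
  let ?n = "idx y"
  have "continuous_on {xstar..1} (\<psi> ?n)"
    using xstar_pos by (intro continuous_at_imp_continuous_on ballI psi_isCont) auto
  moreover have "\<psi> ?n xstar < y" "y \<le> \<psi> ?n 1"
    using psi_Suc_idx_less[OF assms] le_psi_idx[OF assms] by (simp_all add: psi_Suc_1)
  ultimately obtain z where z: "xstar \<le> z" "z \<le> 1" "\<psi> ?n z = y"
    using IVT'[of "\<psi> ?n" xstar y 1] xstar_less_1 by auto
  then have "z \<in> {xstar<..1}"
    using \<open>\<psi> ?n xstar < y\<close> by (cases "z = xstar") auto
  then show "F y \<in> {xstar<..1}" "\<psi> (idx y) (F y) = y"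
    using F_psi[of z ?n] z(3) by auto
qed

lemma idx_antimono: "x \<in> {xstar<..1} \<Longrightarrow> y \<in> {xstar<..1} \<Longrightarrow> x \<le> y \<Longrightarrow> idx y \<le> idx x"
  using less_idx_iff[of y "idx y"] less_idx_iff[of x "idx y"] by auto

section \<open>Change of variables along the branches\<close>

abbreviation \<mu> :: "real measure" where "\<mu> \<equiv> thaler_mu \<gamma>"

lemma mu_eq: "\<mu> = density (restrict_space lborel {xstar<..1}) (\<lambda>x. ennreal (\<kappa> * h x))"
  by (simp add: thaler_mu_def thaler_Y_eq kappa_eq)

lemma space_mu: "space \<mu> = {xstar<..1}"
  by (simp add: mu_eq space_restrict_space)

lemma sets_mu: "sets \<mu> = sets (restrict_space borel {xstar<..1})"
  by (simp add: mu_eq) (simp add: sets_restrict_space)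

lemma measurable_mu: "f \<in> measurable borel N \<Longrightarrow> f \<in> measurable \<mu> N"
  by (subst measurable_cong_sets[OF sets_mu refl]) (rule measurable_restrict_space1)

lemma borel_measurable_h [measurable]: "h \<in> borel_measurable borel"
  unfolding thaler_h_def [abs_def] by measurable

lemma borel_measurable_mu_iff:
  fixes f :: "real \<Rightarrow> ennreal"
  shows "f \<in> borel_measurable \<mu> \<longleftrightarrow> (\<lambda>x. f x * indicator {xstar<..1} x) \<in> borel_measurable borel"
  by (subst measurable_cong_sets[OF sets_mu refl]) (rule borel_measurable_restrict_space_iff_ennreal, simp)

lemma nn_integral_mu:
  assumes f: "f \<in> borel_measurable \<mu>"
  shows "(\<integral>\<^sup>+x. f x \<partial>\<mu>) = (\<integral>\<^sup>+x. ennreal (\<kappa> * h x) * (f x * indicator {xstar<..1} x) \<partial>lborel)"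
proof -
  have h: "(\<lambda>x. ennreal (\<kappa> * h x)) \<in> borel_measurable (restrict_space lborel {xstar<..1})"
    by (rule measurable_restrict_space1) measurable
  have "f \<in> borel_measurable (restrict_space lborel {xstar<..1})"
    using f unfolding mu_eq by simp
  then have "(\<integral>\<^sup>+x. f x \<partial>\<mu>) = (\<integral>\<^sup>+x. ennreal (\<kappa> * h x) * f x \<partial>restrict_space lborel {xstar<..1})"
    unfolding mu_eq using h by (intro nn_integral_density)
  also have "\<dots> = (\<integral>\<^sup>+x. ennreal (\<kappa> * h x) * f x * indicator {xstar<..1} x \<partial>lborel)"
    by (rule nn_integral_restrict_space) simp
  finally show ?thesis
    by (simp add: mult.assoc)
qed

lemma emeasure_mu:
  assumes "s \<in> {xstar<..1}"
  shows "emeasure \<mu> {xstar<..s} = ennreal (U s)"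
proof -
  have m: "{xstar<..s} \<in> sets \<mu>"
    using assms by (auto simp: sets_mu sets_restrict_space_iff)
  have "emeasure \<mu> {xstar<..s} = (\<integral>\<^sup>+x. indicator {xstar<..s} x \<partial>\<mu>)"
    using m by simp
  also have "\<dots> = (\<integral>\<^sup>+x. ennreal (\<kappa> * h x) * (indicator {xstar<..s} x * indicator {xstar<..1} x) \<partial>lborel)"
    using m by (intro nn_integral_mu) simp
  also have "\<dots> = (\<integral>\<^sup>+x. ennreal (\<kappa> * h x) * indicator {xstar..s} x \<partial>lborel)"
    using AE_lborel_singleton[of xstar] assms by (intro nn_integral_cong_AE) (auto split: split_indicator)
  also have "\<dots> = ennreal (U s - U xstar)"
  proof (rule nn_integral_FTC_Icc)
    fix x assume "x \<in> {xstar..s}"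
    then have "0 < x" using xstar_pos by auto
    then show "(U has_real_derivative \<kappa> * h x) (at x)"
      by (rule U_deriv)
    show "0 \<le> \<kappa> * h x"
      using kappa_pos h_pos[OF \<open>0 < x\<close>] by simp
  qed (use assms in auto)
  finally show ?thesis
    by (simp add: U_xstar)
qed

lemma U_1: "U 1 = 1"
  using b_2 by (simp add: U_def b_1)

lemma prob_space_mu: "prob_space \<mu>"
  by (rule prob_spaceI) (use emeasure_mu[of 1] xstar_less_1 in \<open>simp add: space_mu U_1\<close>)

lemma idx_measurable [measurable]: "idx \<in> measurable borel (count_space UNIV)"
  unfolding idx_def [abs_def] by measurable

lemma lift_map_measurable [measurable]: "lift_map \<in> borel_measurable borel"
  unfolding lift_map_def [abs_def] by measurable

lemma F_measurable_borel [measurable]: "F \<in> borel_measurable borel"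
proof -
  have [measurable]: "(lift_map ^^ n) \<in> borel_measurable borel" for n
    by (rule measurable_compose_n) measurable
  have "(\<lambda>y. (lift_map ^^ n) (lift_map y - 1)) \<in> borel_measurable borel" for n
    by measurable
  then show ?thesis
    unfolding F_def [abs_def] by (rule measurable_compose_countable[OF _ idx_measurable])
qed

lemma F_measurable_mu: "F \<in> measurable \<mu> \<mu>"
proof -
  have "F \<in> measurable \<mu> (restrict_space borel {xstar<..1})"
    by (rule measurable_restrict_space2) (use psi_F(1) in \<open>auto simp only: space_mu measurable_mu F_measurable_borel\<close>)
  then show ?thesis
    by (simp add: measurable_cong_sets[OF refl sets_mu])
qed

lemma continuous_measurable_mu:
  fixes f :: "real \<Rightarrow> real"
  assumes "\<And>x. 0 < x \<Longrightarrow> isCont f x"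
  shows "f \<in> borel_measurable \<mu>"
proof -
  have "continuous_on {xstar<..1} f"
    using xstar_pos by (intro continuous_at_imp_continuous_on ballI assms) auto
  then show ?thesis
    by (subst measurable_cong_sets[OF sets_mu refl]) (rule borel_measurable_continuous_on_restrict)
qed

lemma Q_isCont: "0 < y \<Longrightarrow> isCont (Q n) y"
proof -
  assume y: "0 < y"
  have "isCont (\<lambda>y. r ((V ^^ j) y)) y" for j
  proof (rule isCont_o2[where g = r])
    show "isCont (V ^^ j) y"
      using V_pow_deriv[OF y] by (rule DERIV_isCont)
    show "isCont r ((V ^^ j) y)"
      using r_continuous V_pow_pos[OF y] by (simp add: continuous_on_eq_continuous_at)
  qed
  then show ?thesis
    unfolding Q_def [abs_def] by (intro continuous_intros)
qed

lemma w_isCont: "0 < y \<Longrightarrow> isCont (w n) y"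
  unfolding w_def [abs_def] by (intro continuous_intros Q_isCont)

lemma psi_measurable_mu: "\<psi> n \<in> measurable \<mu> \<mu>"
proof -
  have "\<psi> n \<in> measurable \<mu> (restrict_space borel {xstar<..1})"
    using xstar_pos
    by (intro measurable_restrict_space2 continuous_measurable_mu psi_isCont) 
       (auto simp: space_mu xstar_less_psi psi_le_1)
  then show ?thesis
    by (simp add: measurable_cong_sets[OF refl sets_mu])
qed

lemma h_isCont: "0 < x \<Longrightarrow> isCont h x"
  unfolding thaler_h_def [abs_def] by (auto intro!: continuous_intros)

text \<open>On each cell {idx = n} substitute x = \<open>\<psi> n y\<close> and use the Jacobian
  \<open>w n\<close>; then sum over the cells. With extended nonnegative values, sum and integral
  may be exchanged freely.\<close>

lemma nn_transfer:
  fixes f H :: "real \<Rightarrow> ennreal"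
  assumes f [measurable]: "f \<in> borel_measurable \<mu>" and H [measurable]: "H \<in> borel_measurable \<mu>"
  shows "(\<integral>\<^sup>+x. f x * H (F x) \<partial>\<mu>) = (\<integral>\<^sup>+x. (\<Sum>n. ennreal (w n x) * f (\<psi> n x)) * H x \<partial>\<mu>)"
proof -
  note [measurable] = F_measurable_mu psi_measurable_mu
  let ?I = "\<lambda>n x. indicator {x. idx x = n} x"
  have I [measurable]: "?I n \<in> borel_measurable \<mu>" for n
    by (rule measurable_mu) measurable
  have w_meas [measurable]: "w n \<in> borel_measurable \<mu>" for n
    by (intro continuous_measurable_mu w_isCont)
  have branch: "(\<integral>\<^sup>+x. f x * H (F x) * ?I n x \<partial>\<mu>) = (\<integral>\<^sup>+x. ennreal (w n x) * f (\<psi> n x) * H x \<partial>\<mu>)" for n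
  proof -
    define G where "G x = ennreal (\<kappa> * h x) * (f x * H (F x) * ?I n x * indicator {xstar<..1} x)" for x
    have "(\<lambda>x. f x * H (F x) * ?I n x) \<in> borel_measurable \<mu>"
      by measurable
    then have [measurable]: "(\<lambda>x. f x * H (F x) * ?I n x * indicator {xstar<..1} x) \<in> borel_measurable borel"
      unfolding borel_measurable_mu_iff .
    have G_meas: "G \<in> borel_measurable borel"
      unfolding G_def by measurable
    let ?d = "\<lambda>y. w n y * h y / h (\<psi> n y)"
    \<comment> \<open>The cell is open on the left; passing to the closed interval suits the
      substitution rule and changes nothing, as \<open>G\<close> vanishes off the cell.\<close>
    have supp: "G x * indicator {\<psi> n xstar..\<psi> n 1} x = G x" for x
    proof (cases "x \<in> {xstar<..1} \<and> idx x = n")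
      case True
      then show ?thesis
        using psi_Suc_idx_less[of x] le_psi_idx[of x] by (auto simp: psi_Suc_1 indicator_def)
    qed (auto simp: G_def indicator_def)
    have "(\<integral>\<^sup>+x. f x * H (F x) * ?I n x \<partial>\<mu>) = (\<integral>\<^sup>+x. G x \<partial>lborel)"
      unfolding G_def by (rule nn_integral_mu) measurable
    also have "\<dots> = (\<integral>\<^sup>+x. G x * indicator {\<psi> n xstar..\<psi> n 1} x \<partial>lborel)"
      by (simp add: supp)
    also have "\<dots> = (\<integral>\<^sup>+x. G (\<psi> n x) * ?d x * indicator {xstar..1} x \<partial>lborel)"
    proof (rule nn_integral_substitution_aux[OF G_meas])
      show "xstar < 1" by (rule xstar_less_1)
      fix x assume "x \<in> {xstar..1}"
      then have x: "0 < x" using xstar_pos by auto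
      show "(\<psi> n has_real_derivative ?d x) (at x)"
        by (rule psi_deriv[OF x])
      show "0 \<le> ?d x"
        using w_nonneg h_pos[OF x] h_pos[OF psi_pos[OF x, of n]] by (simp add: less_imp_le)
    next
      show "continuous_on {xstar..1} ?d"
      proof (intro continuous_at_imp_continuous_on ballI isCont_divide isCont_mult)
        fix x assume "x \<in> {xstar..1}"
        then have x: "0 < x" using xstar_pos by auto
        show "isCont (w n) x" "isCont h x"
          using x by (auto intro: w_isCont h_isCont)
        show "isCont (\<lambda>y. h (\<psi> n y)) x"
          by (rule isCont_o2[OF psi_isCont[OF x] h_isCont[OF psi_pos[OF x]]])
        show "h (\<psi> n x) \<noteq> 0"
          using h_pos[OF psi_pos[OF x, of n]] by simp
      qed
    qed simp
    also have "\<dots> = (\<integral>\<^sup>+x. ennreal (\<kappa> * h x) * (ennreal (w n x) * f (\<psi> n x) * H x * indicator {xstar<..1} x) \<partial>lborel)"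
      using AE_lborel_singleton[of xstar]
    proof (intro nn_integral_cong_AE, eventually_elim)
      fix x :: real assume "x \<noteq> xstar"
      show "G (\<psi> n x) * ennreal (?d x) * indicator {xstar..1} x =
          ennreal (\<kappa> * h x) * (ennreal (w n x) * f (\<psi> n x) * H x * indicator {xstar<..1} x)"
      proof (cases "x \<in> {xstar<..1}")
        case True
        then have x: "0 < x" using xstar_pos by auto
        have h: "0 < h x" "0 < h (\<psi> n x)"
          using h_pos x psi_pos by auto
        have "ennreal (\<kappa> * h (\<psi> n x)) * ennreal (?d x) = ennreal (\<kappa> * h x) * ennreal (w n x)"
          using h kappa_pos w_nonneg[of n x] by (simp flip: ennreal_mult'')
        moreover have "G (\<psi> n x) = ennreal (\<kappa> * h (\<psi> n x)) * (f (\<psi> n x) * H x)"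
          using True xstar_less_psi[OF x] psi_le_1[OF x] by (simp add: G_def F_psi idx_psi)
        ultimately show ?thesis
          using True by (simp add: mult_ac)
      next
        case False
        then show ?thesis
          using \<open>x \<noteq> xstar\<close> by (auto simp: indicator_def)
      qed
    qed
    also have "\<dots> = (\<integral>\<^sup>+x. ennreal (w n x) * f (\<psi> n x) * H x \<partial>\<mu>)"
      by (rule nn_integral_mu[symmetric]) measurable
    finally show ?thesis .
  qed
  have one: "(\<Sum>n. ?I n x) = (1::ennreal)" for x
    by (subst suminf_finite[of "{idx x}"]) auto
  have "(\<integral>\<^sup>+x. f x * H (F x) \<partial>\<mu>) = (\<integral>\<^sup>+x. (\<Sum>n. f x * H (F x) * ?I n x) \<partial>\<mu>)"
    unfolding ennreal_suminf_cmult one by simp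
  also have "\<dots> = (\<Sum>n. \<integral>\<^sup>+x. ennreal (w n x) * f (\<psi> n x) * H x \<partial>\<mu>)"
    by (subst nn_integral_suminf) (measurable, simp only: branch)
  also have "\<dots> = (\<integral>\<^sup>+x. (\<Sum>n. ennreal (w n x) * f (\<psi> n x) * H x) \<partial>\<mu>)"
    by (subst nn_integral_suminf) measurable
  finally show ?thesis
    by (simp add: ennreal_suminf_multc)
qed

end

context thaler
begin

lemma antimono_measurable_mu:
  fixes f :: "real \<Rightarrow> real"
  shows "antimono_on {xstar<..1} f \<Longrightarrow> f \<in> borel_measurable \<mu>"
  by (subst measurable_cong_sets[OF sets_mu refl]) (rule antimono_on_borel_measurable)

text \<open>Complex test functions are reached through an identity of measures: the push-forward of
  f * \<open>\<mu>\<close> under \<open>F\<close> is K f * \<open>\<mu>\<close>. On sets this is the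
  nonnegative transfer formula.\<close>

lemma is_transfer_K:
  assumes f: "antimono_on {xstar<..1} f" "\<And>y. y \<in> {xstar<..1} \<Longrightarrow> f y \<in> {lo..hi}" "0 \<le> lo"
  shows "is_transfer \<mu> F f (K f)"
proof -
  note [measurable] = F_measurable_mu psi_measurable_mu
  have fm [measurable]: "f \<in> borel_measurable \<mu>"
    by (rule antimono_measurable_mu[OF f(1)])
  have w_meas [measurable]: "w n \<in> borel_measurable \<mu>" for n
    by (intro continuous_measurable_mu w_isCont)
  have K_meas [measurable]: "K f \<in> borel_measurable \<mu>"
    unfolding K_def [abs_def] by measurable
  have f0: "0 \<le> f y" "0 \<le> K f y" if "y \<in> space \<mu>" for y
    using f(2)[of y] f(3) K_range[OF f, of y] that by (auto simp: space_mu)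
  have eq: "distr (density \<mu> (\<lambda>x. ennreal (f x))) \<mu> F = density \<mu> (\<lambda>x. ennreal (K f x))"
  proof (rule measure_eqI)
    fix A assume "A \<in> sets (distr (density \<mu> (\<lambda>x. ennreal (f x))) \<mu> F)"
    then have [measurable]: "A \<in> sets \<mu>" by simp
    have "emeasure (distr (density \<mu> (\<lambda>x. ennreal (f x))) \<mu> F) A =
        emeasure (density \<mu> (\<lambda>x. ennreal (f x))) (F -` A \<inter> space \<mu>)"
      by (subst emeasure_distr) (simp_all add: F_measurable_mu)
    also have "\<dots> = (\<integral>\<^sup>+x. ennreal (f x) * indicator (F -` A \<inter> space \<mu>) x \<partial>\<mu>)"
      by (rule emeasure_density) measurable
    also have "\<dots> = (\<integral>\<^sup>+x. ennreal (f x) * indicator A (F x) \<partial>\<mu>)"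
      by (intro nn_integral_cong) (auto simp: indicator_def)
    also have "\<dots> = (\<integral>\<^sup>+x. (\<Sum>n. ennreal (w n x) * ennreal (f (\<psi> n x))) * indicator A x \<partial>\<mu>)"
      by (rule nn_transfer) measurable
    also have "\<dots> = (\<integral>\<^sup>+x. ennreal (K f x) * indicator A x \<partial>\<mu>)"
    proof (intro nn_integral_cong)
      fix x assume "x \<in> space \<mu>"
      then have x: "x \<in> {xstar..1}" by (simp add: space_mu)
      have "(\<Sum>n. ennreal (w n x) * ennreal (f (\<psi> n x))) = (\<Sum>n. ennreal (w n x * f (\<psi> n x)))"
        using w_nonneg by (intro suminf_cong) (simp add: ennreal_mult')
      also have "\<dots> = ennreal (K f x)"
        unfolding K_def using f_psi_range[OF f x] f(3) w_nonneg
        by (intro suminf_ennreal2 summable_w[OF f] x mult_nonneg_nonneg) (auto intro: order.trans)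
      finally show "(\<Sum>n. ennreal (w n x) * ennreal (f (\<psi> n x))) * indicator A x = ennreal (K f x) * indicator A x"
        by simp
    qed
    also have "\<dots> = emeasure (density \<mu> (\<lambda>x. ennreal (K f x))) A"
      by (rule emeasure_density[symmetric]) measurable
    finally show "emeasure (distr (density \<mu> (\<lambda>x. ennreal (f x))) \<mu> F) A = \<dots>" .
  qed simp
  show ?thesis
    unfolding is_transfer_def
  proof (intro allI impI)
    fix H :: "real \<Rightarrow> complex" assume [measurable]: "H \<in> borel_measurable \<mu>"
    have "(\<integral>x. of_real (f x) * H (F x) \<partial>\<mu>) = (\<integral>x. H (F x) \<partial>density \<mu> (\<lambda>x. ennreal (f x)))"
      by (subst integral_density) (auto simp: scaleR_conv_of_real f0)
    also have "\<dots> = (\<integral>x. H x \<partial>distr (density \<mu> (\<lambda>x. ennreal (f x))) \<mu> F)"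
      by (rule integral_distr[symmetric]) (simp_all add: F_measurable_mu)
    also have "\<dots> = (\<integral>x. of_real (K f x) * H x \<partial>\<mu>)"
      unfolding eq by (subst integral_density) (auto simp: scaleR_conv_of_real f0)
    finally show "(\<integral>x. of_real (f x) * H (F x) \<partial>\<mu>) = (\<integral>x. of_real (K f x) * H x \<partial>\<mu>)" .
  qed
qed

text \<open>Since \<open>V 1 = xstar\<close>, the identity \<open>K_1\<close> couples the kernel at \<open>1\<close> with the one at \<open>xstar\<close>;
  for monotone functions these are the extreme values of \<open>K f\<close>.\<close>

lemma mu_transfer_step:
  assumes f: "antimono_on (space \<mu>) f" "\<And>y. y \<in> space \<mu> \<Longrightarrow> f y \<in> {lo..hi}" "0 \<le> lo"
  shows "\<exists>g lo' hi'. is_transfer \<mu> F f g \<and> antimono_on (space \<mu>) g \<and> (\<forall>y\<in>space \<mu>. g y \<in> {lo'..hi'}) \<and>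
          lo \<le> lo' \<and> hi' \<le> hi \<and> hi' - lo' \<le> (hi - lo) / 2 \<and>
          (\<forall>y\<in>space \<mu>. g y \<le> 2 * (\<integral>x. f x \<partial>\<mu>))"
proof -
  interpret prob_space \<mu> by (rule prob_space_mu)
  note f = f[unfolded space_mu]
  have tr: "is_transfer \<mu> F f (K f)"
    by (rule is_transfer_K[OF f])
  have anti: "antimono_on (space \<mu>) (K f)"
    unfolding space_mu monotone_on_def using K_antimono[OF f] by simp
  have mem: "xstar \<in> {xstar..1}" "1 \<in> {xstar..1}"
    using xstar_less_1 by auto
  have between: "K f y \<in> {K f 1..K f xstar}" if "y \<in> {xstar..1}" for y
    using K_antimono[OF f that mem(2)] K_antimono[OF f mem(1) that] that by auto
  have range: "K f 1 \<in> {lo..hi}" "K f xstar \<in> {lo..hi}"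
    using K_range[OF f] mem by auto
  have r1: "1 / 2 \<le> r 1" "r 1 \<le> 1"
    by (rule r_1_ge, rule r_le_1)
  have K1: "K f 1 = (1 - r 1) * f 1 + r 1 * K f xstar"
    by (rule K_1[OF f])
  \<comment> \<open>Only the branch of weight 1 - r 1 <= 1/2 distinguishes the two extreme values,
    and on it the difference is at most the old oscillation.\<close>
  then have "K f xstar - K f 1 = (1 - r 1) * (K f xstar - f 1)"
    by (simp add: algebra_simps)
  also have "\<dots> \<le> (1 - r 1) * (hi - lo)"
    using r1 range(2) f(2)[of 1] xstar_less_1 by (intro mult_left_mono) auto
  also have "\<dots> \<le> (1 / 2) * (hi - lo)"
    using r1 range by (intro mult_right_mono) auto
  finally have osc: "K f xstar - K f 1 \<le> (hi - lo) / 2"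
    by simp
  have "\<bar>K f y\<bar> \<le> K f xstar" if "y \<in> space \<mu>" for y
    using between[of y] range f(3) that by (auto simp: space_mu)
  then have K_int: "integrable \<mu> (K f)"
    using antimono_measurable_mu[of "K f"] anti
    by (intro integrable_const_bound[where B = "K f xstar"] AE_I2) (simp_all add: space_mu)
  have "complex_of_real (\<integral>x. f x \<partial>\<mu>) = of_real (\<integral>x. K f x \<partial>\<mu>)"
    using is_transferD[OF tr, of "\<lambda>_. 1"] by simp
  then have mean: "(\<integral>x. f x \<partial>\<mu>) = (\<integral>x. K f x \<partial>\<mu>)"
    by (simp only: of_real_eq_iff)
  \<comment> \<open>Here the nonnegativity of \<open>f 1\<close> enters: the minimum of
    \<open>K f\<close> is at least \<open>r 1 \<ge> 1/2\<close> times its maximum, so the maximum is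
    at most twice the mean.\<close>
  have "r 1 * K f xstar \<le> K f 1"
    using K1 r1 f(2)[of 1] f(3) xstar_less_1 by simp
  moreover have "K f 1 \<le> (\<integral>x. K f x \<partial>\<mu>)"
    using between by (intro integral_ge_const K_int AE_I2) (auto simp: space_mu)
  moreover have "(1 / 2) * K f xstar \<le> r 1 * K f xstar"
    using r1 range f(3) by (intro mult_right_mono) auto
  ultimately have up: "K f xstar \<le> 2 * (\<integral>x. f x \<partial>\<mu>)"
    unfolding mean by simp
  have "\<forall>y\<in>space \<mu>. K f y \<in> {K f 1..K f xstar}"
    using between by (simp add: space_mu)
  moreover from this up have "\<forall>y\<in>space \<mu>. K f y \<le> 2 * (\<integral>x. f x \<partial>\<mu>)"
    by fastforce
  moreover have "lo \<le> K f 1" "K f xstar \<le> hi"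
    using range by auto
  ultimately show ?thesis
    using tr anti osc by blast
qed

sublocale monotone_mixing \<mu> F "\<lambda>y. Suc (idx y)"
proof (intro monotone_mixing.intro monotone_mixing_axioms.intro)
  show "prob_space \<mu>"
    by (rule prob_space_mu)
  show "(\<lambda>y. Suc (idx y)) \<in> measurable \<mu> (count_space UNIV)"
    by (rule measurable_mu) measurable
  show "sets \<mu> = sets (restrict_space borel (space \<mu>))"
    by (simp add: sets_mu space_mu)
  show "Suc (idx y) \<le> Suc (idx x)" if "x \<in> space \<mu>" "y \<in> space \<mu>" "x \<le> y" for x y
    using that idx_antimono by (simp add: space_mu)
qed (rule F_measurable_mu, rule mu_transfer_step)

definition p :: "nat \<Rightarrow> real" where "p n = b (1 + (V ^^ n) 1) - b 1"

text \<open>The return time exceeds n exactly on the interval from \<open>xstar\<close> to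
  \<open>\<psi> n 1\<close>, and U there is explicit; this exact tail replaces any distortion
  estimate.\<close>

lemma prob_tail: "prob {x \<in> space \<mu>. n < Suc (idx x)} = p n"
proof -
  have "{x \<in> space \<mu>. n < Suc (idx x)} = {xstar<..\<psi> n 1}"
    using less_idx_iff[of _ n] psi_le_1[of 1 n] by (auto simp: space_mu)
  moreover have "0 \<le> U (\<psi> n 1)"
    using U_less[OF xstar_pos xstar_less_psi[of 1 n]] U_xstar by simp
  ultimately show ?thesis
    using emeasure_mu[of "\<psi> n 1"] xstar_less_psi[of 1 n] psi_le_1[of 1 n] U_psi[of 1 n]
    by (simp add: measure_def p_def)
qed

section \<open>Return times of the Thaler map\<close>

lemma thaler_map_eq:
  assumes "0 < x" "x \<le> 1"
  shows "thaler_map \<gamma> x = frac (lift_map x)"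
proof -
  let ?E = "1 + (x / (1 + x)) powr (\<gamma> - 1) - x powr (\<gamma> - 1)"
  have E: "x powr (1 - \<gamma>) * ?E = x powr (1 - \<gamma>) + (1 + x) powr (1 - \<gamma>) - 1"
  proof -
    have "x powr (1 - \<gamma>) * x powr (\<gamma> - 1) = 1"
      using assms by (simp flip: powr_add)
    moreover have "x powr (1 - \<gamma>) * (x / (1 + x)) powr (\<gamma> - 1) = (1 + x) powr (1 - \<gamma>)"
    proof -
      have "x powr (1 - \<gamma>) * (x / (1 + x)) powr (\<gamma> - 1) = x powr (1 - \<gamma>) * x powr (\<gamma> - 1) / (1 + x) powr (\<gamma> - 1)"
        using assms by (simp add: powr_divide)
      also have "\<dots> = 1 / (1 + x) powr (\<gamma> - 1)"
        using assms by (simp flip: powr_add)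
      also have "\<dots> = (1 + x) powr (1 - \<gamma>)"
        using powr_minus_divide[of "1 + x" "\<gamma> - 1"] by simp
      finally show ?thesis .
    qed
    ultimately show ?thesis
      by (simp add: algebra_simps)
  qed
  have "0 < x powr (1 - \<gamma>) + (1 + x) powr (1 - \<gamma>) - 1"
  proof (cases "\<gamma> < 1")
    case True
    then have "1 \<le> (1 + x) powr (1 - \<gamma>)" "0 < x powr (1 - \<gamma>)"
      using assms by (auto intro: ge_one_powr_ge_zero)
    then show ?thesis by linarith
  next
    case False
    then have "1 \<le> x powr (1 - \<gamma>)" "0 < (1 + x) powr (1 - \<gamma>)"
      using assms powr_mono2'[of "1 - \<gamma>" x 1] by auto
    then show ?thesis by linarith
  qed
  then have "0 < ?E"
    unfolding E[symmetric] using assms by (simp add: zero_less_mult_iff)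
  then have "lift_map x = (x powr (1 - \<gamma>)) powr (1 / (1 - \<gamma>)) * ?E powr (1 / (1 - \<gamma>))"
    unfolding lift_map_def E[symmetric] by (simp add: powr_mult)
  then show ?thesis
    using assms gamma_neq_1 by (simp add: thaler_map_def powr_powr)
qed

lemma thaler_map_V:
  assumes "0 < z" "z < 1"
  shows "thaler_map \<gamma> (V z) = z" "thaler_map \<gamma> (V (1 + z)) = z"
proof -
  have "V (1 + z) \<le> V 2"
    using assms by (simp add: V_le_iff)
  then have 1: "V (1 + z) \<le> 1"
    by (simp add: V_2)
  have "V z \<le> 1"
    using V_less_self[of z] assms by simp
  then show "thaler_map \<gamma> (V z) = z"
    using assms by (simp add: thaler_map_eq V_pos lift_map_V frac_eq)
  show "thaler_map \<gamma> (V (1 + z)) = z"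
    using assms 1 frac_1_eq[of z] by (simp add: thaler_map_eq V_pos lift_map_V frac_eq add.commute)
qed

text \<open>With z = F y the orbit of y runs through V^n z, ..., V z, z. The intermediate points lie
  below V 1 = \<open>xstar\<close>, hence outside \<open>Y\<close>. Excluding z = 1 keeps every V^k
  z strictly below 1, so that \<open>frac\<close> removes exactly the integer part intended.\<close>

lemma first_return:
  assumes y: "y \<in> {xstar<..1}" and F: "F y \<noteq> 1"
  shows "(LEAST k. k \<ge> 1 \<and> (thaler_map \<gamma> ^^ k) y \<in> thaler_Y \<gamma>) = Suc (idx y)"
    and "(thaler_map \<gamma> ^^ Suc (idx y)) y = F y"
proof -
  define n z where "n = idx y" and "z = F y"
  have z: "z \<in> {xstar<..1}" "y = \<psi> n z" "z < 1"
    using psi_F[OF y] F by (auto simp: n_def z_def)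
  have z0: "0 < z" using z xstar_pos by auto
  have less1: "(V ^^ k) z < 1" for k
    using V_pow_antimono[OF z0, of 0 k] z(3) by simp
  have orbit: "(thaler_map \<gamma> ^^ Suc j) y = (V ^^ (n - j)) z" if "j \<le> n" for j
    using that
  proof (induction j)
    case 0
    show ?case
      using thaler_map_V(2)[OF V_pow_pos[OF z0] less1] z(2) by (simp add: \<psi>_def)
  next
    case (Suc j)
    then have "n - j = Suc (n - Suc j)" by simp
    then show ?case
      using Suc thaler_map_V(1)[OF V_pow_pos[OF z0] less1, of "n - Suc j"] by simp
  qed
  show F_eq: "(thaler_map \<gamma> ^^ Suc (idx y)) y = F y"
    using orbit[of n] by (simp add: n_def z_def)
  show "(LEAST k. k \<ge> 1 \<and> (thaler_map \<gamma> ^^ k) y \<in> thaler_Y \<gamma>) = Suc (idx y)"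
  proof (rule Least_equality)
    show "1 \<le> Suc (idx y) \<and> (thaler_map \<gamma> ^^ Suc (idx y)) y \<in> thaler_Y \<gamma>"
      unfolding F_eq using psi_F(1)[OF y] by (simp add: thaler_Y_eq)
    fix k assume k: "1 \<le> k \<and> (thaler_map \<gamma> ^^ k) y \<in> thaler_Y \<gamma>"
    show "Suc (idx y) \<le> k"
    proof (rule ccontr)
      assume "\<not> Suc (idx y) \<le> k"
      with k obtain j where j: "k = Suc j" "j < n"
        by (cases k) (auto simp: n_def)
      then have "n - j = Suc (n - Suc j)" by simp
      then have "(thaler_map \<gamma> ^^ k) y = V ((V ^^ (n - Suc j)) z)"
        using orbit[of j] j by simp
      also have "\<dots> < xstar"
        unfolding xstar_def using V_pow_pos[OF z0] less1 by (simp add: V_less_iff)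
      finally show False
        using k by (simp add: thaler_Y_eq)
    qed
  qed
qed

definition Bad :: "real set" where
  "Bad = {y \<in> {xstar<..1}. \<exists>j. (F ^^ j) y = 1}"

text \<open>Each preimage under \<open>F\<close> of a set lies in the union of its images under the
  countably many branches \<open>\<psi> n\<close>, starting from the single point 1.\<close>

lemma countable_Bad: "countable Bad"
proof -
  have "countable {y \<in> {xstar<..1}. (F ^^ j) y = 1}" for j
  proof (induction j)
    case 0
    show ?case
      by (rule countable_subset[of _ "{1}"]) auto
  next
    case (Suc j)
    have "{y \<in> {xstar<..1}. (F ^^ Suc j) y = 1} \<subseteq> (\<Union>n. \<psi> n ` {y \<in> {xstar<..1}. (F ^^ j) y = 1})"
    proof
      fix y assume y: "y \<in> {y \<in> {xstar<..1}. (F ^^ Suc j) y = 1}"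
      then have "F y \<in> {y \<in> {xstar<..1}. (F ^^ j) y = 1}" "y = \<psi> (idx y) (F y)"
        using psi_F[of y] by (auto simp: funpow_swap1)
      then show "y \<in> (\<Union>n. \<psi> n ` {y \<in> {xstar<..1}. (F ^^ j) y = 1})"
        by blast
    qed
    then show ?case
      by (rule countable_subset) (intro countable_UN countable_image Suc, simp)
  qed
  then have "countable (\<Union>j. {y \<in> {xstar<..1}. (F ^^ j) y = 1})"
    by blast
  then show ?thesis
    by (rule countable_subset[rotated]) (auto simp: Bad_def)
qed

lemma F_pow_range: "y \<in> {xstar<..1} \<Longrightarrow> (F ^^ j) y \<in> {xstar<..1}"
  by (induction j) (use psi_F(1) in auto)

lemma return_time_eq:
  assumes "y \<in> {xstar<..1}" "y \<notin> Bad"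
  shows "return_time \<gamma> y j = Suc (idx ((F ^^ j) y))"
proof -
  have orbit: "(F ^^ i) y \<noteq> 1" for i
    using assms by (auto simp: Bad_def)
  \<comment> \<open>The definition of a return time refers to the sum of its predecessors, so the
    induction carries all earlier values together with the position of the orbit at that
    time.\<close>
  have "(\<forall>i<j. return_time \<gamma> y i = Suc (idx ((F ^^ i) y))) \<and> (thaler_map \<gamma> ^^ birkhoff j y) y = (F ^^ j) y" for j
  proof (induction j)
    case (Suc j)
    then have IH: "\<And>i. i < j \<Longrightarrow> return_time \<gamma> y i = Suc (idx ((F ^^ i) y))"
      "(thaler_map \<gamma> ^^ birkhoff j y) y = (F ^^ j) y"
      by auto
    have sum: "(\<Sum>i<j. return_time \<gamma> y i) = birkhoff j y"
      unfolding birkhoff_def using IH(1) by simp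
    have "(thaler_map \<gamma> ^^ (birkhoff j y + k)) y = (thaler_map \<gamma> ^^ k) ((F ^^ j) y)" for k
      unfolding IH(2)[symmetric] by (simp add: funpow_add add.commute[of "birkhoff j y"])
    note T = this
    have ret: "return_time \<gamma> y j = Suc (idx ((F ^^ j) y))"
      unfolding return_time.simps[of \<gamma> y j] sum T
      by (rule first_return(1)) (use F_pow_range[OF assms(1)] orbit[of "Suc j"] in auto)
    have "(thaler_map \<gamma> ^^ birkhoff (Suc j) y) y = (F ^^ Suc j) y"
      using T[of "Suc (idx ((F ^^ j) y))"] first_return(2)[of "(F ^^ j) y"] F_pow_range[OF assms(1), of j] orbit[of "Suc j"]
      by (simp add: birkhoff_def)
    with IH ret show ?case
      by (auto simp: less_Suc_eq)
  qed (simp add: birkhoff_def)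
  from this[of "Suc j"] show ?thesis by simp
qed

lemma sum_return_time:
  "y \<in> space \<mu> \<Longrightarrow> y \<notin> Bad \<Longrightarrow> (\<Sum>j<n. return_time \<gamma> y j) = birkhoff n y"
  unfolding birkhoff_def by (intro sum.cong refl) (simp add: return_time_eq space_mu)

lemma sets_Bad: "x \<in> Bad \<Longrightarrow> {x} \<in> sets \<mu>" "Bad \<in> sets \<mu>"
proof -
  show 1: "{x} \<in> sets \<mu>" if "x \<in> Bad" for x
    using that by (auto simp: sets_mu sets_restrict_space_iff Bad_def)
  have "(\<Union>x\<in>Bad. {x}) \<in> sets \<mu>"
    by (rule sets.countable_UN'[OF countable_Bad]) (use 1 in auto)
  then show "Bad \<in> sets \<mu>" by simp
qed

text \<open>The recursive LEAST is never analysed for measurability: the sum agrees with a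
  measurable one off a countable set of measurable points.\<close>

lemma return_sum_measurable [measurable]:
  "(\<lambda>y. \<Sum>j<n. return_time \<gamma> y j) \<in> measurable \<mu> (count_space UNIV)"
  by (rule measurable_discrete_difference[OF birkhoff_measurable[of n] countable_Bad])
     (auto simp: sets_Bad sum_return_time)

lemma scaled_return_sum_measurable:
  "(\<lambda>y. a * (real (\<Sum>j<n. return_time \<gamma> y j) - d)) \<in> borel_measurable \<mu>"
  by (intro borel_measurable_times borel_measurable_diff borel_measurable_const
      measurable_compose[OF return_sum_measurable]) simp

lemma AE_not_Bad: "AE y in \<mu>. y \<notin> Bad"
proof -
  have "Bad \<in> null_sets lborel"
    using countable_Bad by (auto intro: countable_imp_null_set_lborel)
  then have "AE y in lborel. y \<notin> Bad"
    by (rule AE_not_in)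
  then have "AE y in restrict_space lborel {xstar<..1}. y \<notin> Bad"
    by (subst AE_restrict_space_iff) auto
  moreover have "(\<lambda>x. ennreal (\<kappa> * h x)) \<in> borel_measurable (restrict_space lborel {xstar<..1})"
    by (rule measurable_restrict_space1) measurable
  ultimately show ?thesis
    unfolding mu_eq by (subst AE_density) auto
qed

lemma char_return_sum:
  "char (distr \<mu> borel (\<lambda>y. a * (real (\<Sum>j<n. return_time \<gamma> y j) - d))) s =
    cis (- (s * a * d)) * (\<integral>y. cis (s * a * real (birkhoff n y)) \<partial>\<mu>)"
proof -
  note m = scaled_return_sum_measurable[of a n d]
  have "char (distr \<mu> borel (\<lambda>y. a * (real (\<Sum>j<n. return_time \<gamma> y j) - d))) s =
      (\<integral>y. cis (s * (a * (real (\<Sum>j<n. return_time \<gamma> y j) - d))) \<partial>\<mu>)"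
    unfolding char_def by (subst integral_distr[OF m]) (auto simp: cis_conv_exp)
  also have "\<dots> = (\<integral>y. cis (- (s * a * d)) * cis (s * a * real (birkhoff n y)) \<partial>\<mu>)"
  proof (rule integral_cong_AE)
    show "AE y in \<mu>. cis (s * (a * (real (\<Sum>j<n. return_time \<gamma> y j) - d))) =
        cis (- (s * a * d)) * cis (s * a * real (birkhoff n y))"
      using AE_not_Bad AE_space
    proof eventually_elim
      case (elim y)
      then show ?case
        by (simp add: sum_return_time cis_mult algebra_simps)
    qed
  qed (use m in measurable)
  finally show ?thesis by simp
qed

end

section \<open>Convergence of the characteristic functions\<close>

text \<open>No complex logarithm is taken. Since Re z <= 0, exp (z / n) lies in the closed unit disc
  like \<open>f n\<close>, and there the difference of n-th powers is at most n times the difference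
  of the bases.\<close>

lemma power_tendsto_exp:
  fixes f :: "nat \<Rightarrow> complex"
  assumes lim: "(\<lambda>n. of_nat n * (f n - 1)) \<longlonglongrightarrow> z" and f: "\<And>n. norm (f n) \<le> 1" and z: "Re z \<le> 0"
  shows "(\<lambda>n. f n ^ n) \<longlonglongrightarrow> exp z"
proof -
  have d: "((\<lambda>u. (exp (z * u) - 1) / u) \<longlongrightarrow> z) (at 0)"
  proof -
    have "((\<lambda>u. exp (z * u)) has_field_derivative z) (at 0)"
      by (auto intro!: derivative_eq_intros)
    then show ?thesis
      by (simp add: has_field_derivative_iff)
  qed
  have "filterlim (\<lambda>n. complex_of_real (inverse (real n))) (at 0) sequentially"
    unfolding filterlim_at
  proof
    show "\<forall>\<^sub>F n in sequentially. complex_of_real (inverse (real n)) \<in> UNIV \<and> complex_of_real (inverse (real n)) \<noteq> 0"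
      using eventually_gt_at_top[of 0] by eventually_elim simp
    show "(\<lambda>n. complex_of_real (inverse (real n))) \<longlonglongrightarrow> 0"
      using tendsto_of_real[OF lim_inverse_n, where 'a = complex] by (simp add: o_def)
  qed
  from filterlim_compose[OF d this]
  have e: "(\<lambda>n. of_nat n * (exp (z / of_nat n) - 1)) \<longlonglongrightarrow> z"
    by (simp add: divide_inverse mult.commute)
  have "(\<lambda>n. of_nat n * (f n - 1) - of_nat n * (exp (z / of_nat n) - 1)) \<longlonglongrightarrow> z - z"
    by (intro tendsto_diff lim e)
  then have "(\<lambda>n. of_nat n * (f n - exp (z / of_nat n))) \<longlonglongrightarrow> 0"
    by (simp add: algebra_simps)
  then have 0: "(\<lambda>n. f n ^ n - exp (z / of_nat n) ^ n) \<longlonglongrightarrow> 0"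
  proof (rule Lim_null_comparison[OF _ tendsto_norm_zero, rotated])
    have "norm (exp (z / of_nat n)) \<le> 1" for n
      using z by (simp add: norm_exp_eq_Re divide_nonpos_nonneg)
    then have "norm (f n ^ n - exp (z / of_nat n) ^ n) \<le> real n * norm (f n - exp (z / of_nat n))" for n
      by (intro norm_power_diff f)
    then show "\<forall>\<^sub>F n in sequentially. norm (f n ^ n - exp (z / of_nat n) ^ n) \<le> norm (of_nat n * (f n - exp (z / of_nat n)))"
      by (intro always_eventually allI) (simp add: norm_mult)
  qed
  have "\<forall>\<^sub>F n in sequentially. f n ^ n - exp (z / of_nat n) ^ n = f n ^ n - exp z"
    using eventually_gt_at_top[of 0] by eventually_elim (simp flip: exp_of_nat_mult)
  with 0 have "(\<lambda>n. f n ^ n - exp z) \<longlonglongrightarrow> 0"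
    by (rule Lim_transform_eventually)
  then show ?thesis
    by (simp add: LIM_zero_iff)
qed

lemma Gamma_two_minus:
  fixes a :: real
  assumes "1 < a" "a < 2"
  shows "Gamma (2 - a) = (1 - a) * Gamma (1 - a)"
proof -
  have "1 - a \<notin> \<int>\<^sub>\<le>\<^sub>0"
  proof
    assume "1 - a \<in> \<int>\<^sub>\<le>\<^sub>0"
    then obtain k where "1 - a = - real k"
      by (auto elim!: nonpos_Ints_cases')
    then show False
      using assms by (cases k) auto
  qed
  from Gamma_plus1[OF this] show ?thesis
    by (simp add: algebra_simps)
qed

context thaler
begin

section \<open>Asymptotics of the preimages of 1 and of the tail\<close>

definition preim :: "nat \<Rightarrow> real" where "preim n = (V ^^ n) 1"

lemma preim_pos: "0 < preim n"
  by (simp add: preim_def V_pow_pos)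

lemma preim_tendsto_0: "preim \<longlonglongrightarrow> 0"
  unfolding preim_def using V_pow_tendsto_0[of 1] by simp

lemma lift_map_preim: "lift_map (preim (Suc n)) = preim n"
  using lift_map_V[OF preim_pos[of n]] by (simp add: preim_def)

lemma preim_at_right: "filterlim preim (at_right 0) sequentially"
  unfolding filterlim_at using preim_tendsto_0 preim_pos by (auto simp: less_imp_neq[symmetric])

text \<open>In the coordinate x powr -\<open>\<gamma>\<close> the map near its neutral fixed point 0
  is asymptotically the translation by -\<open>\<gamma>\<close>. Indeed \<open>lift_map x\<close> is
  x * (1 + \<open>\<epsilon> x\<close>) powr (1 / (1 - \<open>\<gamma>\<close>)), with
  \<open>\<epsilon> x\<close> asymptotic to (1 - \<open>\<gamma>\<close>) * x powr
  \<open>\<gamma>\<close>.\<close>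

lemma lift_map_increment:
  "((\<lambda>x. lift_map x powr - \<gamma> - x powr - \<gamma>) \<longlongrightarrow> - \<gamma>) (at_right 0)"
proof -
  define q where "q = - \<gamma> / (1 - \<gamma>)"
  define \<epsilon> where "\<epsilon> x = ((1 + x) powr (1 - \<gamma>) - 1) * x powr (\<gamma> - 1)" for x :: real
  have l1: "((\<lambda>x. ((1 + x) powr (1 - \<gamma>) - 1) / x) \<longlongrightarrow> 1 - \<gamma>) (at_right 0)"
    by real_asymp
  have pos: "\<forall>\<^sub>F x in at_right 0. 0 < (x::real)"
    by (simp add: eventually_at_right_less)
  have "((\<lambda>x. ((1 + x) powr (1 - \<gamma>) - 1) / x * x powr \<gamma>) \<longlongrightarrow> (1 - \<gamma>) * 0) (at_right 0)"
    by (intro tendsto_mult l1) (use gamma_pos in real_asymp)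
  moreover have "\<forall>\<^sub>F x in at_right 0. ((1 + x) powr (1 - \<gamma>) - 1) / x * x powr \<gamma> = \<epsilon> x"
    using pos by eventually_elim (simp add: \<epsilon>_def powr_diff)
  ultimately have eps_0: "(\<epsilon> \<longlongrightarrow> 0) (at_right 0)"
    using Lim_transform_eventually by fastforce
  have eps_ne: "\<epsilon> x \<noteq> 0" if "0 < x" for x
  proof -
    have "(1 + x) powr (1 - \<gamma>) \<noteq> 1"
      using that gamma_neq_1 by simp
    then show ?thesis
      using that by (simp add: \<epsilon>_def)
  qed
  have d: "((\<lambda>u. ((1 + u) powr q - 1) / u) \<longlongrightarrow> q) (at 0)"
  proof -
    have "((\<lambda>u. (1 + u) powr q) has_real_derivative q * (1 + 0) powr (q - 1) * 1) (at 0)"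
      by (auto intro!: derivative_eq_intros)
    then show ?thesis
      by (simp add: has_field_derivative_iff)
  qed
  have "filterlim \<epsilon> (at 0) (at_right 0)"
    unfolding filterlim_at using eps_0 eps_ne pos by (auto elim: eventually_mono)
  from filterlim_compose[OF d this]
  have l2: "((\<lambda>x. ((1 + \<epsilon> x) powr q - 1) / \<epsilon> x) \<longlongrightarrow> q) (at_right 0)" .
  have "((\<lambda>x. ((1 + \<epsilon> x) powr q - 1) / \<epsilon> x * (((1 + x) powr (1 - \<gamma>) - 1) / x)) \<longlongrightarrow> q * (1 - \<gamma>)) (at_right 0)"
    by (intro tendsto_mult l1 l2)
  moreover have "q * (1 - \<gamma>) = - \<gamma>"
    using gamma_neq_1 by (simp add: q_def)
  moreover have "\<forall>\<^sub>F x in at_right 0. - 1 < \<epsilon> x"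
    using eps_0 by (rule order_tendstoD) simp
  then have "\<forall>\<^sub>F x in at_right 0. ((1 + \<epsilon> x) powr q - 1) / \<epsilon> x * (((1 + x) powr (1 - \<gamma>) - 1) / x) = lift_map x powr - \<gamma> - x powr - \<gamma>"
    using pos
  proof eventually_elim
    case (elim x)
    then have x: "0 < x" "0 < 1 + \<epsilon> x" by auto
    have "x powr (1 - \<gamma>) * (1 + \<epsilon> x) = x powr (1 - \<gamma>) + (x powr (1 - \<gamma>) * x powr (\<gamma> - 1)) * ((1 + x) powr (1 - \<gamma>) - 1)"
      by (simp add: \<epsilon>_def algebra_simps)
    also have "x powr (1 - \<gamma>) * x powr (\<gamma> - 1) = 1"
      using x by (simp flip: powr_add)
    finally have "x powr (1 - \<gamma>) + (1 + x) powr (1 - \<gamma>) - 1 = x powr (1 - \<gamma>) * (1 + \<epsilon> x)"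
      by simp
    then have "lift_map x powr - \<gamma> = (x powr (1 - \<gamma>) * (1 + \<epsilon> x)) powr (1 / (1 - \<gamma>) * - \<gamma>)"
      by (simp add: lift_map_def powr_powr)
    also have "\<dots> = (x powr (1 - \<gamma>)) powr (1 / (1 - \<gamma>) * - \<gamma>) * (1 + \<epsilon> x) powr q"
      using x by (simp add: powr_mult q_def)
    also have "(x powr (1 - \<gamma>)) powr (1 / (1 - \<gamma>) * - \<gamma>) = x powr - \<gamma>"
      using gamma_neq_1 by (simp add: powr_powr)
    finally have "lift_map x powr - \<gamma> - x powr - \<gamma> = x powr - \<gamma> * ((1 + \<epsilon> x) powr q - 1)"
      by (simp add: algebra_simps)
    moreover have "((1 + x) powr (1 - \<gamma>) - 1) / x = \<epsilon> x * x powr - \<gamma>"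
      using x by (simp add: \<epsilon>_def powr_diff powr_minus field_simps)
    ultimately show ?case
      using eps_ne[OF x(1)] by simp
  qed
  ultimately show ?thesis
    using Lim_transform_eventually by fastforce
qed

text \<open>Backwards in time the translation adds about \<open>\<gamma>\<close> per step, so
  Stolz-Cesaro gives linear growth.\<close>

lemma preim_powr_asymp: "(\<lambda>n. preim n powr - \<gamma> / real n) \<longlonglongrightarrow> \<gamma>"
proof (rule stolz_cesaro)
  have "(\<lambda>n. - (lift_map (preim (Suc n)) powr - \<gamma> - preim (Suc n) powr - \<gamma>)) \<longlonglongrightarrow> - (- \<gamma>)"
    by (intro tendsto_minus filterlim_compose[OF lift_map_increment] filterlim_compose[OF preim_at_right filterlim_Suc])
  then show "(\<lambda>n. (preim (Suc n) powr - \<gamma> - preim n powr - \<gamma>) / (real (Suc n) - real n)) \<longlonglongrightarrow> \<gamma>"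
    by (simp add: lift_map_preim)
qed (simp_all add: filterlim_real_sequentially)

lemma preim_asymp: "(\<lambda>n. preim n * real n powr inverse \<gamma>) \<longlonglongrightarrow> \<gamma> powr - inverse \<gamma>"
proof -
  have "(\<lambda>n. (preim n powr - \<gamma> / real n) powr - inverse \<gamma>) \<longlonglongrightarrow> \<gamma> powr - inverse \<gamma>"
    using gamma_pos by (intro tendsto_powr preim_powr_asymp tendsto_const) auto
  moreover have "\<forall>\<^sub>F n in sequentially. (preim n powr - \<gamma> / real n) powr - inverse \<gamma> = preim n * real n powr inverse \<gamma>"
    using eventually_gt_at_top[of 0]
  proof eventually_elim
    case (elim n)
    then show ?case
      using preim_pos[of n] gamma_pos
      by (simp add: powr_divide powr_powr) (simp add: powr_minus divide_inverse)
  qed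
  ultimately show ?thesis
    by (rule Lim_transform_eventually)
qed

lemma p_eq: "p n = b (1 + preim n) - b 1"
  by (simp add: p_def preim_def)

text \<open>Obtained from U (V z) = b z - b 1 at two consecutive preimages. It makes the tails
  themselves a telescoping sequence, which is how the case of finite mean is reduced to an exponent
  below 1.\<close>

lemma p_eq_diff: "p (Suc n) = b (preim n) - b (preim (Suc n))"
proof -
  have "b (preim n) - b (preim (Suc n)) = (U (preim (Suc n)) + b 1) - (U (preim (Suc (Suc n))) + b 1)"
    using U_V[OF preim_pos[of n]] U_V[OF preim_pos[of "Suc n"]] by (simp add: preim_def)
  also have "\<dots> = p (Suc n)"
    using U_diff_V_pow[of 1 "Suc n"] by (simp add: p_def preim_def)
  finally show ?thesis by simp
qed

lemma decseq_p: "decseq p"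
proof (rule decseq_SucI)
  show "p (Suc n) \<le> p n" for n
    unfolding p_eq using V_pow_Suc_less[of 1 n] preim_pos[of "Suc n"]
    by (simp add: b_le preim_def)
qed

text \<open>The derivative of \<open>b\<close> at 1 is \<open>\<kappa>\<close>, so
  \<open>p n\<close> is asymptotic to \<open>\<kappa> * preim n\<close>.\<close>

lemma p_asymp: "(\<lambda>n. p n * real n powr inverse \<gamma>) \<longlonglongrightarrow> \<kappa> * \<gamma> powr - inverse \<gamma>"
proof -
  have d: "((\<lambda>u. (b (1 + u) - b 1) / u) \<longlongrightarrow> \<kappa>) (at 0)"
    using b_deriv[of 1] by (simp add: DERIV_def)
  have "filterlim preim (at 0) sequentially"
    using preim_at_right by (rule filterlim_mono) (simp_all add: at_le)
  from filterlim_compose[OF d this]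
  have "(\<lambda>n. p n / preim n) \<longlonglongrightarrow> \<kappa>"
    by (simp add: p_eq)
  then have "(\<lambda>n. p n / preim n * (preim n * real n powr inverse \<gamma>)) \<longlonglongrightarrow> \<kappa> * \<gamma> powr - inverse \<gamma>"
    by (intro tendsto_mult preim_asymp)
  moreover have "p n / preim n * (preim n * real n powr inverse \<gamma>) = p n * real n powr inverse \<gamma>" for n
    using preim_pos[of n] by simp
  ultimately show ?thesis by simp
qed

lemma p_tendsto_0: "p \<longlonglongrightarrow> 0"
proof -
  have "(\<lambda>n. b (1 + preim n) - b 1) \<longlonglongrightarrow> b (1 + 0) - b 1"
    by (intro tendsto_diff tendsto_const isCont_tendsto_compose[OF b_isCont] tendsto_add preim_tendsto_0) simp
  then show ?thesis
    by (simp add: p_eq [abs_def])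
qed

lemma p_nonneg: "0 \<le> p n"
  using decseq_ge[OF decseq_p p_tendsto_0] by simp

section \<open>Expansion of the characteristic function at 0\<close>

lemma phi_p_sums: "(\<lambda>n. of_real (p n) * (cis t ^ n - cis t ^ Suc n)) sums (1 - phi t)"
  using phi_sums[of t] by (simp only: prob_tail)

lemma char_asymp_small:
  assumes g: "1 < \<gamma>"
  shows "((\<lambda>t. (phi t - 1) / of_real (t powr inverse \<gamma>)) \<longlongrightarrow>
     - of_real (\<kappa> * \<gamma> powr - inverse \<gamma> * Gamma (1 - inverse \<gamma>)) * cis (- (pi * inverse \<gamma> / 2))) (at_right 0)"
proof -
  have "((\<lambda>t. (1 - phi t) / of_real (t powr inverse \<gamma>)) \<longlongrightarrow>
     of_real (\<kappa> * \<gamma> powr - inverse \<gamma> * Gamma (1 - inverse \<gamma>)) * cis (- (pi * inverse \<gamma> / 2))) (at_right 0)"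
    using g by (intro abelian[OF _ _ decseq_p p_tendsto_0 p_asymp phi_p_sums]) (auto simp: inverse_less_1_iff)
  from tendsto_minus[OF this]
  have "((\<lambda>t. - ((1 - phi t) / of_real (t powr inverse \<gamma>))) \<longlongrightarrow>
     - (of_real (\<kappa> * \<gamma> powr - inverse \<gamma> * Gamma (1 - inverse \<gamma>)) * cis (- (pi * inverse \<gamma> / 2)))) (at_right 0)" .
  moreover have "- ((1 - phi t) / of_real (t powr inverse \<gamma>)) = (phi t - 1) / of_real (t powr inverse \<gamma>)" for t
    by (simp add: diff_divide_distrib)
  ultimately show ?thesis
    by (simp only: mult_minus_left)
qed

text \<open>Here \<open>\<alpha>\<close> lies in (1,2). The Abelian theorem is applied to P n = b
  (preim n), of exponent \<open>\<alpha>\<close> - 1 and with decrements p (Suc n); the factor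
  \<open>cis t - 1\<close> restores the missing power of t. The centring 1 + c is p 0 + P 0, the sum
  of all tails.\<close>

lemma char_asymp_large:
  assumes g: "1 / 2 < \<gamma>" "\<gamma> < 1"
  shows "((\<lambda>t. (phi t * cis (- (t * (1 + c))) - 1) / of_real (t powr inverse \<gamma>)) \<longlongrightarrow>
     - of_real (\<kappa> * \<gamma> powr - inverse \<gamma> * Gamma (1 - inverse \<gamma>)) * cis (- (pi * inverse \<gamma> / 2))) (at_right 0)"
proof -
  define a where "a = inverse \<gamma>"
  have a: "1 < a" "a < 2"
    using g gamma_pos by (simp_all add: a_def field_simps)
  have ga: "\<gamma> * a = 1"
    using gamma_pos by (simp add: a_def)
  define P where "P n = b (preim n)" for n
  have c_pos: "0 < c"
    using kappa_pos g by (simp add: \<kappa>_def zero_less_mult_iff)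
  have P_eq: "P n = c * preim n powr (1 - \<gamma>)" for n
    by (simp add: P_def b_def)
  have dec: "decseq P"
  proof (rule decseq_SucI)
    show "P (Suc n) \<le> P n" for n
      using p_eq_diff[of n] p_nonneg[of "Suc n"] by (simp add: P_def)
  qed
  have "(\<lambda>n. c * preim n powr (1 - \<gamma>)) \<longlonglongrightarrow> c * 0 powr (1 - \<gamma>)"
    using g preim_pos by (intro tendsto_mult tendsto_const tendsto_powr' preim_tendsto_0) (auto simp: less_imp_le)
  then have P0: "P \<longlonglongrightarrow> 0"
    by (simp add: P_eq [abs_def])
  have "(\<lambda>n. c * (preim n * real n powr a) powr (1 - \<gamma>)) \<longlonglongrightarrow> c * (\<gamma> powr - a) powr (1 - \<gamma>)"
    unfolding a_def by (intro tendsto_mult tendsto_const tendsto_powr preim_asymp) (use gamma_pos in auto)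
  moreover have "c * (preim n * real n powr a) powr (1 - \<gamma>) = P n * real n powr (a - 1)" for n
    using preim_pos[of n] ga by (simp add: P_eq powr_mult powr_powr right_diff_distrib mult.commute[of a \<gamma>])
  ultimately have P_lim: "(\<lambda>n. P n * real n powr (a - 1)) \<longlonglongrightarrow> c * (\<gamma> powr - a) powr (1 - \<gamma>)"
    by simp
  define S where "S t = of_real (P 0) - (\<Sum>n. of_real (P n - P (Suc n)) * cis t ^ Suc n)" for t
  have S_sums: "(\<lambda>n. of_real (P n) * (cis t ^ n - cis t ^ Suc n)) sums S t" for t
    unfolding S_def by (rule abel_sums(2)[OF dec P0]) simp
  have P_0: "P 0 = c"
    by (simp add: P_def preim_def b_1)
  have p_0: "p 0 = 1"
    using b_2 by (simp add: p_def b_1)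
  \<comment> \<open>The second summation by parts: the generating series of \<open>p (Suc n)\<close>
    is \<open>P 0 - S t\<close> with P 0 = c, and p 0 = 1 supplies the remaining summand.\<close>
  have phi_eq: "phi t - 1 = (cis t - 1) * (1 + c - S t)" for t
  proof -
    have "summable (\<lambda>n. of_real (P n - P (Suc n)) * cis t ^ Suc n)"
      by (rule summable_norm_cancel[OF abel_sums(1)[OF dec P0]]) simp
    then have "(\<lambda>n. of_real (p (Suc n)) * cis t ^ Suc n) sums (c - S t)"
      by (simp add: p_eq_diff P_def S_def P_0[unfolded P_def] summable_sums)
    then have "(\<lambda>n. of_real (p n) * cis t ^ n) sums (c - S t + of_real (p 0) * cis t ^ 0)"
      by (subst sums_Suc_iff[symmetric]) simp
    then have "(\<lambda>n. (1 - cis t) * (of_real (p n) * cis t ^ n)) sums ((1 - cis t) * (c - S t + 1))"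
      by (intro sums_mult) (simp add: p_0)
    moreover have "(1 - cis t) * (of_real (p n) * cis t ^ n) = of_real (p n) * (cis t ^ n - cis t ^ Suc n)" for n
      by (simp add: algebra_simps)
    ultimately have "(\<lambda>n. of_real (p n) * (cis t ^ n - cis t ^ Suc n)) sums ((1 - cis t) * (c - S t + 1))"
      by (simp only:)
    with phi_p_sums have "1 - phi t = (1 - cis t) * (c - S t + 1)"
      by (rule sums_unique2)
    then show ?thesis
      by (simp add: algebra_simps)
  qed
  have S_asymp: "((\<lambda>t. S t / of_real (t powr (a - 1))) \<longlongrightarrow>
      of_real (c * (\<gamma> powr - a) powr (1 - \<gamma>) * Gamma (1 - (a - 1))) * cis (- (pi * (a - 1) / 2))) (at_right 0)"
    using a by (intro abelian[OF _ _ dec P0 P_lim S_sums]) auto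
  define e where "e t = cis (- (t * (1 + c)))" for t
  have e_lim: "(e \<longlongrightarrow> 1) (at_right 0)"
  proof -
    have "((\<lambda>t. e t - 1) \<longlongrightarrow> 0) (at_right 0)"
    proof (rule Lim_null_comparison)
      show "\<forall>\<^sub>F t in at_right 0. norm (e t - 1) \<le> \<bar>t * (1 + c)\<bar>"
      proof (intro always_eventually allI)
        show "norm (e t - 1) \<le> \<bar>t * (1 + c)\<bar>" for t
          using norm_cis_diff_le[of "- (t * (1 + c))" 0] by (simp add: e_def)
      qed
      show "((\<lambda>t. \<bar>t * (1 + c)\<bar>) \<longlongrightarrow> 0) (at_right 0)"
        using tendsto_rabs[OF tendsto_mult[OF tendsto_ident_at tendsto_const[of "1 + c"]], of 0 "{0<..}"] by simp
    qed
    then show ?thesis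
      by (simp add: LIM_zero_iff)
  qed
  have quad: "norm (cis u - 1 - \<i> * of_real u) \<le> u\<^sup>2 / 2" for u
    using iexp_approx1[of u 1] by (simp add: cis_conv_exp power2_eq_square algebra_simps)
  \<comment> \<open>The first-order terms of the centring factor and of
    \<open>(cis t - 1) * (1 + c)\<close> cancel; the remainder is quadratic, hence negligible
    against t powr a because a < 2.\<close>
  have rest: "((\<lambda>t. (e t - 1 + (cis t - 1) * (1 + c) * e t) / of_real (t powr a)) \<longlongrightarrow> 0) (at_right 0)"
  proof (rule Lim_null_comparison)
    let ?l = "1 + c"
    show "\<forall>\<^sub>F t in at_right 0. norm ((e t - 1 + (cis t - 1) * (1 + c) * e t) / of_real (t powr a)) \<le>
        ((t * ?l)\<^sup>2 / 2 + (t\<^sup>2 / 2 * ?l + t * ?l * (t * ?l))) / t powr a"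
      using eventually_at_right_less
    proof eventually_elim
      case (elim t)
      then have t: "0 < t" by simp
      have e1: "norm (e t - 1) \<le> t * ?l"
        using norm_cis_diff_le[of "- (t * ?l)" 0] t c_pos by (simp add: e_def abs_mult)
      have "e t - 1 + (cis t - 1) * (1 + c) * e t =
         (e t - 1 - \<i> * of_real (- (t * ?l))) + ((cis t - 1 - \<i> * of_real t) * of_real ?l * e t + \<i> * of_real (t * ?l) * (e t - 1))"
        by (simp add: algebra_simps)
      also have "norm \<dots> \<le> (t * ?l)\<^sup>2 / 2 + (t\<^sup>2 / 2 * ?l * 1 + t * ?l * (t * ?l))"
      proof (intro order.trans[OF norm_triangle_ineq] add_mono)
        show "norm (e t - 1 - \<i> * of_real (- (t * ?l))) \<le> (t * ?l)\<^sup>2 / 2"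
          using quad[of "- (t * ?l)"] by (simp add: e_def)
        have "norm (of_real ?l :: complex) = ?l"
          using c_pos by (simp only: norm_of_real)
        then show "norm ((cis t - 1 - \<i> * of_real t) * of_real ?l * e t) \<le> t\<^sup>2 / 2 * ?l * 1"
          unfolding norm_mult using quad[of t] c_pos by (intro mult_mono) (auto simp: e_def)
        show "norm (\<i> * of_real (t * ?l) * (e t - 1)) \<le> t * ?l * (t * ?l)"
          unfolding norm_mult norm_of_real using e1 t c_pos by (simp add: abs_mult mult_left_mono)
      qed
      finally have "norm (e t - 1 + (cis t - 1) * (1 + c) * e t) \<le> (t * ?l)\<^sup>2 / 2 + (t\<^sup>2 / 2 * ?l + t * ?l * (t * ?l))"
        by (simp only: mult_1_right)
      then show ?case
        unfolding norm_divide norm_of_real by (simp add: divide_right_mono)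
    qed
    show "((\<lambda>t. ((t * ?l)\<^sup>2 / 2 + (t\<^sup>2 / 2 * ?l + t * ?l * (t * ?l))) / t powr a) \<longlongrightarrow> 0) (at_right 0)"
      using a c_pos by real_asymp
  qed
  have main: "((\<lambda>t. (1 - cis t) / of_real t * (S t / of_real (t powr (a - 1))) * e t) \<longlongrightarrow>
      - \<i> * (of_real (c * (\<gamma> powr - a) powr (1 - \<gamma>) * Gamma (1 - (a - 1))) * cis (- (pi * (a - 1) / 2))) * 1) (at_right 0)"
    by (intro tendsto_mult cis_minus_one_tendsto S_asymp e_lim)
  have sum: "((\<lambda>t. (e t - 1 + (cis t - 1) * (1 + c) * e t) / of_real (t powr a) + (1 - cis t) / of_real t * (S t / of_real (t powr (a - 1))) * e t) \<longlongrightarrow>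
      0 + - \<i> * (of_real (c * (\<gamma> powr - a) powr (1 - \<gamma>) * Gamma (1 - (a - 1))) * cis (- (pi * (a - 1) / 2))) * 1) (at_right 0)"
    by (intro tendsto_add rest main)
  \<comment> \<open>The quarter turn by -i, the recursion for Gamma at 2 - a, and
    \<open>\<gamma>\<close> * a = 1 bring the constant into the form found for
    \<open>\<gamma>\<close> > 1, so the two regimes merge from here on.\<close>
  have const: "0 + - \<i> * (of_real (c * (\<gamma> powr - a) powr (1 - \<gamma>) * Gamma (1 - (a - 1))) * cis (- (pi * (a - 1) / 2))) * 1 =
      - of_real (\<kappa> * \<gamma> powr - a * Gamma (1 - a)) * cis (- (pi * a / 2))"
  proof -
    have "- (pi * (a - 1) / 2) = pi / 2 + - (pi * a / 2)"
      by (simp add: field_simps)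
    then have cis: "\<i> * cis (- (pi * (a - 1) / 2)) = - cis (- (pi * a / 2))"
      by (simp only: cis_mult[symmetric] cis_pi_half) simp
    have Gamma: "Gamma (1 - (a - 1)) = (1 - a) * Gamma (1 - a)"
      using Gamma_two_minus[OF a] by simp
    have gam: "(\<gamma> powr - a) powr (1 - \<gamma>) * (1 - a) = - ((1 - \<gamma>) * \<gamma> powr - a)"
    proof -
      have "(\<gamma> powr - a) powr (1 - \<gamma>) = \<gamma> powr (- a + 1)"
        using ga by (simp add: powr_powr algebra_simps)
      also have "\<dots> = \<gamma> powr - a * \<gamma>"
        using gamma_pos by (subst powr_add) simp
      finally have "(\<gamma> powr - a) powr (1 - \<gamma>) * (1 - a) = \<gamma> powr - a * (\<gamma> - \<gamma> * a)"
        by (simp add: algebra_simps)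
      then show ?thesis
        unfolding ga by (simp add: algebra_simps)
    qed
    let ?A = "(\<gamma> powr - a) powr (1 - \<gamma>)"
    have "c * ?A * Gamma (1 - (a - 1)) = c * (?A * (1 - a)) * Gamma (1 - a)"
      unfolding Gamma by (simp only: mult_ac)
    also have "\<dots> = - (\<kappa> * \<gamma> powr - a * Gamma (1 - a))"
      unfolding gam \<kappa>_def by (simp only: mult_ac mult_minus_left mult_minus_right)
    finally have Z: "c * ?A * Gamma (1 - (a - 1)) = - (\<kappa> * \<gamma> powr - a * Gamma (1 - a))" .
    have "0 + - \<i> * (of_real r * z) * 1 = - of_real r * (\<i> * z)" for r z
      by simp
    note 0 = this
    show ?thesis
      unfolding Z 0 cis by simp
  qed
  have "\<forall>\<^sub>F t in at_right 0. (e t - 1 + (cis t - 1) * (1 + c) * e t) / of_real (t powr a) + (1 - cis t) / of_real t * (S t / of_real (t powr (a - 1))) * e t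
      = (phi t * e t - 1) / of_real (t powr a)"
    using eventually_at_right_less
  proof eventually_elim
    case (elim t)
    then have t: "0 < t" by simp
    have ph: "phi t = 1 + (cis t - 1) * (1 + c - S t)"
      using phi_eq[of t] by (simp add: algebra_simps)
    have A: "phi t * e t - 1 = (e t - 1 + (cis t - 1) * (1 + c) * e t) + (1 - cis t) * S t * e t"
      unfolding ph by (simp add: algebra_simps)
    have B: "complex_of_real t * of_real (t powr (a - 1)) = of_real (t powr a)"
    proof -
      have "t * t powr (a - 1) = t powr a"
        using t by (simp add: powr_diff)
      then show ?thesis
        by (simp only: of_real_mult[symmetric])
    qed
    show ?case
      unfolding A add_divide_distrib B[symmetric] by simp
  qed
  from Lim_transform_eventually[OF sum this] show ?thesis
    unfolding const by (simp add: e_def a_def)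
qed

definition \<alpha> :: real where "\<alpha> = inverse \<gamma>"

definition ell :: real where "ell = (if \<gamma> < 1 then 1 + c else 0)"

lemma char_asymp:
  assumes "1 / 2 < \<gamma>"
  shows "((\<lambda>t. (phi t * cis (- (t * ell)) - 1) / of_real (t powr \<alpha>)) \<longlongrightarrow>
     - of_real (\<kappa> * \<gamma> powr - \<alpha> * Gamma (1 - \<alpha>)) * cis (- (pi * \<alpha> / 2))) (at_right 0)"
proof (cases "\<gamma> < 1")
  case True
  then show ?thesis
    using char_asymp_large[OF assms] by (simp add: ell_def \<alpha>_def)
next
  case False
  then show ?thesis
    using char_asymp_small gamma_neq_1 by (simp add: ell_def \<alpha>_def)
qed

context
  assumes gamma_gt: "1 / 2 < \<gamma>"
begin

lemma alpha_bounds: "0 < \<alpha>" "\<alpha> < 2" "\<alpha> \<noteq> 1" "\<alpha> * \<gamma> = 1"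
  using gamma_gt gamma_pos gamma_neq_1 by (auto simp: \<alpha>_def field_simps)

lemma ell_const_eq: "ell_const \<alpha> = ell"
proof (cases "\<gamma> < 1")
  case True
  then have "1 < \<alpha>"
    using gamma_pos by (simp add: \<alpha>_def one_less_inverse_iff)
  then have "ell_const \<alpha> = inverse (1 - 2 powr (\<gamma> - 1))"
    by (simp add: ell_const_def \<alpha>_def)
  also have "2 powr (\<gamma> - 1) = inverse (2 powr (1 - \<gamma>))"
    by (simp flip: powr_minus)
  also have "inverse (1 - inverse (2 powr (1 - \<gamma>))) = 1 + c"
    using c_denom by (simp add: c_def field_simps)
  finally show ?thesis
    using True by (simp add: ell_def)
next
  case False
  then have "\<alpha> < 1"
    using gamma_pos gamma_neq_1 by (simp add: \<alpha>_def inverse_less_1_iff)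
  then show ?thesis
    using False by (simp add: ell_def ell_const_def)
qed

lemma d_const_eq: "d_const \<alpha> = \<kappa> * \<gamma> powr - \<alpha> * Gamma (1 - \<alpha>) * cos (pi * \<alpha> / 2)"
proof -
  have "\<alpha> powr \<alpha> = \<gamma> powr - \<alpha>"
    using gamma_pos by (simp add: \<alpha>_def powr_minus inverse_powr)
  then show ?thesis
    by (simp add: d_const_def g_const_def kappa_eq \<alpha>_def mult_ac)
qed

text \<open>Both factors change sign as \<open>\<alpha>\<close> crosses 1, so the product stays
  positive.\<close>

lemma Gamma_cos_pos: "0 < Gamma (1 - \<alpha>) * cos (pi * \<alpha> / 2)"
proof (cases "\<alpha> < 1")
  case True
  then have "0 < cos (pi * \<alpha> / 2)"
  proof (intro cos_gt_zero_pi)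
    have "0 < pi * \<alpha>" "pi * \<alpha> < pi"
      using alpha_bounds True by simp_all
    then show "- (pi / 2) < pi * \<alpha> / 2" "pi * \<alpha> / 2 < pi / 2"
      by linarith+
  qed
  then show ?thesis
    using True by (simp add: Gamma_real_pos)
next
  case False
  then have a: "1 < \<alpha>" using alpha_bounds by simp
  have "cos (pi * \<alpha> / 2) = - cos (pi - pi * \<alpha> / 2)"
    by (simp add: cos_diff)
  moreover have "0 < cos (pi - pi * \<alpha> / 2)"
    using a alpha_bounds by (intro cos_gt_zero_pi) (auto simp: field_simps)
  ultimately have cos: "cos (pi * \<alpha> / 2) < 0" by simp
  have "(1 - \<alpha>) * Gamma (1 - \<alpha>) = Gamma (2 - \<alpha>)"
    using Gamma_two_minus a alpha_bounds by simp
  also have "\<dots> > 0"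
    using alpha_bounds by (intro Gamma_real_pos) auto
  finally have "Gamma (1 - \<alpha>) < 0"
    using a by (simp add: zero_less_mult_iff)
  then show ?thesis
    using cos by (rule mult_neg_neg)
qed

lemma d_const_pos: "0 < d_const \<alpha>"
proof -
  have "0 < \<kappa> * \<gamma> powr - \<alpha> * (Gamma (1 - \<alpha>) * cos (pi * \<alpha> / 2))"
    by (rule mult_pos_pos[OF mult_pos_pos Gamma_cos_pos]) (use kappa_pos gamma_pos in auto)
  then show ?thesis
    by (simp add: d_const_eq mult.assoc)
qed

definition \<zeta> :: complex where "\<zeta> = 1 - \<i> * of_real (tan (\<alpha> * pi / 2))"

text \<open>Writing cis (-x) = cos x * (1 - i tan x) explains the cosine in \<open>g_const\<close>
  and produces the skewness factor of the stable law with parameter 1.\<close>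

lemma const_eq: "of_real (\<kappa> * \<gamma> powr - \<alpha> * Gamma (1 - \<alpha>)) * cis (- (pi * \<alpha> / 2)) = of_real (d_const \<alpha>) * \<zeta>"
proof -
  have "cos (pi * \<alpha> / 2) \<noteq> 0"
    using Gamma_cos_pos by auto
  then have "cis (- (pi * \<alpha> / 2)) = of_real (cos (pi * \<alpha> / 2)) * \<zeta>"
    by (simp add: \<zeta>_def complex_eq_iff tan_def mult.commute)
  then show ?thesis
    by (simp add: d_const_eq)
qed

section \<open>Normalisation and choice of the parameters\<close>

definition scale :: "real \<Rightarrow> nat \<Rightarrow> real" where
  "scale s n = s * (real n powr - \<gamma> * d_const \<alpha> powr - \<gamma>)"

lemma scale_at_right:
  assumes "0 < s"
  shows "filterlim (scale s) (at_right 0) sequentially"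
proof -
  have "0 < d_const \<alpha> powr - \<gamma>"
    using d_const_pos by simp
  then show ?thesis
    unfolding scale_def using assms gamma_pos by real_asymp
qed

lemma scale_powr:
  assumes "0 < s" "0 < n"
  shows "real n * scale s n powr \<alpha> = s powr \<alpha> / d_const \<alpha>"
proof -
  have "(real n powr - \<gamma>) powr \<alpha> = real n powr - 1" "(d_const \<alpha> powr - \<gamma>) powr \<alpha> = d_const \<alpha> powr - 1"
    using alpha_bounds(4) by (simp_all add: powr_powr mult.commute[of \<gamma>])
  then have "scale s n powr \<alpha> = s powr \<alpha> * (real n powr - 1 * d_const \<alpha> powr - 1)"
    using assms d_const_pos by (simp only: scale_def powr_mult)
  then show ?thesis
    using assms d_const_pos by (simp add: powr_minus field_simps)
qed

lemma phi_power_limit: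
  assumes s: "0 < s"
  shows "(\<lambda>n. (phi (scale s n) * cis (- (scale s n * ell))) ^ n) \<longlonglongrightarrow> exp (- of_real (s powr \<alpha>) * \<zeta>)"
proof (rule power_tendsto_exp)
  let ?f = "\<lambda>t. (phi t * cis (- (t * ell)) - 1) / of_real (t powr \<alpha>)"
  have "(\<lambda>n. ?f (scale s n)) \<longlonglongrightarrow> - (of_real (d_const \<alpha>) * \<zeta>)"
    using filterlim_compose[OF char_asymp[OF gamma_gt] scale_at_right[OF s]] const_eq by simp
  then have "(\<lambda>n. of_real (s powr \<alpha> / d_const \<alpha>) * ?f (scale s n)) \<longlonglongrightarrow> of_real (s powr \<alpha> / d_const \<alpha>) * - (of_real (d_const \<alpha>) * \<zeta>)"
    by (intro tendsto_mult tendsto_const)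
  moreover have "of_real (s powr \<alpha> / d_const \<alpha>) * - (of_real (d_const \<alpha>) * \<zeta>) = - of_real (s powr \<alpha>) * \<zeta>"
    using d_const_pos by simp
  moreover have "\<forall>\<^sub>F n in sequentially. of_real (s powr \<alpha> / d_const \<alpha>) * ?f (scale s n) =
      of_nat n * (phi (scale s n) * cis (- (scale s n * ell)) - 1)"
    using eventually_gt_at_top[of 0]
  proof eventually_elim
    case (elim n)
    have "scale s n powr \<alpha> \<noteq> 0"
      using s elim d_const_pos by (simp add: scale_def)
    then show ?case
      unfolding scale_powr[OF s elim, symmetric] by simp
  qed
  ultimately show "(\<lambda>n. of_nat n * (phi (scale s n) * cis (- (scale s n * ell)) - 1)) \<longlonglongrightarrow> - of_real (s powr \<alpha>) * \<zeta>"
    using Lim_transform_eventually by fastforce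
  show "norm (phi (scale s n) * cis (- (scale s n * ell))) \<le> 1" for n
    using norm_phi_le by (simp add: norm_mult)
  show "Re (- of_real (s powr \<alpha>) * \<zeta>) \<le> 0"
    by (simp add: \<zeta>_def)
qed

text \<open>With \<open>\<beta>\<close> strictly between \<open>\<alpha> / 2\<close> and \<open>min 1 \<alpha>\<close>, the bound \<open>tmean t = o(t powr \<beta>)\<close> makes
  \<open>n * m * (tmean t)\<^sup>2\<close> negligible at the scale \<open>t \<approx> n powr - \<gamma>\<close>, even for \<open>m\<close> a small power of \<open>n\<close>.\<close>

lemma tmean_scale:
  assumes s: "0 < s" and beta: "0 < \<beta>" "\<beta> < 1" "\<beta> < \<alpha>"
  shows "(\<lambda>n. tmean (scale s n) * real n powr (\<gamma> * \<beta>)) \<longlonglongrightarrow> 0"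
proof -
  \<comment> \<open>n powr \<open>\<gamma>\<close> is the order of 1 / \<open>scale s n\<close>, the
    level at which the two terms of \<open>tmean_le\<close> balance.\<close>
  define N where "N n = nat \<lceil>real n powr \<gamma>\<rceil>" for n
  define D where "D = s * d_const \<alpha> powr - \<gamma>"
  have D: "0 < D" using s d_const_pos by (simp add: D_def)
  have N_top: "filterlim N sequentially sequentially"
    unfolding N_def using gamma_pos by real_asymp
  have "(\<lambda>n. (p n * real n powr \<alpha>) * real n powr (\<beta> - \<alpha>)) \<longlonglongrightarrow> (\<kappa> * \<gamma> powr - \<alpha>) * 0"
  proof (rule tendsto_mult)
    show "(\<lambda>n. p n * real n powr \<alpha>) \<longlonglongrightarrow> \<kappa> * \<gamma> powr - \<alpha>"
      using p_asymp by (simp add: \<alpha>_def)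
    show "(\<lambda>n. real n powr (\<beta> - \<alpha>)) \<longlonglongrightarrow> 0"
      using beta by real_asymp
  qed
  moreover have "(p n * real n powr \<alpha>) * real n powr (\<beta> - \<alpha>) = p n * real n powr \<beta>" for n
    by (simp add: powr_diff)
  ultimately have pb: "(\<lambda>n. p n * real n powr \<beta>) \<longlonglongrightarrow> 0"
    by simp
  from sum_little_o[OF beta(1,2) pb] have pb': "(\<lambda>N. (\<Sum>n<N. p n) / real N powr (1 - \<beta>)) \<longlonglongrightarrow> 0"
    by simp
  have lim: "(\<lambda>n. 2 * (p (N n) * real (N n) powr \<beta>) + D * 2 powr (1 - \<beta>) * ((\<Sum>n<N n. p n) / real (N n) powr (1 - \<beta>))) \<longlonglongrightarrow>
      2 * 0 + D * 2 powr (1 - \<beta>) * 0"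
    by (intro tendsto_add tendsto_mult tendsto_const filterlim_compose[OF pb N_top] filterlim_compose[OF pb' N_top])
  show ?thesis
  proof (rule Lim_null_comparison)
    show "(\<lambda>n. 2 * (p (N n) * real (N n) powr \<beta>) + D * 2 powr (1 - \<beta>) * ((\<Sum>n<N n. p n) / real (N n) powr (1 - \<beta>))) \<longlonglongrightarrow> 0"
      using lim by simp
    show "\<forall>\<^sub>F n in sequentially. norm (tmean (scale s n) * real n powr (\<gamma> * \<beta>)) \<le>
       2 * (p (N n) * real (N n) powr \<beta>) + D * 2 powr (1 - \<beta>) * ((\<Sum>n<N n. p n) / real (N n) powr (1 - \<beta>))"
      using eventually_gt_at_top[of 0]
    proof eventually_elim
      case (elim n)
      have n1: "1 \<le> real n powr \<gamma>"
        using elim gamma_pos by (intro ge_one_powr_ge_zero) auto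
      have "real (N n) = of_int \<lceil>real n powr \<gamma>\<rceil>"
        unfolding N_def using n1 by (subst of_nat_nat) auto
      then have N1: "real n powr \<gamma> \<le> real (N n)" "real (N n) \<le> 2 * real n powr \<gamma>"
        using n1 by linarith+
      have N0: "0 < real (N n)"
        using N1 n1 by linarith
      let ?s = "\<Sum>n<N n. p n"
      have s0: "0 \<le> ?s" by (intro sum_nonneg p_nonneg)
      have sc: "scale s n = D * real n powr - \<gamma>" "0 \<le> scale s n"
        using D s by (simp_all add: scale_def D_def)
      have pw: "(real n powr \<gamma>) powr \<beta> = real n powr (\<gamma> * \<beta>)"
        by (simp add: powr_powr)
      have "tmean (scale s n) * real n powr (\<gamma> * \<beta>) \<le> (2 * p (N n) + scale s n * ?s) * real n powr (\<gamma> * \<beta>)"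
        using tmean_le[OF sc(2), of "N n"] by (intro mult_right_mono) (simp_all only: prob_tail powr_ge_zero)
      also have "\<dots> = 2 * (p (N n) * real n powr (\<gamma> * \<beta>)) + D * (real n powr - \<gamma> * real n powr (\<gamma> * \<beta>)) * ?s"
        by (simp add: sc algebra_simps)
      finally have 1: "tmean (scale s n) * real n powr (\<gamma> * \<beta>) \<le>
          2 * (p (N n) * real n powr (\<gamma> * \<beta>)) + D * (real n powr - \<gamma> * real n powr (\<gamma> * \<beta>)) * ?s" .
      have 2: "p (N n) * real n powr (\<gamma> * \<beta>) \<le> p (N n) * real (N n) powr \<beta>"
        unfolding pw[symmetric] using N1 beta p_nonneg by (intro mult_left_mono powr_mono2) auto
      have 3: "D * (real n powr - \<gamma> * real n powr (\<gamma> * \<beta>)) * ?s \<le> D * 2 powr (1 - \<beta>) * (?s / real (N n) powr (1 - \<beta>))"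
      proof -
        have "real (N n) powr (1 - \<beta>) \<le> (2 * real n powr \<gamma>) powr (1 - \<beta>)"
          using N1 beta by (intro powr_mono2) auto
        also have "\<dots> = 2 powr (1 - \<beta>) * real n powr (\<gamma> * (1 - \<beta>))"
          by (simp add: powr_mult powr_powr)
        finally have le: "real (N n) powr (1 - \<beta>) \<le> 2 powr (1 - \<beta>) * real n powr (\<gamma> * (1 - \<beta>))" .
        define X where "X = real n powr (\<gamma> * (1 - \<beta>))"
        have X: "0 < X" "real n powr (- (\<gamma> * (1 - \<beta>))) = inverse X"
          using elim by (simp_all only: X_def powr_minus) simp
        have "real n powr (- (\<gamma> * (1 - \<beta>))) \<le> 2 powr (1 - \<beta>) / real (N n) powr (1 - \<beta>)"
          unfolding X(2) using le[folded X_def] X(1) N0 by (simp add: field_simps)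
        moreover have "real n powr - \<gamma> * real n powr (\<gamma> * \<beta>) = real n powr (- (\<gamma> * (1 - \<beta>)))"
          by (simp add: algebra_simps flip: powr_add)
        ultimately show ?thesis
          using mult_left_mono[of "real n powr (- (\<gamma> * (1 - \<beta>)))" "2 powr (1 - \<beta>) / real (N n) powr (1 - \<beta>)" "D * ?s"] D s0
          by (simp add: mult_ac)
      qed
      from 1 2 3 have "tmean (scale s n) * real n powr (\<gamma> * \<beta>) \<le>
          2 * (p (N n) * real (N n) powr \<beta>) + D * 2 powr (1 - \<beta>) * (?s / real (N n) powr (1 - \<beta>))"
        by linarith
      then show ?case
        using tmean_nonneg[of "scale s n"] by (simp add: abs_mult)
    qed
  qed
qed

lemma birkhoff_phi_limit:
  assumes s: "0 < s"
  shows "(\<lambda>n. (\<integral>y. cis (scale s n * real (birkhoff n y)) \<partial>\<mu>) - phi (scale s n) ^ n) \<longlonglongrightarrow> 0"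
proof -
  \<comment> \<open>The midpoint of \<open>\<alpha>\<close> / 2 and min 1 \<open>\<alpha>\<close>,
    an interval that is nonempty because 0 < \<open>\<alpha>\<close> < 2.\<close>
  define \<beta> where "\<beta> = (\<alpha> / 2 + min 1 \<alpha>) / 2"
  have beta: "0 < \<beta>" "\<beta> < 1" "\<beta> < \<alpha>" "\<alpha> / 2 < \<beta>"
    using alpha_bounds by (auto simp: \<beta>_def min_def)
  \<comment> \<open>Positive because \<open>\<beta>\<close> > \<open>\<alpha>\<close> / 2. As 2 *
    \<open>\<gamma>\<close> * \<open>\<beta>\<close> = 1 + 2 * \<open>\<delta>\<close>, a gap
    \<open>m\<close> of order n powr \<open>\<delta>\<close> leaves a factor n powr
    -\<open>\<delta>\<close> in the quadratic error.\<close>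
  define \<delta> where "\<delta> = (2 * (\<gamma> * \<beta>) - 1) / 2"
  have delta: "0 < \<delta>"
    using beta(4) alpha_bounds(4) gamma_pos mult_strict_left_mono[OF beta(4) gamma_pos]
    by (simp add: \<delta>_def mult.commute)
  \<comment> \<open>The truncation level will be n ^ k: its tail contributes order n powr (1 - k *
    \<open>\<alpha>\<close>), and 2 ^ m with m about n powr \<open>\<delta>\<close> still beats the
    polynomial n ^ (k + 1).\<close>
  obtain k :: nat where k: "2 < real k * \<alpha>"
    using reals_Archimedean3[OF alpha_bounds(1)] by blast
  define m where "m n = nat \<lceil>real n powr \<delta>\<rceil>" for n
  have t1: "(\<lambda>n. 3 * (real (m n) * real n powr - (2 * \<delta>)) * (tmean (scale s n) * real n powr (\<gamma> * \<beta>)) ^ 2) \<longlonglongrightarrow> 3 * 0 * 0 ^ 2"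
  proof (intro tendsto_mult tendsto_const tendsto_power tmean_scale s beta)
    show "(\<lambda>n. real (m n) * real n powr - (2 * \<delta>)) \<longlonglongrightarrow> 0"
      unfolding m_def using delta by real_asymp
  qed
  have e1: "\<forall>\<^sub>F n in sequentially. 3 * (real (m n) * real n powr - (2 * \<delta>)) * (tmean (scale s n) * real n powr (\<gamma> * \<beta>)) ^ 2
      = real n * (3 * real (m n) * (tmean (scale s n))\<^sup>2)"
    using eventually_gt_at_top[of 0]
  proof eventually_elim
    case (elim n)
    have "(real n powr (\<gamma> * \<beta>)) ^ 2 = real n powr (2 * (\<gamma> * \<beta>))"
      using elim by (simp flip: powr_realpow add: powr_powr mult.commute)
    moreover have "real n powr - (2 * \<delta>) * real n powr (2 * (\<gamma> * \<beta>)) = real n"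
    proof -
      have "- (2 * \<delta>) + 2 * (\<gamma> * \<beta>) = 1"
        by (simp add: \<delta>_def field_simps)
      then show ?thesis
        using elim by (simp flip: powr_add)
    qed
    ultimately show ?case
      by (simp add: power_mult_distrib mult_ac)
  qed
  have t2: "(\<lambda>n. real n * (2 * real (n ^ k) / 2 ^ m n)) \<longlonglongrightarrow> 0"
  proof (rule Lim_null_comparison)
    show "(\<lambda>n. real n * (2 * real n powr real k) / 2 powr (real n powr \<delta>)) \<longlonglongrightarrow> 0"
      using delta by real_asymp
    show "\<forall>\<^sub>F n in sequentially. norm (real n * (2 * real (n ^ k) / 2 ^ m n)) \<le> real n * (2 * real n powr real k) / 2 powr (real n powr \<delta>)"
      using eventually_gt_at_top[of 0]
    proof eventually_elim
      case (elim n)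
      have "real n powr \<delta> \<le> real (m n)"
        unfolding m_def by linarith
      then have "2 powr (real n powr \<delta>) \<le> 2 powr real (m n)"
        by (intro powr_mono) auto
      also have "\<dots> = 2 ^ m n"
        by (simp add: powr_realpow)
      finally have "2 powr (real n powr \<delta>) \<le> 2 ^ m n" .
      then show ?case
        using elim by (simp add: powr_realpow frac_le)
    qed
  qed
  have "(\<lambda>n. p (n ^ k) * real (n ^ k) powr \<alpha> * real n powr (1 - real k * \<alpha>)) \<longlonglongrightarrow> \<kappa> * \<gamma> powr - \<alpha> * 0"
  proof (rule tendsto_mult)
    have "0 < k" using k by (cases k) auto
    then have "filterlim (\<lambda>n. n ^ k) sequentially sequentially"
      by (intro filterlim_at_top_mono[OF filterlim_ident] eventually_sequentiallyI[of 1] self_le_power) auto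
    from filterlim_compose[OF p_asymp this]
    show "(\<lambda>n. p (n ^ k) * real (n ^ k) powr \<alpha>) \<longlonglongrightarrow> \<kappa> * \<gamma> powr - \<alpha>"
      by (simp add: \<alpha>_def)
    show "(\<lambda>n. real n powr (1 - real k * \<alpha>)) \<longlonglongrightarrow> 0"
      using k by real_asymp
  qed
  moreover have "\<forall>\<^sub>F n in sequentially. p (n ^ k) * real (n ^ k) powr \<alpha> * real n powr (1 - real k * \<alpha>) = real n * p (n ^ k)"
    using eventually_gt_at_top[of 0]
  proof eventually_elim
    case (elim n)
    have "real (n ^ k) powr \<alpha> = real n powr (real k * \<alpha>)"
      using elim by (simp flip: powr_realpow add: powr_powr)
    moreover have "real n powr (real k * \<alpha>) * real n powr (1 - real k * \<alpha>) = real n"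
      using elim by (simp flip: powr_add)
    ultimately show ?case
      by (simp add: mult_ac)
  qed
  ultimately have t3: "(\<lambda>n. real n * p (n ^ k)) \<longlonglongrightarrow> 0"
    using Lim_transform_eventually by fastforce
  have t1': "(\<lambda>n. real n * (3 * real (m n) * (tmean (scale s n))\<^sup>2)) \<longlonglongrightarrow> 0"
    using Lim_transform_eventually[OF t1 e1] by simp
  have "(\<lambda>n. real n * (3 * real (m n) * (tmean (scale s n))\<^sup>2) + real n * (2 * real (n ^ k) / 2 ^ m n) + 4 * (real n * p (n ^ k))) \<longlonglongrightarrow> 0 + 0 + 4 * 0"
    by (intro tendsto_add tendsto_mult tendsto_const t1' t2 t3)
  then have lim: "(\<lambda>n. real n * (3 * real (m n) * (tmean (scale s n))\<^sup>2 + 2 * real (n ^ k) / 2 ^ m n + 4 * p (n ^ k))) \<longlonglongrightarrow> 0"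
    by (simp add: distrib_left mult_ac)
  show ?thesis
  proof (rule Lim_null_comparison[OF _ lim], intro always_eventually allI)
    fix n
    show "norm ((\<integral>y. cis (scale s n * real (birkhoff n y)) \<partial>\<mu>) - phi (scale s n) ^ n) \<le>
       real n * (3 * real (m n) * (tmean (scale s n))\<^sup>2 + 2 * real (n ^ k) / 2 ^ m n + 4 * p (n ^ k))"
      using birkhoff_char_approx[of "scale s n" n "m n" "n ^ k"] unfolding prob_tail
      by (simp only: of_nat_mult of_nat_numeral)
  qed
qed

lemma char_limit_pos:
  assumes s: "0 < s"
  shows "(\<lambda>n. cis (- (scale s n * (real n * ell))) * (\<integral>y. cis (scale s n * real (birkhoff n y)) \<partial>\<mu>))
     \<longlonglongrightarrow> exp (- of_real (s powr \<alpha>) * \<zeta>)"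
proof -
  let ?I = "\<lambda>n. \<integral>y. cis (scale s n * real (birkhoff n y)) \<partial>\<mu>"
  have "(\<lambda>n. cis (- (scale s n * (real n * ell))) * (?I n - phi (scale s n) ^ n)) \<longlonglongrightarrow> 0"
    by (rule Lim_null_comparison[OF _ tendsto_norm_zero[OF birkhoff_phi_limit[OF s]]])
       (simp add: norm_mult)
  then have "(\<lambda>n. cis (- (scale s n * (real n * ell))) * (?I n - phi (scale s n) ^ n)
      + (phi (scale s n) * cis (- (scale s n * ell))) ^ n) \<longlonglongrightarrow> 0 + exp (- of_real (s powr \<alpha>) * \<zeta>)"
    by (intro tendsto_add phi_power_limit s)
  moreover have "cis (- (scale s n * (real n * ell))) * (?I n - phi (scale s n) ^ n)
      + (phi (scale s n) * cis (- (scale s n * ell))) ^ n = cis (- (scale s n * (real n * ell))) * ?I n" for n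
  proof -
    have "cis (- (scale s n * ell)) ^ n = cis (- (scale s n * (real n * ell)))"
      by (simp add: Complex.DeMoivre mult_ac)
    then show ?thesis
      by (simp add: power_mult_distrib right_diff_distrib mult.commute)
  qed
  ultimately show ?thesis by simp
qed

end

end

section \<open>Absence of atoms and conclusion\<close>

text \<open>In the inversion formula the kernel is bounded by the length of the interval, so
  interval masses are at most their length times the integral of \<open>g\<close>. Shrinking
  intervals around \<open>x\<close> then carry vanishing mass.\<close>

lemma (in real_distribution) no_atoms:
  assumes g: "integrable lborel g" "\<And>t. norm (char M t) \<le> g t"
  shows "measure M {x} = 0"
proof -
  define I where "I = (\<integral>t. g t \<partial>lborel)"
  have g0: "0 \<le> g t" for t
    using norm_ge_zero g(2) by (rule order.trans)
  have I0: "0 \<le> I"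
    unfolding I_def by (intro Bochner_Integration.integral_nonneg g0)
  have interval: "measure M {a<..b} \<le> (b - a) * I" if ab: "a \<le> b" "measure M {a} = 0" "measure M {b} = 0" for a b
  proof -
    let ?F = "\<lambda>t::real. (iexp (-(t * a)) - iexp (-(t * b))) / (\<i> * t) * char M t"
    have F: "norm (?F t) \<le> (b - a) * g t" for t
    proof (cases "t = 0")
      case False
      then have "norm ((iexp (-(t * a)) - iexp (-(t * b))) / (\<i> * t)) \<le> b - a"
        using Levy_Inversion_aux2[of "- b" "- a" t] ab by simp
      then show ?thesis
        unfolding norm_mult using g(2) ab by (intro mult_mono) auto
    qed (use ab g0 in simp)
    have bound: "norm (1 / (2 * pi) * (CLBINT t=-T..T. ?F t)) \<le> (b - a) * I" if "0 \<le> T" for T :: real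
    proof -
      have "(CLBINT t=-T..T. ?F t) = (\<integral>t. indicator {-T<..<T} t *\<^sub>R ?F t \<partial>lborel)"
        using that by (simp add: interval_lebesgue_integral_def set_lebesgue_integral_def)
      then have "norm (CLBINT t=-T..T. ?F t) \<le> (\<integral>t. norm (indicator {-T<..<T} t *\<^sub>R ?F t) \<partial>lborel)"
        by (simp only:) (rule integral_norm_bound)
      also have "\<dots> \<le> (\<integral>t. (b - a) * g t \<partial>lborel)"
        using F ab g0
        by (intro integral_mono' integrable_mult_right g(1)) (auto simp: indicator_def)
      also have "\<dots> = (b - a) * I"
        by (simp add: I_def)
      finally have 1: "norm (CLBINT t=-T..T. ?F t) \<le> (b - a) * I" .
      have "norm (1 / (2 * pi) * (CLBINT t=-T..T. ?F t)) = 1 / (2 * pi) * norm (CLBINT t=-T..T. ?F t)"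
        unfolding norm_mult by (simp add: norm_divide)
      also have "\<dots> \<le> 1 * norm (CLBINT t=-T..T. ?F t)"
        using pi_ge_two by (intro mult_right_mono) (auto simp: field_simps)
      finally show ?thesis
        using 1 by simp
    qed
    have "norm (1 / (2 * pi) * (CLBINT t=real_of_int (- int n)..real n. ?F t)) \<le> (b - a) * I" for n :: nat
      using bound[of "real n"] by simp
    then have "norm (complex_of_real (measure M {a<..b})) \<le> (b - a) * I"
      by (intro Lim_bounded[OF tendsto_norm[OF Levy_Inversion[OF ab]], of 0]) blast
    then show ?thesis by simp
  qed
  have small: "measure M {x} \<le> 2 * e * I" if e: "0 < e" for e
  proof -
    \<comment> \<open>The inversion formula requires endpoints without mass; these exist arbitrarily
      close to \<open>x\<close>, since atoms are countable and open intervals are not.\<close>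
    have non: "\<exists>a. u < a \<and> a < v \<and> measure M {a} = 0" if uv: "u < v" for u v :: real
    proof (rule ccontr)
      assume "\<nexists>a. u < a \<and> a < v \<and> measure M {a} = 0"
      then have "{u<..<v} \<subseteq> {a. measure M {a} > 0}"
        by (auto simp: zero_less_measure_iff)
      then have "countable {u<..<v}"
        using countable_atoms by (rule countable_subset)
      then show False
        using uncountable_open_interval[of u v] uv by simp
    qed
    obtain a where a: "x - e < a" "a < x" "measure M {a} = 0"
      using non[of "x - e" x] e by auto
    obtain b where b: "x < b" "b < x + e" "measure M {b} = 0"
      using non[of x "x + e"] e by auto
    have "measure M {x} \<le> measure M {a<..b}"
      using a b by (intro finite_measure_mono) auto
    also have "\<dots> \<le> (b - a) * I"
      using a b by (intro interval) auto
    also have "\<dots> \<le> 2 * e * I"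
      using a b I0 by (intro mult_right_mono) auto
    finally show ?thesis .
  qed
  have "((\<lambda>e. 2 * e * I) \<longlongrightarrow> 2 * 0 * I) (at_right 0)"
    by (intro tendsto_intros)
  moreover have "\<forall>\<^sub>F e in at_right 0. measure M {x} \<le> 2 * e * I"
    using eventually_at_right_less by eventually_elim (rule small)
  ultimately have "measure M {x} \<le> 2 * 0 * I"
    by (intro tendsto_lowerbound[of "\<lambda>e. 2 * e * I"]) auto
  then show ?thesis
    using measure_nonneg[of M "{x}"] by simp
qed

text \<open>Supplies the integrable majorant of the stable characteristic function, whose modulus is
  exp (-(|t| powr \<open>\<alpha>\<close>)).\<close>

lemma exp_powr_bound:
  fixes \<alpha> :: real
  assumes "0 < \<alpha>"
  shows "\<exists>C. \<forall>t. exp (- (\<bar>t\<bar> powr \<alpha>)) \<le> C * inverse (1 + t\<^sup>2)"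
proof -
  have "((\<lambda>t::real. (1 + t\<^sup>2) * exp (- (t powr \<alpha>))) \<longlongrightarrow> 0) at_top"
    using assms by real_asymp
  then have "\<forall>\<^sub>F t in at_top. (1 + t\<^sup>2) * exp (- (t powr \<alpha>)) < 1"
    by (intro order_tendstoD) auto
  then obtain T where T: "\<And>t::real. T \<le> t \<Longrightarrow> (1 + t\<^sup>2) * exp (- (t powr \<alpha>)) < 1"
    by (auto simp: eventually_at_top_linorder)
  have "(1 + t\<^sup>2) * exp (- (\<bar>t\<bar> powr \<alpha>)) \<le> 1 + T\<^sup>2" for t
  proof (cases "T \<le> \<bar>t\<bar>")
    case True
    have "(1 + t\<^sup>2) * exp (- (\<bar>t\<bar> powr \<alpha>)) < 1"
      using T[OF True] by (simp only: power2_abs)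
    also have "1 \<le> 1 + T\<^sup>2"
      by simp
    finally show ?thesis
      by (rule less_imp_le)
  next
    case False
    then have "\<bar>t\<bar> ^ 2 \<le> T ^ 2"
      by (intro power_mono) auto
    then have "(1 + t\<^sup>2) * exp (- (\<bar>t\<bar> powr \<alpha>)) \<le> (1 + T\<^sup>2) * 1"
      by (intro mult_mono) auto
    then show ?thesis by simp
  qed
  then have "exp (- (\<bar>t\<bar> powr \<alpha>)) \<le> (1 + T\<^sup>2) * inverse (1 + t\<^sup>2)" for t
    using add_pos_nonneg[of 1 "t\<^sup>2"] by (simp add: field_simps)
  then show ?thesis by blast
qed

lemma (in real_distribution) char_uminus: "char M (- t) = cnj (char M t)"
  unfolding char_def Bochner_Integration.integral_cnj[symmetric]
  by (simp add: exp_cnj del: Bochner_Integration.integral_cnj)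

context thaler
begin

text \<open>The expansion was made for t tending to 0 from the right only; negative arguments follow
  by complex conjugation of both sides, which flips the sign of the tangent term.\<close>

lemma char_limit:
  assumes g: "1 / 2 < \<gamma>"
  shows "(\<lambda>n. char (distr \<mu> borel (\<lambda>y. real n powr - \<gamma> * d_const \<alpha> powr - \<gamma> *
      (real (\<Sum>j<n. return_time \<gamma> y j) - real n * ell_const \<alpha>))) t) \<longlonglongrightarrow>
    exp (- complex_of_real (\<bar>t\<bar> powr \<alpha>) * (1 - \<i> * complex_of_real (sgn t * tan (\<alpha> * pi / 2))))"
    (is "(\<lambda>n. char (distr \<mu> borel (?S n)) t) \<longlonglongrightarrow> ?L t")
proof -
  have dist: "real_distribution (distr \<mu> borel (?S n))" for n
    by (rule real_distribution_distr[OF scaled_return_sum_measurable])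
  have pos: "(\<lambda>n. char (distr \<mu> borel (?S n)) s) \<longlonglongrightarrow> ?L s" if s: "0 < s" for s
  proof -
    have "char (distr \<mu> borel (?S n)) s =
        cis (- (scale s n * (real n * ell))) * (\<integral>y. cis (scale s n * real (birkhoff n y)) \<partial>\<mu>)" for n
      unfolding char_return_sum by (simp add: scale_def[OF g] ell_const_eq[OF g])
    moreover have "?L s = exp (- of_real (s powr \<alpha>) * \<zeta>)"
      using s by (simp add: \<zeta>_def[OF g])
    ultimately show ?thesis
      using char_limit_pos[OF g s] by (simp only:)
  qed
  consider "0 < t" | "t = 0" | "t < 0" by linarith
  then show ?thesis
  proof cases
    case 1
    then show ?thesis by (rule pos)
  next
    case 2
    have "char (distr \<mu> borel (?S n)) 0 = 1" for n
      using real_distribution.char_zero[OF dist] .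
    then show ?thesis
      using 2 by simp
  next
    case 3
    have "(\<lambda>n. cnj (char (distr \<mu> borel (?S n)) (- t))) \<longlonglongrightarrow> cnj (?L (- t))"
      using 3 by (intro tendsto_cnj pos) simp
    moreover have "cnj (?L (- t)) = ?L t"
      by (simp add: exp_cnj sgn_minus)
    ultimately show ?thesis
      using real_distribution.char_uminus[OF dist, of _ "- t"] by simp
  qed
qed

end

theorem theorem2p3:
  fixes \<alpha> \<gamma> :: real and N :: "'a measure" and X :: "'a \<Rightarrow> real"
  assumes "\<alpha> \<in> {0<..<1} \<union> {1<..<2}"
    and "\<gamma> = inverse \<alpha>"
    and "prob_space N"
    and "is_stable_rv N X \<alpha> 1 1"
  shows "let S = (\<lambda>(n::nat) y. real n powr (- \<gamma>) * d_const \<alpha> powr (- \<gamma>) *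
                    (real (\<Sum>j<n. return_time \<gamma> y j) - real n * ell_const \<alpha>))
         in weak_conv_m (\<lambda>n. distr (thaler_mu \<gamma>) borel (S n)) (distr N borel X) \<and>
            (\<forall>c::real. (\<lambda>n. \<P>(y in thaler_mu \<gamma>. S n y \<le> c)) \<longlonglongrightarrow> \<P>(\<omega> in N. X \<omega> \<le> c))"
proof -
  have \<alpha>: "0 < \<alpha>" "\<alpha> < 2" "\<alpha> \<noteq> 1"
    using assms(1) by auto
  have \<gamma>: "0 < \<gamma>" "\<gamma> \<noteq> 1" "1 / 2 < \<gamma>"
    unfolding assms(2) using \<alpha> by (simp_all add: field_simps)
  interpret T: thaler \<gamma>
    by standard (use \<gamma> in auto)
  have al: "T.\<alpha> = \<alpha>"
    by (simp only: T.\<alpha>_def) (simp add: assms(2))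
  define S where "S = (\<lambda>(n::nat) y. real n powr (- \<gamma>) * d_const \<alpha> powr (- \<gamma>) *
                    (real (\<Sum>j<n. return_time \<gamma> y j) - real n * ell_const \<alpha>))"
  have X: "X \<in> borel_measurable N" and char_X: "\<And>t. char (distr N borel X) t =
      exp (- complex_of_real (\<bar>t\<bar> powr \<alpha>) * (1 - \<i> * complex_of_real (sgn t * tan (\<alpha> * pi / 2))))"
    using assms(4) by (auto simp: is_stable_rv_def)
  have S: "S n \<in> borel_measurable (thaler_mu \<gamma>)" for n
    unfolding S_def by (rule T.scaled_return_sum_measurable)
  interpret X: real_distribution "distr N borel X"
    by (rule prob_space.real_distribution_distr[OF assms(3) X])
  have weak: "weak_conv_m (\<lambda>n. distr (thaler_mu \<gamma>) borel (S n)) (distr N borel X)"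
  proof (rule levy_continuity)
    show "real_distribution (distr (thaler_mu \<gamma>) borel (S n))" for n
      by (rule T.real_distribution_distr[OF S])
    show "real_distribution (distr N borel X)"
      by (rule X.real_distribution_axioms)
    show "(\<lambda>n. char (distr (thaler_mu \<gamma>) borel (S n)) t) \<longlonglongrightarrow> char (distr N borel X) t" for t
      unfolding char_X S_def using T.char_limit[OF \<gamma>(3), of t] unfolding al by simp
  qed
  obtain C where C: "\<And>t. exp (- (\<bar>t\<bar> powr \<alpha>)) \<le> C * inverse (1 + t\<^sup>2)"
    using exp_powr_bound[OF \<alpha>(1)] by blast
  \<comment> \<open>Weak convergence gives convergence of distribution functions at continuity
    points of the limit; without atoms every real threshold is one.\<close>
  have atom: "measure (distr N borel X) {c} = 0" for c
  proof (rule X.no_atoms)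
    show "integrable lborel (\<lambda>t. C * inverse (1 + t\<^sup>2))"
      using integrable_inverse_1_plus_square by (intro integrable_mult_right) (simp add: set_integrable_def)
    show "norm (char (distr N borel X) t) \<le> C * inverse (1 + t\<^sup>2)" for t
      using C[of t] by (simp add: char_X norm_exp_eq_Re)
  qed
  have cdf_S: "cdf (distr (thaler_mu \<gamma>) borel (S n)) c = \<P>(y in thaler_mu \<gamma>. S n y \<le> c)" for n c
    unfolding cdf_def using S by (subst measure_distr) (auto intro!: arg_cong[where f = "measure _"])
  have cdf_X: "cdf (distr N borel X) c = \<P>(\<omega> in N. X \<omega> \<le> c)" for c
    unfolding cdf_def using X by (subst measure_distr) (auto intro!: arg_cong[where f = "measure _"])
  have "(\<lambda>n. \<P>(y in thaler_mu \<gamma>. S n y \<le> c)) \<longlonglongrightarrow> \<P>(\<omega> in N. X \<omega> \<le> c)" for c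
    using weak X.isCont_cdf[of c] atom[of c] unfolding weak_conv_m_def weak_conv_def cdf_S cdf_X
    by (simp add: cdf_X)
  with weak show ?thesis
    unfolding S_def[symmetric] Let_def by blast
qed

end
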